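(* Let $\Omega\subset\mathbb{R}^n$ be a bounded open set with Lipschitz boundary, let $0<\lambda\le\Lambda<\infty$ and $(\psi_k)_k\subset\mathcal G(\lambda,\Lambda)$. Assume that $(u_k)_k\subset BV(\Omega)$ and $u\in BV(\Omega;T)$ satisfy $u_k\to u$ strongly in $L^1(\Omega)$ as $k\to\infty$. Then, for all $\varepsilon\in(0,1)$ there exists a sequence $(v^\varepsilon_k)_k\subset BV(\Omega;T)$ such that $$(1-\varepsilon)\int_\Omega\psi_k\Big(y,\frac{\mathrm dDv^\varepsilon_k}{\mathrm d|Dv^\varepsilon_k|}(y)\Big)\mathrm d|Dv^\varepsilon_k|(y)\le\int_\Omega\psi_k\Big(y,\frac{\mathrm dDu_k}{\mathrm d|Du_k|}(y)\Big)\mathrm d|Du_k|(y)\quad\text{for all }k\in\mathbb N,$$ and $$v^\varepsilon_k\to u\quad\text{strongly in }L^1(\Omega)\text{ as }k\to\infty.$$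
   Context: $T=\{c_1,\dots,c_M\}\subset\mathbb{R}$ with $c_1<\dots<c_M$ is a fixed finite set. $BV(\Omega;T)$ is the set of measurable $u\colon\Omega\to T$ whose distributional derivative $Du$ is a finite $\mathbb{R}^n$-valued Radon measure on $\Omega$; $\frac{\mathrm dDu}{\mathrm d|Du|}$ is the Radon–Nikodym derivative of $Du$ with respect to its total variation $|Du|$. $\mathcal G(\lambda,\Lambda)$ is the class of $\psi\colon\mathbb{R}^n\times\mathbb{R}^n\to[0,\infty)$ such that (i) $\psi$ is continuous; (ii) $\xi\mapsto\psi(x,\xi)$ is convex and positively 1-homogeneous for every $x\in\mathbb{R}^n$; (iii) $\lambda|\xi|\le\psi(x,\xi)\le\Lambda|\xi|$ for all $(x,\xi)\in\mathbb{R}^n\times\mathbb{R}^n$. *)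

theory Defs
  imports "HOL-Analysis.Analysis"
begin

section \<open>Finite vector-valued measures\<close>

text \<open>A finite vector-valued measure on the measurable space of M is a countably additive
  set function on \<open>sets M\<close>; its values on other sets play no role. Only \<open>space M\<close> and
  \<open>sets M\<close> matter here, not the measure carried by M.\<close>

definition vector_measure :: "'a measure \<Rightarrow> ('a set \<Rightarrow> 'b::real_normed_vector) \<Rightarrow> bool" where
  "vector_measure M \<mu> \<longleftrightarrow> \<mu> {} = 0 \<and>
     (\<forall>A :: nat \<Rightarrow> 'a set. range A \<subseteq> sets M \<and> disjoint_family A \<longrightarrow>
        (\<lambda>i. \<mu> (A i)) sums \<mu> (\<Union>i. A i))"

definition variation_on :: "'a measure \<Rightarrow> ('a set \<Rightarrow> 'b::real_normed_vector) \<Rightarrow> 'a set \<Rightarrow> ennreal"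
  where "variation_on M \<mu> B =
    (SUP A \<in> {A :: nat \<Rightarrow> 'a set. range A \<subseteq> sets M \<and> disjoint_family A \<and> (\<Union>i. A i) = B}.
       \<Sum>i. ennreal (norm (\<mu> (A i))))"

text \<open>The total variation \<open>\<bar>\<mu>\<bar>\<close>, packaged as a positive measure.  If \<open>\<mu>\<close> is a vector measure,
  \<open>variation_on M \<mu>\<close> is countably additive on \<open>sets M\<close>, so that the emeasure of the result
  agrees with it there.\<close>

definition total_variation :: "'a measure \<Rightarrow> ('a set \<Rightarrow> 'b::real_normed_vector) \<Rightarrow> 'a measure" where
  "total_variation M \<mu> = measure_of (space M) (sets M) (variation_on M \<mu>)"

text \<open>The density \<open>d\<mu>/d\<nu>\<close> of a vector measure with respect to a positive measure; it is
  determined up to \<open>\<nu>\<close>-null sets.\<close>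

definition vec_RN_deriv ::
    "'a measure \<Rightarrow> ('a set \<Rightarrow> 'b::euclidean_space) \<Rightarrow> 'a \<Rightarrow> 'b" where
  "vec_RN_deriv \<nu> \<mu> =
     (SOME f. integrable \<nu> f \<and> (\<forall>A\<in>sets \<nu>. \<mu> A = (LINT x:A|\<nu>. f x)))"

text \<open>The integral of a scalar function against \<open>\<mu>\<close>, by means of the polar decomposition
  \<open>\<mu> = (d\<mu>/d\<bar>\<mu>\<bar>) \<bar>\<mu>\<bar>\<close>.\<close>

definition vec_integral ::
    "'a measure \<Rightarrow> ('a set \<Rightarrow> 'b::euclidean_space) \<Rightarrow> ('a \<Rightarrow> real) \<Rightarrow> 'b" where
  "vec_integral M \<mu> \<phi> =
     (LINT x|total_variation M \<mu>. \<phi> x *\<^sub>R vec_RN_deriv (total_variation M \<mu>) \<mu> x)"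


section \<open>Test functions and distributional derivatives\<close>

definition partial :: "'n::finite \<Rightarrow> (real^'n \<Rightarrow> real) \<Rightarrow> real^'n \<Rightarrow> real" where
  "partial i f x = frechet_derivative f (at x) (axis i 1)"

primrec C_k :: "nat \<Rightarrow> (real^'n::finite \<Rightarrow> real) \<Rightarrow> bool" where
  "C_k 0 f \<longleftrightarrow> continuous_on UNIV f"
| "C_k (Suc k) f \<longleftrightarrow> (\<forall>x. f differentiable (at x)) \<and> (\<forall>i. C_k k (partial i f))"

definition test_fun :: "(real^'n::finite) set \<Rightarrow> (real^'n \<Rightarrow> real) \<Rightarrow> bool" where
  "test_fun \<Omega> \<phi> \<longleftrightarrow> (\<forall>k. C_k k \<phi>) \<and>
     compact (closure {x. \<phi> x \<noteq> 0}) \<and> closure {x. \<phi> x \<noteq> 0} \<subseteq> \<Omega>"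

abbreviation borel_on :: "(real^'n::finite) set \<Rightarrow> (real^'n) measure" where
  "borel_on \<Omega> \<equiv> restrict_space borel \<Omega>"

text \<open>The distributional derivative of u is the finite vector-valued Radon measure \<open>\<mu>\<close>.
  On an open subset of Euclidean space every finite Borel measure is Radon.\<close>

definition has_distr_deriv ::
    "(real^'n::finite) set \<Rightarrow> (real^'n \<Rightarrow> real) \<Rightarrow> ((real^'n) set \<Rightarrow> real^'n) \<Rightarrow> bool" where
  "has_distr_deriv \<Omega> u \<mu> \<longleftrightarrow> vector_measure (borel_on \<Omega>) \<mu> \<and>
     (\<forall>\<phi> i. test_fun \<Omega> \<phi> \<longrightarrow>
        (LINT x|lebesgue_on \<Omega>. u x * partial i \<phi> x) = - (vec_integral (borel_on \<Omega>) \<mu> \<phi> $ i))"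

text \<open>On the Borel subsets of an open \<open>\<Omega>\<close> the measure \<open>Du\<close> is unique.\<close>

definition distr_deriv ::
    "(real^'n::finite) set \<Rightarrow> (real^'n \<Rightarrow> real) \<Rightarrow> (real^'n) set \<Rightarrow> real^'n" where
  "distr_deriv \<Omega> u = (SOME \<mu>. has_distr_deriv \<Omega> u \<mu>)"


section \<open>Functions of bounded variation\<close>

text \<open>Functions on \<open>\<Omega>\<close> are represented by total functions whose values outside \<open>\<Omega>\<close> are
  irrelevant.\<close>

definition BV :: "(real^'n::finite) set \<Rightarrow> (real^'n \<Rightarrow> real) set" where
  "BV \<Omega> = {u. integrable (lebesgue_on \<Omega>) u \<and> (\<exists>\<mu>. has_distr_deriv \<Omega> u \<mu>)}"

definition BV_into :: "(real^'n::finite) set \<Rightarrow> real set \<Rightarrow> (real^'n \<Rightarrow> real) set" where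
  "BV_into \<Omega> T = {u. u \<in> borel_measurable (lebesgue_on \<Omega>) \<and> (\<forall>x\<in>\<Omega>. u x \<in> T) \<and>
     (\<exists>\<mu>. has_distr_deriv \<Omega> u \<mu>)}"

definition var_deriv ::
    "(real^'n::finite) set \<Rightarrow> (real^'n \<Rightarrow> real) \<Rightarrow> (real^'n) measure" where
  "var_deriv \<Omega> u = total_variation (borel_on \<Omega>) (distr_deriv \<Omega> u)"

definition energy ::
    "(real^'n \<Rightarrow> real^'n \<Rightarrow> real) \<Rightarrow> (real^'n::finite) set \<Rightarrow> (real^'n \<Rightarrow> real) \<Rightarrow> real" where
  "energy \<psi> \<Omega> u =
     (LINT y|var_deriv \<Omega> u. \<psi> y (vec_RN_deriv (var_deriv \<Omega> u) (distr_deriv \<Omega> u) y))"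

definition L1_converges ::
    "(real^'n::finite) set \<Rightarrow> (nat \<Rightarrow> real^'n \<Rightarrow> real) \<Rightarrow> (real^'n \<Rightarrow> real) \<Rightarrow> bool" where
  "L1_converges \<Omega> f g \<longleftrightarrow>
     (\<forall>k. integrable (lebesgue_on \<Omega>) (f k)) \<and> integrable (lebesgue_on \<Omega>) g \<and>
     (\<lambda>k. LINT x|lebesgue_on \<Omega>. \<bar>f k x - g x\<bar>) \<longlonglongrightarrow> 0"


section \<open>Integrands and domains\<close>

definition class_G :: "real \<Rightarrow> real \<Rightarrow> (real^'n::finite \<Rightarrow> real^'n \<Rightarrow> real) set" where
  "class_G l L = {\<psi>.
     (\<forall>x \<xi>. 0 \<le> \<psi> x \<xi>) \<and>
     continuous_on UNIV (\<lambda>(x, \<xi>). \<psi> x \<xi>) \<and>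
     (\<forall>x. convex_on UNIV (\<psi> x)) \<and>
     (\<forall>x \<xi> t. 0 < t \<longrightarrow> \<psi> x (t *\<^sub>R \<xi>) = t * \<psi> x \<xi>) \<and>
     (\<forall>x \<xi>. l * norm \<xi> \<le> \<psi> x \<xi> \<and> \<psi> x \<xi> \<le> L * norm \<xi>)}"

text \<open>Near each boundary point \<open>\<Omega>\<close> is the strict epigraph, in some direction e, of a Lipschitz
  function g defined on the hyperplane orthogonal to e.  This is the usual definition by
  rotated coordinates, written without choosing the coordinates.\<close>

definition lipschitz_boundary :: "(real^'n::finite) set \<Rightarrow> bool" where
  "lipschitz_boundary \<Omega> \<longleftrightarrow> (\<forall>x\<in>frontier \<Omega>. \<exists>r>0. \<exists>e g C. norm e = 1 \<and>
     C-lipschitz_on {z. z \<bullet> e = 0} g \<and>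
     \<Omega> \<inter> ball x r = {y \<in> ball x r. g (y - (y \<bullet> e) *\<^sub>R e) < y \<bullet> e})"

end

theory Submission imports Defs "HOL-Probability.Probability" begin

text \<open>Let \<open>V w\<close> be the supremum of \<open>- \<integral> w div \<phi>\<close> over test fields with
  \<open>\<phi> x \<bullet> \<xi> \<le> \<psi> x \<xi>\<close>. It is lower semicontinuous in \<open>L\<^sup>1\<close>, and it is
  subadditive under truncation, with the good sign:
  \<open>V (min w t) + V (max (w - t) 0) \<le> V w\<close>. Indeed, the constraint on \<open>\<phi>\<close> is
  convex, so for smooth w the field \<open>(1 - q' w) \<phi>1 + q' w \<phi>2\<close> is a competitor for \<open>V w\<close> if
  \<open>\<phi>1\<close>, \<open>\<phi>2\<close> are competitors and \<open>0 \<le> q' \<le> 1\<close>, q being a smooth approximation of \<open>max (\<cdot> - t) 0\<close>. This replaces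
  the coarea formula: dividing \<open>[a, b]\<close> into N equal parts, one of them carries at most the
  fraction 1/N of the variation of w between the levels a and b, and the limit \<open>N \<rightarrow> \<infinity>\<close> gives
  a set A with \<open>{w > b} \<subseteq> A \<subseteq> {w \<ge> a}\<close> and \<open>(b - a) V 1\<^sub>A\<close> at most that variation.

  Taking \<open>[a\<^sub>i, b\<^sub>i]\<close> inside \<open>[c\<^sub>i, c\<^sub>i\<^sub>+\<^sub>1]\<close>, shrunk by the factor \<open>1 - \<epsilon>\<close>,
  the function \<open>v = c\<^sub>0 + \<Sum>i. (c\<^sub>i\<^sub>+\<^sub>1 - c\<^sub>i) 1\<^sub>A\<^sub>i\<close> satisfies
  \<open>(1 - \<epsilon>) V v \<le> V w\<close> and equals \<open>c\<^sub>m\<close> wherever w is close to \<open>c\<^sub>m\<close>; Chebyshev's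
  inequality then gives the convergence. Finally V is the energy on functions with a derivative
  measure, and functions with finite V have one.\<close>

section \<open>Total variation of vector measures\<close>

text \<open>The energy is computed from the polar density of a derivative measure, whereas the
  selection of level sets needs a quantity that survives \<open>L\<^sup>1\<close> limits. This is
  why V is built from pairings alone. Three bridges result: the energy bounds V by pointwise
  duality; V bounds the energy, which requires nearly optimal fields although the density is merely
  measurable; and finite V produces a derivative measure, a statement of Riesz type obtained from
  weak limits of mollified derivatives. The dependence of \<psi> on x obstructs mollification, since
  a mollified field inherits the constraints of neighbouring points. The lower bound
  \<open>l * norm \<xi>\<close> turns uniform continuity into a factor \<open>1 + \<delta>\<close>
  that tends to 1. The factor \<open>1 - \<epsilon>\<close> is the ratio of the shrunken interval to
  the gap \<open>c (Suc i) - c i\<close>: a share \<open>\<epsilon> / 2\<close> is removed at each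
  end. These margins do not depend on k. Hence neither does the constant with which
  \<open>u k - u0\<close> controls \<open>v k - u0\<close>, although the selected levels vary with k
  in an uncontrolled way.\<close>

lemma vector_measure_Un:
  assumes "vector_measure M \<mu>" "A \<in> sets M" "B \<in> sets M" "A \<inter> B = {}"
  shows "\<mu> (A \<union> B) = \<mu> A + \<mu> B"
proof -
  have r: "range (binaryset A B) \<subseteq> sets M" "disjoint_family (binaryset A B)"
    using assms by (auto simp: range_binaryset_eq disjoint_family_on_def binaryset_def)
  then have "(\<lambda>i. \<mu> (binaryset A B i)) sums \<mu> (\<Union>i. binaryset A B i)"
    using assms(1) by (auto simp: vector_measure_def)
  moreover have "(\<lambda>i. \<mu> (binaryset A B i)) sums (\<mu> A + \<mu> B)"
    using assms(1) binaryset_sums[of \<mu> A B] by (auto simp: vector_measure_def)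
  ultimately show ?thesis by (metis UN_binaryset_eq sums_unique2)
qed

lemma vector_measure_finite_UN:
  assumes "vector_measure M \<mu>" "finite I" "\<And>i. i \<in> I \<Longrightarrow> A i \<in> sets M" "disjoint_family_on A I"
  shows "\<mu> (\<Union>i\<in>I. A i) = (\<Sum>i\<in>I. \<mu> (A i))"
  using assms(2,3,4)
proof (induction I rule: finite_induct)
  case empty then show ?case using assms(1) by (simp add: vector_measure_def)
next
  case (insert x F)
  have "A x \<inter> (\<Union>i\<in>F. A i) = {}"
    using insert.prems(2) insert.hyps(2) by (fastforce simp: disjoint_family_on_def)
  moreover have "(\<Union>i\<in>F. A i) \<in> sets M" using insert by (intro sets.finite_UN) auto
  ultimately have "\<mu> (A x \<union> (\<Union>i\<in>F. A i)) = \<mu> (A x) + \<mu> (\<Union>i\<in>F. A i)"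
    using insert.prems by (intro vector_measure_Un[OF assms(1)]) auto
  with insert show ?case by (auto simp: disjoint_family_on_def)
qed

lemma variation_on_upper:
  assumes "range A \<subseteq> sets M" "disjoint_family A" "(\<Union>i. A i) = B"
  shows "(\<Sum>i. ennreal (norm (\<mu> (A i)))) \<le> variation_on M \<mu> B"
  unfolding variation_on_def using assms by (intro SUP_upper) auto

lemma norm_le_variation_on:
  assumes "B \<in> sets M" "\<mu> {} = 0"
  shows "ennreal (norm (\<mu> B)) \<le> variation_on M \<mu> B"
proof -
  have "(\<lambda>i. ennreal (norm (\<mu> (binaryset B {} i)))) sums (ennreal (norm (\<mu> B)) + ennreal (norm (\<mu> {})))"
    using binaryset_sums[of "\<lambda>A. ennreal (norm (\<mu> A))" B "{}"] assms by simp
  then have "(\<Sum>i. ennreal (norm (\<mu> (binaryset B {} i)))) = ennreal (norm (\<mu> B))"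
    using assms by (simp add: sums_iff)
  moreover have "(\<Sum>i. ennreal (norm (\<mu> (binaryset B {} i)))) \<le> variation_on M \<mu> B"
    using assms by (intro variation_on_upper) (auto simp: range_binaryset_eq UN_binaryset_eq disjoint_family_on_def binaryset_def)
  ultimately show ?thesis by simp
qed

text \<open>Interleaving a partition of A with one of B, at even and odd indices, gives a partition
  of the union. So the sum of any two competitors is bounded by the supremum for the union.\<close>

lemma variation_on_superadd:
  assumes "A \<in> sets M" "B \<in> sets M" "A \<inter> B = {}" "\<mu> {} = 0"
  shows "variation_on M \<mu> A + variation_on M \<mu> B \<le> variation_on M \<mu> (A \<union> B)"
proof -
  have key: "(\<Sum>i. ennreal (norm (\<mu> (F i)))) + (\<Sum>i. ennreal (norm (\<mu> (G i)))) \<le> variation_on M \<mu> (A \<union> B)"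
    if F: "range F \<subseteq> sets M" "disjoint_family F" "(\<Union>i. F i) = A"
     and G: "range G \<subseteq> sets M" "disjoint_family G" "(\<Union>i. G i) = B" for F G :: "nat \<Rightarrow> 'a set"
  proof -
    define H where "H n = (if even n then F (n div 2) else G (n div 2))" for n :: nat
    have inter: "F i \<inter> G j = {}" for i j using F(3) G(3) assms(3) by blast
    have disj: "disjoint_family H"
      unfolding disjoint_family_on_def
    proof (intro ballI impI)
      fix m n :: nat assume "m \<noteq> n"
      moreover have "m div 2 \<noteq> n div 2" if "even m \<longleftrightarrow> even n" using that \<open>m \<noteq> n\<close> by presburger
      ultimately show "H m \<inter> H n = {}"
        using F(2) G(2) inter[of "m div 2" "n div 2"] inter[of "n div 2" "m div 2"] unfolding H_def disjoint_family_on_def by auto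
    qed
    have un: "(\<Union>i. H i) = A \<union> B"
    proof
      show "(\<Union>i. H i) \<subseteq> A \<union> B" using F(3) G(3) by (auto simp: H_def split: if_splits)
      have "F i \<subseteq> (\<Union>i. H i)" for i using H_def[of "2*i"] by auto
      moreover have "G i \<subseteq> (\<Union>i. H i)" for i using H_def[of "2*i+1"] by auto
      ultimately show "A \<union> B \<subseteq> (\<Union>i. H i)" using F(3) G(3) by blast
    qed
    have le: "(\<Sum>i<n. ennreal (norm (\<mu> (F i)))) + (\<Sum>i<n. ennreal (norm (\<mu> (G i)))) \<le> (\<Sum>i. ennreal (norm (\<mu> (H i))))" for n
    proof -
      have "(\<Sum>i<n. ennreal (norm (\<mu> (F i)))) + (\<Sum>i<n. ennreal (norm (\<mu> (G i)))) = (\<Sum>i<2*n. ennreal (norm (\<mu> (H i))))"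
      proof (induction n)
        case (Suc n)
        then show ?case by (simp add: H_def algebra_simps)
      qed simp
      also have "\<dots> \<le> (\<Sum>i. ennreal (norm (\<mu> (H i))))" by (intro sum_le_suminf) auto
      finally show ?thesis .
    qed
    have "(\<lambda>n. (\<Sum>i<n. ennreal (norm (\<mu> (F i)))) + (\<Sum>i<n. ennreal (norm (\<mu> (G i)))))
        \<longlonglongrightarrow> (\<Sum>i. ennreal (norm (\<mu> (F i)))) + (\<Sum>i. ennreal (norm (\<mu> (G i))))"
      by (intro tendsto_intros summable_LIMSEQ) auto
    from LIMSEQ_le_const2[OF this] le
    have "(\<Sum>i. ennreal (norm (\<mu> (F i)))) + (\<Sum>i. ennreal (norm (\<mu> (G i)))) \<le> (\<Sum>i. ennreal (norm (\<mu> (H i))))" by blast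
    also have "\<dots> \<le> variation_on M \<mu> (A \<union> B)"
    proof (intro variation_on_upper disj un)
      show "range H \<subseteq> sets M" using F(1) G(1) by (auto simp: H_def)
    qed
    finally show ?thesis .
  qed
  let ?PA = "{F :: nat \<Rightarrow> 'a set. range F \<subseteq> sets M \<and> disjoint_family F \<and> (\<Union>i. F i) = A}"
  let ?PB = "{F :: nat \<Rightarrow> 'a set. range F \<subseteq> sets M \<and> disjoint_family F \<and> (\<Union>i. F i) = B}"
  have ne: "binaryset X {} \<in> {F. range F \<subseteq> sets M \<and> disjoint_family F \<and> (\<Union>i. F i) = X}" if "X \<in> sets M" for X
    using that by (auto simp: range_binaryset_eq UN_binaryset_eq disjoint_family_on_def binaryset_def)
  have neA: "?PA \<noteq> {}" using ne[OF assms(1)] by (metis (no_types, lifting) empty_iff)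
  have neB: "?PB \<noteq> {}" using ne[OF assms(2)] by (metis (no_types, lifting) empty_iff)
  have "variation_on M \<mu> A + variation_on M \<mu> B =
     (SUP F\<in>?PA. (\<Sum>i. ennreal (norm (\<mu> (F i)))) + variation_on M \<mu> B)"
    unfolding variation_on_def[of M \<mu> A] by (rule ennreal_SUP_add_left[OF neA, symmetric])
  also have "\<dots> \<le> variation_on M \<mu> (A \<union> B)"
  proof (rule SUP_least)
    fix F assume F: "F \<in> ?PA"
    have "(\<Sum>i. ennreal (norm (\<mu> (F i)))) + variation_on M \<mu> B =
      (SUP G\<in>?PB. (\<Sum>i. ennreal (norm (\<mu> (F i)))) + (\<Sum>i. ennreal (norm (\<mu> (G i)))))"
      unfolding variation_on_def[of M \<mu> B] add.commute[of "\<Sum>i. ennreal (norm (\<mu> (F i)))"]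
      by (rule ennreal_SUP_add_left[OF neB, symmetric])
    also have "\<dots> \<le> variation_on M \<mu> (A \<union> B)"
      using F by (intro SUP_least key) auto
    finally show "(\<Sum>i. ennreal (norm (\<mu> (F i)))) + variation_on M \<mu> B \<le> variation_on M \<mu> (A \<union> B)" .
  qed
  finally show ?thesis .
qed

lemma norm_sums_le_suminf_ennreal:
  fixes f :: "nat \<Rightarrow> 'b::real_normed_vector"
  assumes "f sums s"
  shows "ennreal (norm s) \<le> (\<Sum>i. ennreal (norm (f i)))"
proof (rule LIMSEQ_le_const2)
  show "(\<lambda>n. ennreal (norm (\<Sum>i<n. f i))) \<longlonglongrightarrow> ennreal (norm s)"
    using assms unfolding sums_def by (intro tendsto_intros)
  have "ennreal (norm (\<Sum>i<n. f i)) \<le> (\<Sum>i. ennreal (norm (f i)))" for n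
  proof -
    have "ennreal (norm (\<Sum>i<n. f i)) \<le> ennreal (\<Sum>i<n. norm (f i))" by (intro ennreal_leI norm_sum)
    also have "\<dots> = (\<Sum>i<n. ennreal (norm (f i)))" by simp
    also have "\<dots> \<le> (\<Sum>i. ennreal (norm (f i)))" by (intro sum_le_suminf) auto
    finally show ?thesis .
  qed
  then show "\<exists>N. \<forall>n\<ge>N. ennreal (norm (\<Sum>i<n. f i)) \<le> (\<Sum>i. ennreal (norm (f i)))" by blast
qed

text \<open>A partition of the union is refined by the sets \<open>B k\<close>. Countable additivity
  of \<mu> bounds each cell by its pieces, and the pieces regrouped by k form partitions of the
  \<open>B k\<close>.\<close>

lemma variation_on_countable_subadd:
  assumes \<mu>: "vector_measure M \<mu>" and B: "range B \<subseteq> sets M" "disjoint_family B"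
  shows "variation_on M \<mu> (\<Union>k. B k) \<le> (\<Sum>k. variation_on M \<mu> (B k))"
  unfolding variation_on_def[of M \<mu> "\<Union>k. B k"]
proof (rule SUP_least, clarify)
  fix A :: "nat \<Rightarrow> 'a set" assume A: "range A \<subseteq> sets M" "disjoint_family A" "(\<Union>i. A i) = (\<Union>k. B k)"
  have "(\<Sum>i. ennreal (norm (\<mu> (A i)))) \<le> (\<Sum>i. \<Sum>k. ennreal (norm (\<mu> (A i \<inter> B k))))"
  proof (intro suminf_le)
    fix i
    have "A i = (\<Union>k. A i \<inter> B k)" using A(3) by auto
    moreover have "(\<lambda>k. \<mu> (A i \<inter> B k)) sums \<mu> (\<Union>k. A i \<inter> B k)"
    proof -
      have "range (\<lambda>k. A i \<inter> B k) \<subseteq> sets M" using A B by auto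
      moreover have "disjoint_family (\<lambda>k. A i \<inter> B k)" using B(2) by (fastforce simp: disjoint_family_on_def)
      ultimately show ?thesis using \<mu> unfolding vector_measure_def by blast
    qed
    ultimately show "ennreal (norm (\<mu> (A i))) \<le> (\<Sum>k. ennreal (norm (\<mu> (A i \<inter> B k))))"
      using norm_sums_le_suminf_ennreal by metis
  qed auto
  also have "\<dots> = (\<Sum>k. \<Sum>i. ennreal (norm (\<mu> (A i \<inter> B k))))"
  proof -
    \<comment> \<open>The order of the two series is exchanged by writing one of them as an integral
      over the counting measure.\<close>
    have "(\<Sum>i. \<Sum>k. ennreal (norm (\<mu> (A i \<inter> B k)))) = (\<integral>\<^sup>+i. (\<Sum>k. ennreal (norm (\<mu> (A i \<inter> B k)))) \<partial>count_space UNIV)"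
      by (rule nn_integral_count_space_nat[symmetric])
    also have "\<dots> = (\<Sum>k. \<integral>\<^sup>+i. ennreal (norm (\<mu> (A i \<inter> B k))) \<partial>count_space UNIV)"
      by (rule nn_integral_suminf) auto
    finally show ?thesis by (simp add: nn_integral_count_space_nat)
  qed
  also have "\<dots> \<le> (\<Sum>k. variation_on M \<mu> (B k))"
  proof (intro suminf_le variation_on_upper)
    fix k
    show "range (\<lambda>i. A i \<inter> B k) \<subseteq> sets M" using A B by auto
    show "disjoint_family (\<lambda>i. A i \<inter> B k)" using A(2) by (fastforce simp: disjoint_family_on_def)
    show "(\<Union>i. A i \<inter> B k) = B k" using A(3) by auto
  qed auto
  finally show "(\<Sum>i. ennreal (norm (\<mu> (A i)))) \<le> (\<Sum>k. variation_on M \<mu> (B k))" .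
qed

lemma variation_on_mono:
  assumes "A \<subseteq> B" "A \<in> sets M" "B \<in> sets M" "\<mu> {} = 0"
  shows "variation_on M \<mu> A \<le> variation_on M \<mu> B"
proof -
  have "variation_on M \<mu> A + variation_on M \<mu> (B - A) \<le> variation_on M \<mu> (A \<union> (B - A))"
    using assms by (intro variation_on_superadd) auto
  moreover have "A \<union> (B - A) = B" using assms by auto
  ultimately show ?thesis by (metis add_increasing2 le_iff_add order_trans zero_le)
qed

lemma variation_on_empty:
  fixes M :: "'a measure" and \<mu> :: "'a set \<Rightarrow> 'b::real_normed_vector"
  assumes 0: "\<mu> {} = 0"
  shows "variation_on M \<mu> {} = 0"
proof -
  have "(\<Sum>i. ennreal (norm (\<mu> (A i)))) = 0" if "(\<Union>i. A i) = {}" for A :: "nat \<Rightarrow> 'a set"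
  proof -
    have "A i = {}" for i using that by auto
    then show ?thesis using 0 by simp
  qed
  then have "variation_on M \<mu> {} \<le> 0" unfolding variation_on_def by (intro SUP_least) auto
  then show ?thesis by simp
qed

text \<open>Superadditivity on finite unions gives one inequality, refinement of partitions the
  other.\<close>

lemma countably_additive_variation_on:
  assumes \<mu>: "vector_measure M \<mu>"
  shows "countably_additive (sets M) (variation_on M \<mu>)"
  unfolding countably_additive_def
proof (intro allI impI)
  have 0: "\<mu> {} = 0" using \<mu> by (simp add: vector_measure_def)
  fix B :: "nat \<Rightarrow> 'a set" assume B: "range B \<subseteq> sets M" "disjoint_family B" "(\<Union>i. B i) \<in> sets M"
  have fin: "(\<Sum>i<n. variation_on M \<mu> (B i)) \<le> variation_on M \<mu> (\<Union>i<n. B i)" for n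
  proof (induction n)
    case 0 then show ?case by simp
  next
    case (Suc n)
    have "(\<Sum>i<Suc n. variation_on M \<mu> (B i)) \<le> variation_on M \<mu> (\<Union>i<n. B i) + variation_on M \<mu> (B n)"
      using Suc by (simp add: add_right_mono)
    also have "\<dots> \<le> variation_on M \<mu> ((\<Union>i<n. B i) \<union> B n)"
    proof (intro variation_on_superadd)
      show "(\<Union>i<n. B i) \<inter> B n = {}" using B(2) by (auto simp: disjoint_family_on_def) (metis IntI empty_iff less_irrefl)
    qed (use B 0 in auto)
    also have "(\<Union>i<n. B i) \<union> B n = (\<Union>i<Suc n. B i)" by (auto simp: lessThan_Suc)
    finally show ?case .
  qed
  have "(\<Sum>i. variation_on M \<mu> (B i)) \<le> variation_on M \<mu> (\<Union>i. B i)"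
  proof (rule suminf_le_const)
    fix n
    show "(\<Sum>i<n. variation_on M \<mu> (B i)) \<le> variation_on M \<mu> (\<Union>i. B i)"
      using fin[of n] B 0 by (rule_tac order_trans[OF fin]) (intro variation_on_mono, auto)
  qed auto
  with variation_on_countable_subadd[OF \<mu> B(1,2)]
  show "(\<Sum>i. variation_on M \<mu> (B i)) = variation_on M \<mu> (\<Union>i. B i)" by (simp add: antisym)
qed

lemma sets_total_variation [simp, measurable_cong]: "sets (total_variation M \<mu>) = sets M"
  unfolding total_variation_def by simp

lemma space_total_variation [simp]: "space (total_variation M \<mu>) = space M"
  unfolding total_variation_def by (simp add: sets.space_closed)

lemma emeasure_total_variation:
  assumes "vector_measure M \<mu>" "A \<in> sets M"
  shows "emeasure (total_variation M \<mu>) A = variation_on M \<mu> A"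
  unfolding total_variation_def
proof (rule emeasure_measure_of_sigma)
  show "sigma_algebra (space M) (sets M)" by (rule sets.sigma_algebra_axioms)
  show "positive (sets M) (variation_on M \<mu>)"
    using assms(1) by (auto simp: positive_def variation_on_empty vector_measure_def)
qed (use assms countably_additive_variation_on in auto)


text \<open>Passing to the coordinate with the largest sum of absolute values costs the factor
  \<open>DIM('b)\<close>. Keeping only the terms of one sign in that coordinate, where nothing
  cancels, costs the factor 2.\<close>

lemma sum_norm_le_subset_norm:
  fixes x :: "'a \<Rightarrow> 'b::euclidean_space"
  assumes "finite I"
  shows "\<exists>S\<subseteq>I. (\<Sum>i\<in>I. norm (x i)) \<le> 2 * real DIM('b) * norm (\<Sum>i\<in>S. x i)"
proof -
  have one: "\<exists>S\<subseteq>I. (\<Sum>i\<in>I. \<bar>x i \<bullet> b\<bar>) \<le> 2 * norm (\<Sum>i\<in>S. x i)" if b: "b \<in> Basis" for b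
  proof -
    let ?P = "{i\<in>I. x i \<bullet> b \<ge> 0}" and ?N = "{i\<in>I. x i \<bullet> b < 0}"
    have "(\<Sum>i\<in>I. \<bar>x i \<bullet> b\<bar>) = (\<Sum>i\<in>?P. \<bar>x i \<bullet> b\<bar>) + (\<Sum>i\<in>?N. \<bar>x i \<bullet> b\<bar>)"
      using assms by (subst sum.union_disjoint[symmetric]) (auto intro!: sum.cong)
    also have "(\<Sum>i\<in>?P. \<bar>x i \<bullet> b\<bar>) = (\<Sum>i\<in>?P. x i) \<bullet> b"
      by (subst inner_sum_left) (auto intro!: sum.cong)
    also have "(\<Sum>i\<in>?N. \<bar>x i \<bullet> b\<bar>) = - ((\<Sum>i\<in>?N. x i) \<bullet> b)"
      by (subst inner_sum_left) (auto simp: sum_negf[symmetric] intro!: sum.cong)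
    finally have eq: "(\<Sum>i\<in>I. \<bar>x i \<bullet> b\<bar>) = (\<Sum>i\<in>?P. x i) \<bullet> b + - ((\<Sum>i\<in>?N. x i) \<bullet> b)" .
    have "(\<Sum>i\<in>?P. x i) \<bullet> b \<le> norm (\<Sum>i\<in>?P. x i)" "- ((\<Sum>i\<in>?N. x i) \<bullet> b) \<le> norm (\<Sum>i\<in>?N. x i)"
      using Basis_le_norm[OF b, of "\<Sum>i\<in>?P. x i"] Basis_le_norm[OF b, of "\<Sum>i\<in>?N. x i"] by linarith+
    then have "(\<Sum>i\<in>I. \<bar>x i \<bullet> b\<bar>) \<le> 2 * norm (\<Sum>i\<in>?P. x i) \<or> (\<Sum>i\<in>I. \<bar>x i \<bullet> b\<bar>) \<le> 2 * norm (\<Sum>i\<in>?N. x i)"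
      using eq by linarith
    then show ?thesis by (metis (no_types, lifting) mem_Collect_eq subsetI)
  qed
  obtain b0 where b0: "b0 \<in> Basis" "\<And>b. b \<in> Basis \<Longrightarrow> (\<Sum>i\<in>I. \<bar>x i \<bullet> b\<bar>) \<le> (\<Sum>i\<in>I. \<bar>x i \<bullet> b0\<bar>)"
  proof -
    have "finite ((\<lambda>b. \<Sum>i\<in>I. \<bar>x i \<bullet> b\<bar>) ` (Basis :: 'b set))" "(\<lambda>b. \<Sum>i\<in>I. \<bar>x i \<bullet> b\<bar>) ` (Basis :: 'b set) \<noteq> {}" by auto
    from Max_in[OF this] obtain b0 where "b0 \<in> (Basis :: 'b set)"
      "Max ((\<lambda>b. \<Sum>i\<in>I. \<bar>x i \<bullet> b\<bar>) ` (Basis :: 'b set)) = (\<Sum>i\<in>I. \<bar>x i \<bullet> b0\<bar>)" by blast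
    with that[of b0] show ?thesis by (metis (no_types, lifting) Max_ge finite_Basis finite_imageI imageI)
  qed
  have "(\<Sum>i\<in>I. norm (x i)) \<le> (\<Sum>i\<in>I. \<Sum>b\<in>Basis. \<bar>x i \<bullet> b\<bar>)" by (intro sum_mono norm_le_l1)
  also have "\<dots> = (\<Sum>b\<in>Basis. \<Sum>i\<in>I. \<bar>x i \<bullet> b\<bar>)" by (rule sum.swap)
  also have "\<dots> \<le> (\<Sum>b\<in>(Basis::'b set). \<Sum>i\<in>I. \<bar>x i \<bullet> b0\<bar>)" by (intro sum_mono b0)
  also have "\<dots> = DIM('b) * (\<Sum>i\<in>I. \<bar>x i \<bullet> b0\<bar>)" by simp
  finally have A: "(\<Sum>i\<in>I. norm (x i)) \<le> DIM('b) * (\<Sum>i\<in>I. \<bar>x i \<bullet> b0\<bar>)" .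
  obtain S where S: "S \<subseteq> I" "(\<Sum>i\<in>I. \<bar>x i \<bullet> b0\<bar>) \<le> 2 * norm (\<Sum>i\<in>S. x i)" using one[OF b0(1)] by blast
  have "real DIM('b) * (\<Sum>i\<in>I. \<bar>x i \<bullet> b0\<bar>) \<le> real DIM('b) * (2 * norm (\<Sum>i\<in>S. x i))" using S by (intro mult_left_mono) auto
  with A have "(\<Sum>i\<in>I. norm (x i)) \<le> 2 * real DIM('b) * norm (\<Sum>i\<in>S. x i)" by linarith
  with S(1) show ?thesis by blast
qed

text \<open>Infinite variation yields a union F of cells whose measure has norm above
  \<open>1 + norm (\<mu> E)\<close>. Then F and its complement in E both have measure of norm at
  least 1. One of the two has infinite variation and is kept, the other is split off.\<close>

lemma variation_on_infinite_split:
  fixes \<mu> :: "'a set \<Rightarrow> 'b::euclidean_space"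
  assumes \<mu>: "vector_measure M \<mu>" and E: "E \<in> sets M" "variation_on M \<mu> E = \<infinity>"
  shows "\<exists>B\<in>sets M. B \<subseteq> E \<and> 1 \<le> norm (\<mu> (E - B)) \<and> variation_on M \<mu> B = \<infinity>"
proof -
  have 0: "\<mu> {} = 0" using \<mu> by (simp add: vector_measure_def)
  define t where "t = 2 * real DIM('b) * (1 + norm (\<mu> E))"
  have "ennreal t < variation_on M \<mu> E" using E by simp
  then obtain A where A: "range A \<subseteq> sets M" "disjoint_family A" "(\<Union>i. A i) = E"
     and tA: "ennreal t < (\<Sum>i. ennreal (norm (\<mu> (A i))))"
    unfolding variation_on_def less_SUP_iff by auto
  obtain n where n: "ennreal t < (\<Sum>i<n. ennreal (norm (\<mu> (A i))))"
    using tA unfolding suminf_eq_SUP less_SUP_iff by blast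
  then have "ennreal t < ennreal (\<Sum>i<n. norm (\<mu> (A i)))" by simp
  then have n: "t < (\<Sum>i<n. norm (\<mu> (A i)))" by (metis ennreal_less_iff linorder_not_less ennreal_leI)
  obtain S where S: "S \<subseteq> {..<n}" "(\<Sum>i<n. norm (\<mu> (A i))) \<le> 2 * real DIM('b) * norm (\<Sum>i\<in>S. \<mu> (A i))"
    using sum_norm_le_subset_norm[of "{..<n}" "\<lambda>i. \<mu> (A i)"] by auto
  define F where "F = (\<Union>i\<in>S. A i)"
  have F: "F \<in> sets M" "F \<subseteq> E" unfolding F_def using A S(1) finite_subset[OF S(1)] by (auto intro!: sets.finite_UN)
  have \<mu>F: "\<mu> F = (\<Sum>i\<in>S. \<mu> (A i))" unfolding F_def
    using A S(1) finite_subset[OF S(1)] by (intro vector_measure_finite_UN[OF \<mu>]) (auto simp: disjoint_family_on_def)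
  have "2 * real DIM('b) * (1 + norm (\<mu> E)) < 2 * real DIM('b) * norm (\<mu> F)"
    using n S(2) unfolding \<mu>F t_def by (rule less_le_trans)
  then have big: "1 + norm (\<mu> E) < norm (\<mu> F)" by simp
  have "\<mu> (F \<union> (E - F)) = \<mu> F + \<mu> (E - F)" using F E by (intro vector_measure_Un[OF \<mu>]) auto
  moreover have FE: "F \<union> (E - F) = E" using F by auto
  ultimately have eq: "\<mu> E = \<mu> F + \<mu> (E - F)" by simp
  then have "norm (\<mu> F) \<le> norm (\<mu> E) + norm (\<mu> (E - F))" by (metis add_diff_cancel_right' norm_triangle_ineq4)
  with big have 1: "1 \<le> norm (\<mu> (E - F))" "1 \<le> norm (\<mu> F)" using norm_ge_zero[of "\<mu> E"] by linarith+
  have "(\<lambda>i. variation_on M \<mu> (binaryset F (E - F) i)) sums (variation_on M \<mu> F + variation_on M \<mu> (E - F))"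
    using binaryset_sums[of "variation_on M \<mu>"] variation_on_empty[where \<mu>=\<mu>, OF 0] by blast
  moreover have "variation_on M \<mu> (\<Union>i. binaryset F (E - F) i) \<le> (\<Sum>i. variation_on M \<mu> (binaryset F (E - F) i))"
    using F E by (intro variation_on_countable_subadd[OF \<mu>]) (auto simp: range_binaryset_eq disjoint_family_on_def binaryset_def)
  ultimately have "variation_on M \<mu> E \<le> variation_on M \<mu> F + variation_on M \<mu> (E - F)"
    using FE by (simp add: UN_binaryset_eq sums_iff)
  then have "variation_on M \<mu> F = \<infinity> \<or> variation_on M \<mu> (E - F) = \<infinity>" using E(2) by (auto simp: top_unique)
  moreover have "E - (E - F) = F" using F by auto
  ultimately show ?thesis using 1 F E by (metis Diff_subset sets.Diff)
qed

text \<open>Otherwise sets can be split off indefinitely. They are disjoint and their measures have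
  norm at least 1, which contradicts convergence of the series in countable additivity.\<close>

lemma variation_on_finite:
  fixes \<mu> :: "'a set \<Rightarrow> 'b::euclidean_space"
  assumes \<mu>: "vector_measure M \<mu>" and E: "E \<in> sets M"
  shows "variation_on M \<mu> E < \<infinity>"
proof (rule ccontr)
  assume "\<not> ?thesis"
  then have inf: "variation_on M \<mu> E = \<infinity>" by (simp add: less_top[symmetric])
  define Q where "Q B \<longleftrightarrow> B \<in> sets M \<and> variation_on M \<mu> B = \<infinity>" for B
  have "\<exists>f. \<forall>n. Q (f n) \<and> (f (Suc n) \<subseteq> f n \<and> 1 \<le> norm (\<mu> (f n - f (Suc n))))"
  proof (rule dependent_nat_choice)
    show "\<exists>x. Q x" using inf E by (auto simp: Q_def)
    show "\<exists>y. Q y \<and> (y \<subseteq> x \<and> 1 \<le> norm (\<mu> (x - y)))" if "Q x" for x n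
      using variation_on_infinite_split[OF \<mu>, of x] that unfolding Q_def by blast
  qed
  then obtain f where f: "\<And>n. f n \<in> sets M" "\<And>n. f (Suc n) \<subseteq> f n" "\<And>n. 1 \<le> norm (\<mu> (f n - f (Suc n)))"
    unfolding Q_def by blast
  have anti: "f n \<subseteq> f m" if "m \<le> n" for m n using lift_Suc_antimono_le[of f] f(2) that by blast
  define D where "D n = f n - f (Suc n)" for n
  have "disjoint_family D"
    unfolding disjoint_family_on_def
  proof (intro ballI impI)
    fix m n :: nat assume "m \<noteq> n"
    then consider "Suc m \<le> n" | "Suc n \<le> m" by linarith
    then show "D m \<inter> D n = {}" using anti unfolding D_def by cases blast+
  qed
  moreover have "range D \<subseteq> sets M" using f by (auto simp: D_def)
  ultimately have "(\<lambda>n. \<mu> (D n)) sums \<mu> (\<Union>n. D n)" using \<mu> unfolding vector_measure_def by blast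
  then have "(\<lambda>n. \<mu> (D n)) \<longlonglongrightarrow> 0" using summable_LIMSEQ_zero sums_summable by blast
  then have "\<forall>\<^sub>F n in sequentially. norm (\<mu> (D n)) < 1" by (auto dest: tendstoD[where e=1])
  then show False using f(3) unfolding D_def eventually_sequentially by (meson linorder_not_less order_refl)
qed

lemma finite_measure_total_variation:
  fixes \<mu> :: "'a set \<Rightarrow> 'b::euclidean_space"
  assumes "vector_measure M \<mu>"
  shows "finite_measure (total_variation M \<mu>)"
  using variation_on_finite[OF assms, of "space M"] emeasure_total_variation[OF assms, of "space M"]
  by (intro finite_measureI) auto

section \<open>Densities of signed and vector measures\<close>

lemma signed_measure_density:
  fixes \<nu> :: "'a set \<Rightarrow> real"
  assumes fin: "finite_measure N" and \<nu>: "vector_measure N \<nu>"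
    and bound: "\<And>A. A \<in> sets N \<Longrightarrow> \<bar>\<nu> A\<bar> \<le> measure N A"
  shows "\<exists>f. integrable N f \<and> (\<forall>A\<in>sets N. \<nu> A = (LINT x:A|N. f x))"
proof -
  interpret finite_measure N by fact
  \<comment> \<open>By the bound on \<nu>, adding N makes it a positive measure, absolutely
    continuous with respect to N. The density sought is that of the sum minus 1.\<close>
  define P where "P = measure_of (space N) (sets N) (\<lambda>A. ennreal (\<nu> A + measure N A))"
  have sP [simp, measurable_cong]: "sets P = sets N" "space P = space N"
    unfolding P_def by (auto simp: sets.space_closed)
  have nn: "0 \<le> \<nu> A + measure N A" if "A \<in> sets N" for A using bound[OF that] by linarith
  have emP: "emeasure P A = ennreal (\<nu> A + measure N A)" if "A \<in> sets N" for A
    unfolding P_def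
  proof (rule emeasure_measure_of_sigma)
    show "sigma_algebra (space N) (sets N)" by (rule sets.sigma_algebra_axioms)
    show "positive (sets N) (\<lambda>A. ennreal (\<nu> A + measure N A))"
      using \<nu> by (auto simp: positive_def vector_measure_def)
    show "countably_additive (sets N) (\<lambda>A. ennreal (\<nu> A + measure N A))"
      unfolding countably_additive_def
    proof (intro allI impI)
      fix A :: "nat \<Rightarrow> 'a set" assume A: "range A \<subseteq> sets N" "disjoint_family A" "(\<Union>i. A i) \<in> sets N"
      have "(\<lambda>i. \<nu> (A i)) sums \<nu> (\<Union>i. A i)" using \<nu> A unfolding vector_measure_def by blast
      moreover have "(\<lambda>i. measure N (A i)) sums measure N (\<Union>i. A i)" using A by (rule_tac finite_measure_UNION)
      ultimately have "(\<lambda>i. \<nu> (A i) + measure N (A i)) sums (\<nu> (\<Union>i. A i) + measure N (\<Union>i. A i))" by (rule sums_add)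
      then show "(\<Sum>i. ennreal (\<nu> (A i) + measure N (A i))) = ennreal (\<nu> (\<Union>i. A i) + measure N (\<Union>i. A i))"
        using nn A by (intro suminf_ennreal_eq) auto
    qed
  qed fact
  have "absolutely_continuous N P"
    unfolding absolutely_continuous_def
  proof
    fix A assume A: "A \<in> null_sets N"
    then have "measure N A = 0" by (simp add: measure_eq_0_null_sets)
    with A bound[of A] show "A \<in> null_sets P" by (auto simp: null_sets_def emP)
  qed
  then obtain g where g: "g \<in> borel_measurable N" "density N g = P" using Radon_Nikodym[of P] by auto
  have int: "(\<integral>\<^sup>+x\<in>A. g x \<partial>N) = ennreal (\<nu> A + measure N A)" if "A \<in> sets N" for A
    using emeasure_density[OF g(1) that] g(2) emP[OF that] by simp
  have tot: "(\<integral>\<^sup>+x. g x \<partial>N) < \<infinity>"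
  proof -
    have "(\<integral>\<^sup>+x. g x \<partial>N) = (\<integral>\<^sup>+x\<in>space N. g x \<partial>N)" by (intro nn_integral_cong) (simp add: indicator_def)
    then show ?thesis using int[of "space N"] by simp
  qed
  then have AEfin: "AE x in N. g x \<noteq> \<infinity>" using tot by (intro nn_integral_PInf_AE g) auto
  have ig: "integrable N (\<lambda>x. enn2real (g x))"
  proof (rule integrableI_bounded)
    have "(\<integral>\<^sup>+x. ennreal (norm (enn2real (g x))) \<partial>N) = (\<integral>\<^sup>+x. g x \<partial>N)"
      using AEfin by (intro nn_integral_cong_AE) (auto simp: less_top[symmetric])
    with tot show "(\<integral>\<^sup>+x. ennreal (norm (enn2real (g x))) \<partial>N) < \<infinity>" by simp
  qed (use g in measurable)
  have setint: "(LINT x:A|N. enn2real (g x)) = \<nu> A + measure N A" if A: "A \<in> sets N" for A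
  proof -
    have "(LINT x:A|N. enn2real (g x)) = enn2real (\<integral>\<^sup>+x. ennreal (indicator A x * enn2real (g x)) \<partial>N)"
      unfolding set_lebesgue_integral_def using g A by (simp add: integral_eq_nn_integral)
    also have "(\<integral>\<^sup>+x. ennreal (indicator A x * enn2real (g x)) \<partial>N) = (\<integral>\<^sup>+x\<in>A. g x \<partial>N)"
      using AEfin by (intro nn_integral_cong_AE) (auto simp: less_top[symmetric] indicator_def)
    finally show ?thesis using int[OF A] nn[OF A] by simp
  qed
  have "integrable N (\<lambda>x. enn2real (g x) - 1)" using ig by (intro Bochner_Integration.integrable_diff) auto
  moreover have "\<nu> A = (LINT x:A|N. enn2real (g x) - 1)" if A: "A \<in> sets N" for A
  proof -
    have "set_integrable N A (\<lambda>x. enn2real (g x))" "set_integrable N A (\<lambda>x. 1::real)"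
      using ig A unfolding set_integrable_def by (intro integrable_mult_indicator integrable_const; simp)+
    then have "(LINT x:A|N. enn2real (g x) - 1) = (LINT x:A|N. enn2real (g x)) - (LINT x:A|N. 1)"
      by (intro set_integral_diff)
    also have "(LINT x:A|N. (1::real)) = measure N A" using A by (simp add: set_lebesgue_integral_def)
    finally show ?thesis using setint[OF A] by simp
  qed
  ultimately show ?thesis by blast
qed

text \<open>Each component of \<mu> is dominated by the total variation and so has a density. Thus
  the choice in \<open>vec_RN_deriv\<close> is made from a nonempty set when the reference measure
  is the total variation.\<close>

lemma vector_measure_density:
  fixes \<mu> :: "'a set \<Rightarrow> real^'n::finite"
  assumes \<mu>: "vector_measure M \<mu>"
  shows "\<exists>f. integrable (total_variation M \<mu>) f \<and>
    (\<forall>A\<in>sets (total_variation M \<mu>). \<mu> A = (LINT x:A|total_variation M \<mu>. f x))"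
proof -
  let ?N = "total_variation M \<mu>"
  interpret finite_measure ?N by (rule finite_measure_total_variation[OF \<mu>])
  have "\<exists>f. integrable ?N f \<and> (\<forall>A\<in>sets ?N. \<mu> A $ i = (LINT x:A|?N. f x))" for i
  proof (rule signed_measure_density)
    show "finite_measure ?N" by (rule finite_measure_axioms)
    show "vector_measure ?N (\<lambda>A. \<mu> A $ i)"
      using \<mu> unfolding vector_measure_def by (auto intro!: bounded_linear.sums[OF bounded_linear_vec_nth])
    fix A assume "A \<in> sets ?N"
    then have "ennreal (norm (\<mu> A)) \<le> ennreal (measure ?N A)"
      using norm_le_variation_on[of A M \<mu>] emeasure_total_variation[OF \<mu>, of A] \<mu> emeasure_eq_measure[of A]
      by (simp add: vector_measure_def)
    then show "\<bar>\<mu> A $ i\<bar> \<le> measure ?N A"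
      using component_le_norm_cart[of "\<mu> A" i] by (simp add: measure_nonneg)
  qed
  then obtain f where f: "\<And>i. integrable ?N (f i)" "\<And>i A. A \<in> sets ?N \<Longrightarrow> \<mu> A $ i = (LINT x:A|?N. f i x)" by metis
  define F where "F x = (\<Sum>i\<in>UNIV. f i x *\<^sub>R axis i (1::real))" for x
  have "integrable ?N F" unfolding F_def using f(1) by (intro Bochner_Integration.integrable_sum integrable_scaleR_left) auto
  moreover have "\<mu> A = (LINT x:A|?N. F x)" if A: "A \<in> sets ?N" for A
  proof -
    have "set_integrable ?N A F" using \<open>integrable ?N F\<close> A unfolding set_integrable_def by (intro integrable_mult_indicator)
    then have "(LINT x:A|?N. F x) $ i = (LINT x|?N. (indicator A x *\<^sub>R F x) $ i)" for i
      unfolding set_lebesgue_integral_def set_integrable_def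
      by (rule integral_bounded_linear[OF bounded_linear_vec_nth, symmetric])
    moreover have "F x $ i = f i x" for x i by (simp add: F_def axis_def if_distrib cong: if_cong)
    ultimately have "(LINT x:A|?N. F x) $ i = \<mu> A $ i" for i using f(2)[OF A] by (simp add: set_lebesgue_integral_def)
    then show ?thesis by (simp add: vec_eq_iff)
  qed
  ultimately show ?thesis by blast
qed

lemma vec_RN_deriv_total_variation:
  fixes \<mu> :: "'a set \<Rightarrow> real^'n::finite"
  assumes \<mu>: "vector_measure M \<mu>"
  shows "integrable (total_variation M \<mu>) (vec_RN_deriv (total_variation M \<mu>) \<mu>)"
    and "A \<in> sets M \<Longrightarrow> \<mu> A = (LINT x:A|total_variation M \<mu>. vec_RN_deriv (total_variation M \<mu>) \<mu> x)"
  using someI_ex[OF vector_measure_density[OF \<mu>]] unfolding vec_RN_deriv_def[symmetric] by auto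


section \<open>Smooth functions and mollifiers\<close>

lemma partial_eq: "(f has_derivative f') (at x) \<Longrightarrow> partial i f x = f' (axis i 1)"
  unfolding partial_def using frechet_derivative_at by metis

lemma vec_eq_sum_axis: "h = (\<Sum>i\<in>UNIV. (h $ i) *\<^sub>R axis i (1::real))" for h :: "real^'n::finite"
  by (simp add: vec_eq_iff axis_def if_distrib cong: if_cong)

lemma has_derivative_partial:
  fixes f :: "real^'n::finite \<Rightarrow> real"
  assumes "f differentiable (at x)"
  shows "(f has_derivative (\<lambda>h. \<Sum>i\<in>UNIV. h $ i * partial i f x)) (at x)"
proof -
  obtain f' where f': "(f has_derivative f') (at x)" using assms by (auto simp: differentiable_def)
  then interpret f': bounded_linear f' by (rule has_derivative_bounded_linear)
  have "f' h = (\<Sum>i\<in>UNIV. h $ i * partial i f x)" for h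
    by (subst vec_eq_sum_axis[of h]) (simp add: f'.sum f'.scaleR partial_eq[OF f'])
  with f' show ?thesis by (metis (no_types, lifting) ext has_derivative_eq_rhs)
qed

lemma C_k_SucD: "C_k (Suc k) f \<Longrightarrow> C_k k f"
proof (induction k arbitrary: f)
  case 0
  then show ?case
    by (auto intro!: continuous_at_imp_continuous_on differentiable_imp_continuous_within)
next
  case (Suc k)
  then have "C_k (Suc k) (partial i f)" for i by (simp del: C_k.simps(2) add: C_k.simps(2)[of "Suc k"])
  with Suc show ?case by auto
qed

lemma C_k_continuous: "C_k k f \<Longrightarrow> continuous_on UNIV f"
  by (induction k) (simp, metis C_k_SucD)

lemma partial_const [simp]: "partial i (\<lambda>x. c) = (\<lambda>x. 0)"
  using partial_eq[OF has_derivative_const] by fastforce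

lemma C_k_const [simp]: "C_k k (\<lambda>x. c)"
  by (induction k arbitrary: c) auto

lemma sum_axis_mult: "(\<Sum>j\<in>UNIV. axis i (1::real) $ j * c j) = c (i::'n::finite)"
proof -
  have "(\<Sum>j\<in>UNIV. axis i (1::real) $ j * c j) = (\<Sum>j\<in>UNIV. if j = i then c j else 0)"
    by (intro sum.cong) (auto simp: axis_def)
  then show ?thesis by simp
qed

lemma partial_add:
  assumes "f differentiable (at x)" "g differentiable (at x)"
  shows "partial i (\<lambda>x. f x + g x) x = partial i f x + partial i g x"
  using partial_eq[OF has_derivative_add[OF has_derivative_partial[OF assms(1)] has_derivative_partial[OF assms(2)]], of i]
  by (simp add: sum_axis_mult)

lemma partial_mult:
  assumes "f differentiable (at x)" "g differentiable (at x)"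
  shows "partial i (\<lambda>x. f x * g x) x = f x * partial i g x + partial i f x * g x"
  using partial_eq[OF has_derivative_mult[OF has_derivative_partial[OF assms(1)] has_derivative_partial[OF assms(2)]], of i]
  by (simp add: sum_axis_mult)

lemma partial_chain:
  assumes "DERIV g (f x) :> d" "f differentiable (at x)"
  shows "partial i (\<lambda>x. g (f x)) x = d * partial i f x"
  using partial_eq[OF has_derivative_compose[OF has_derivative_partial[OF assms(2)] assms(1)[unfolded has_field_derivative_def]], of i]
  by (simp add: sum_axis_mult)

lemma C_k_add: "C_k k f \<Longrightarrow> C_k k g \<Longrightarrow> C_k k (\<lambda>x. f x + g x)"
proof (induction k arbitrary: f g)
  case 0 then show ?case by (auto intro: continuous_intros)
next
  case (Suc k)
  then have "partial i (\<lambda>x. f x + g x) = (\<lambda>x. partial i f x + partial i g x)" for i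
    by (auto simp: partial_add)
  with Suc show ?case by auto
qed

lemma C_k_mult: "C_k k f \<Longrightarrow> C_k k g \<Longrightarrow> C_k k (\<lambda>x. f x * g x)"
proof (induction k arbitrary: f g)
  case 0 then show ?case by (auto intro: continuous_intros)
next
  case (Suc k)
  then have "partial i (\<lambda>x. f x * g x) = (\<lambda>x. f x * partial i g x + partial i f x * g x)" for i
    by (auto simp: partial_mult)
  moreover have "C_k k f" "C_k k g" using Suc.prems by (auto simp del: C_k.simps intro: C_k_SucD)
  ultimately show ?case using Suc by (auto intro!: C_k_add)
qed

lemma C_k_sum: "finite I \<Longrightarrow> (\<And>i. i \<in> I \<Longrightarrow> C_k k (f i)) \<Longrightarrow> C_k k (\<lambda>x. \<Sum>i\<in>I. f i x)"
  by (induction I rule: finite_induct) (auto intro: C_k_add)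

lemma partial_cmult:
  "f differentiable (at x) \<Longrightarrow> partial i (\<lambda>x. c * f x) x = c * partial i f x"
  by (subst partial_mult) auto

lemma partial_vec_nth: "partial i (\<lambda>x::real^'n::finite. x $ j) = (\<lambda>x. if i = j then 1 else 0)"
  by (rule ext, subst partial_eq[OF bounded_linear_imp_has_derivative[OF bounded_linear_vec_nth]]) (simp add: axis_def)

lemma C_k_vec_nth: "C_k k (\<lambda>x. x $ j)"
proof (cases k)
  case 0 then show ?thesis by (auto intro: continuous_intros)
next
  case (Suc n)
  have "(\<lambda>x::real^'a. x $ j) differentiable (at x)" for x
    using bounded_linear_imp_has_derivative[OF bounded_linear_vec_nth] by (auto simp: differentiable_def)
  then show ?thesis using Suc by (simp add: partial_vec_nth)
qed

section \<open>The standard mollifier\<close>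

definition exp_bump :: "nat \<Rightarrow> real \<Rightarrow> real" where
  "exp_bump m s = (if s \<le> 0 then 0 else exp (- 1 / s) / s ^ m)"

lemma exp_bump_tendsto_0: "(exp_bump m \<longlongrightarrow> 0) (at 0)"
proof -
  have "((\<lambda>s::real. inverse s ^ m / exp (inverse s)) \<longlongrightarrow> 0) (at_right 0)"
    by (rule filterlim_compose[OF tendsto_power_div_exp_0 filterlim_inverse_at_top_right])
  then have "(exp_bump m \<longlongrightarrow> 0) (at_right 0)"
  proof (rule Lim_transform_eventually)
    have "inverse s ^ m / exp (inverse s) = exp_bump m s" if "s > 0" for s :: real
    proof -
      have "exp (- 1 / s) = 1 / exp (inverse s)" by (simp add: exp_minus inverse_eq_divide)
      then show ?thesis using that by (simp add: exp_bump_def power_inverse inverse_eq_divide power_one_over)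
    qed
    then show "\<forall>\<^sub>F s in at_right 0. inverse s ^ m / exp (inverse s) = exp_bump m s"
      unfolding eventually_at_right_field by (intro exI[of _ 1]) auto
  qed
  moreover have "(exp_bump m \<longlongrightarrow> 0) (at_left 0)"
    by (rule tendsto_eventually) (auto simp: eventually_at_left_field exp_bump_def intro: exI[of _ "-1"])
  ultimately show ?thesis by (simp add: filterlim_split_at)
qed

text \<open>Differentiation maps the family into itself, raising m by 1 and by 2. The power of s in
  the denominator is carried for this reason, and the proof of smoothness is an induction with m
  arbitrary. At 0 the difference quotient is \<open>exp_bump (m + 1) h\<close>, which tends to
  0.\<close>

lemma DERIV_exp_bump:
  "DERIV (exp_bump m) s :> (- real m * exp_bump (m + 1) s + exp_bump (m + 2) s)"
proof -
  consider "s < 0" | "s = 0" | "s > 0" by linarith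
  then show ?thesis
  proof cases
    case 1
    then have "\<forall>\<^sub>F y in nhds s. exp_bump m y = 0"
      by (intro eventually_nhds_in_open[THEN eventually_mono, of "{..<0}"]) (auto simp: exp_bump_def)
    then have "DERIV (exp_bump m) s :> 0 \<longleftrightarrow> DERIV (\<lambda>_. 0) s :> (0::real)"
      by (intro DERIV_cong_ev) auto
    with 1 show ?thesis by (simp add: exp_bump_def)
  next
    case 2
    have "((\<lambda>h. (exp_bump m (0 + h) - exp_bump m 0) / h) \<longlongrightarrow> 0) (at 0)"
    proof (rule Lim_transform_eventually[OF exp_bump_tendsto_0[of "m+1"]])
      show "\<forall>\<^sub>F h in at 0. exp_bump (m + 1) h = (exp_bump m (0 + h) - exp_bump m 0) / h"
        by (auto simp: exp_bump_def eventually_at intro!: exI[of _ 1])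
    qed
    then show ?thesis using 2 by (simp add: DERIV_def exp_bump_def)
  next
    case 3
    then have "\<forall>\<^sub>F y in nhds s. exp_bump m y = exp (- 1 / y) / y ^ m"
      by (intro eventually_nhds_in_open[THEN eventually_mono, of "{0<..}"]) (auto simp: exp_bump_def)
    moreover have "DERIV (\<lambda>y. exp (- 1 / y) / y ^ m) s :> (- real m * exp_bump (m + 1) s + exp_bump (m + 2) s)"
    proof (cases m)
      case 0
      then show ?thesis using 3 by (auto intro!: derivative_eq_intros simp: exp_bump_def field_simps power2_eq_square)
    next
      case (Suc k)
      have "(exp (- 1 / s) * (1 / s\<^sup>2) * s ^ m - exp (- 1 / s) * (real m * s ^ (m - 1))) / (s ^ m * s ^ m) =
         - real m * exp_bump (m + 1) s + exp_bump (m + 2) s"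
        using 3 Suc by (simp add: exp_bump_def divide_simps power2_eq_square) (simp add: algebra_simps)
      moreover have "DERIV (\<lambda>y. exp (- 1 / y) / y ^ m) s :>
         (exp (- 1 / s) * (1 / s\<^sup>2) * s ^ m - exp (- 1 / s) * (real m * s ^ (m - 1))) / (s ^ m * s ^ m)"
        using 3 by (auto intro!: derivative_eq_intros simp: power2_eq_square)
      ultimately show ?thesis by simp
    qed
    ultimately show ?thesis by (subst DERIV_cong_ev) auto
  qed
qed

lemma C_k_exp_bump: "C_k k f \<Longrightarrow> C_k k (\<lambda>x. exp_bump m (f x))"
proof (induction k arbitrary: m)
  case 0
  have "continuous_on UNIV (exp_bump m)"
    using DERIV_exp_bump DERIV_isCont continuous_at_imp_continuous_on by blast
  with 0 show ?case by (auto intro: continuous_on_compose2)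
next
  case (Suc k)
  have d: "f differentiable (at x)" for x using Suc.prems by simp
  have "partial i (\<lambda>x. exp_bump m (f x)) = (\<lambda>x. (- real m * exp_bump (m + 1) (f x) + exp_bump (m + 2) (f x)) * partial i f x)" for i
    using partial_chain[OF DERIV_exp_bump d] by blast
  moreover have "(\<lambda>x. exp_bump m (f x)) differentiable (at x)" for x
    using has_derivative_compose[OF has_derivative_partial[OF d] DERIV_exp_bump[unfolded has_field_derivative_def]]
    unfolding differentiable_def by blast
  moreover have "C_k k f" using Suc.prems by (rule C_k_SucD)
  moreover have "C_k k (\<lambda>x. (- real m * exp_bump (m + 1) (f x) + exp_bump (m + 2) (f x)) * partial i f x)" for i
    using Suc calculation(3) by (intro C_k_add C_k_mult C_k_const) auto
  ultimately show ?case by simp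
qed

lemma borel_measurable_C_k [measurable_dest]: "C_k k f \<Longrightarrow> f \<in> borel_measurable borel"
  by (intro borel_measurable_continuous_onI C_k_continuous)

lemma partial_outside_closed:
  assumes "closed K" "\<And>x. x \<notin> K \<Longrightarrow> f x = 0" "x \<notin> K"
  shows "partial i f x = 0"
proof -
  have "(f has_derivative (\<lambda>_. 0)) (at x)"
    using assms by (intro has_derivative_transform_within_open[OF has_derivative_const[of 0], of "- K"]) (auto simp: has_derivative_const)
  then show ?thesis by (rule partial_eq)
qed

lemma test_funI:
  assumes "\<And>k. C_k k \<phi>" "compact K" "K \<subseteq> \<Omega>" "\<And>x. x \<notin> K \<Longrightarrow> \<phi> x = 0"
  shows "test_fun \<Omega> \<phi>"
proof -
  have "closure {x. \<phi> x \<noteq> 0} \<subseteq> K" using assms by (intro closure_minimal) (auto simp: compact_imp_closed)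
  moreover have "compact (closure {x. \<phi> x \<noteq> 0})"
    using compact_Int_closed[OF \<open>compact K\<close>, of "closure {x. \<phi> x \<noteq> 0}"] calculation by (simp add: Int_absorb1)
  ultimately show ?thesis using assms by (auto simp: test_fun_def)
qed

lemma test_fun_support:
  assumes "test_fun \<Omega> \<phi>"
  obtains K where "compact K" "K \<subseteq> \<Omega>" "\<And>x. x \<notin> K \<Longrightarrow> \<phi> x = 0" "\<And>x i. x \<notin> K \<Longrightarrow> partial i \<phi> x = 0"
proof
  let ?K = "closure {x. \<phi> x \<noteq> 0}"
  show "compact ?K" "?K \<subseteq> \<Omega>" using assms by (auto simp: test_fun_def)
  show zero: "\<phi> x = 0" if "x \<notin> ?K" for x using that closure_subset[of "{x. \<phi> x \<noteq> 0}"] by auto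
  show "partial i \<phi> x = 0" if "x \<notin> ?K" for x i using partial_outside_closed[OF closed_closure zero that] .
qed

lemma test_fun_C_k: "test_fun \<Omega> \<phi> \<Longrightarrow> C_k k \<phi>"
  by (simp add: test_fun_def)

lemma integrable_continuous_compact_support:
  fixes f :: "'a::euclidean_space \<Rightarrow> real"
  assumes "continuous_on UNIV f" "compact K" "\<And>x. x \<notin> K \<Longrightarrow> f x = 0"
  shows "integrable lborel f"
proof -
  have "integrable lborel (\<lambda>x. indicator K x *\<^sub>R f x)"
    using assms by (intro borel_integrable_compact) (auto intro: continuous_on_subset)
  moreover have "(\<lambda>x. indicator K x *\<^sub>R f x) = f" using assms(3) by (intro ext) (auto simp: indicator_def)
  ultimately show ?thesis by simp
qed

lemma bounded_continuous_compact_support: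
  fixes f :: "'a::euclidean_space \<Rightarrow> 'b::real_normed_vector"
  assumes "continuous_on UNIV f" "compact K" "\<And>x. x \<notin> K \<Longrightarrow> f x = 0"
  obtains B where "B > 0" "\<And>x. norm (f x) \<le> B"
proof -
  have "compact (f ` K)" using assms by (intro compact_continuous_image) (auto intro: continuous_on_subset)
  then obtain B where "B > 0" "\<And>x. x \<in> K \<Longrightarrow> norm (f x) \<le> B" by (auto simp: bounded_pos dest!: compact_imp_bounded)
  then show ?thesis using assms(3) by (intro that[of B]) (metis norm_zero less_imp_le)+
qed

lemma uniformly_continuous_compact_support:
  fixes f :: "'a::euclidean_space \<Rightarrow> 'b::real_normed_vector"
  assumes f: "continuous_on UNIV f" and K: "compact K" "\<And>x. x \<notin> K \<Longrightarrow> f x = 0" and e: "e > 0"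
  obtains d where "d > 0" "\<And>x y. dist x y < d \<Longrightarrow> dist (f x) (f y) < e"
proof -
  obtain r where r: "K \<subseteq> cball 0 r" using compact_imp_bounded[OF K(1)] unfolding bounded_iff by (auto simp: subset_iff)
  have "uniformly_continuous_on (cball 0 (r + 1)) f"
    using f by (intro compact_uniformly_continuous) (auto intro: continuous_on_subset)
  then obtain d where d: "d > 0" "\<And>x y. x \<in> cball 0 (r+1) \<Longrightarrow> y \<in> cball 0 (r+1) \<Longrightarrow> dist y x < d \<Longrightarrow> dist (f y) (f x) < e"
    unfolding uniformly_continuous_on_def using e by metis
  show ?thesis
  proof (rule that[of "min d 1"])
    show "min d 1 > 0" using d by simp
    fix x y :: 'a assume xy: "dist x y < min d 1"
    show "dist (f x) (f y) < e"
    proof (cases "x \<in> K \<or> y \<in> K")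
      case True
      then have "x \<in> cball 0 r \<or> y \<in> cball 0 r" using r by blast
      then have "x \<in> cball 0 (r+1) \<and> y \<in> cball 0 (r+1)"
        using xy norm_triangle_sub[of x y] norm_triangle_sub[of y x] by (auto simp: dist_norm norm_minus_commute)
      with d xy show ?thesis by auto
    next
      case False
      then show ?thesis using K e by simp
    qed
  qed
qed

text \<open>The squared norm is a polynomial in the coordinates, so no separate argument is needed
  for smoothness at the origin.\<close>

definition bump :: "real \<Rightarrow> real^'n::finite \<Rightarrow> real" where
  "bump e x = exp_bump 0 (e\<^sup>2 - x \<bullet> x)"

definition moll :: "real \<Rightarrow> real^'n::finite \<Rightarrow> real" where
  "moll e x = bump e x / (LINT y|lborel. bump e (y :: real^'n))"

lemma bump_nonneg: "bump e x \<ge> 0"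
  by (simp add: bump_def exp_bump_def)

lemma bump_pos_iff: "e > 0 \<Longrightarrow> bump e x \<noteq> 0 \<longleftrightarrow> norm x < e"
  using power_strict_mono[of "norm x" e 2] power_mono[of e "norm x" 2]
  by (cases "norm x < e") (simp_all add: bump_def exp_bump_def dot_square_norm)

lemma C_k_bump: "C_k k (bump e :: real^'n::finite \<Rightarrow> real)"
proof -
  have "C_k k (\<lambda>x::real^'n. e\<^sup>2 + (- 1) * (\<Sum>i\<in>UNIV. x $ i * x $ i))"
    by (intro C_k_add C_k_const C_k_mult C_k_sum C_k_vec_nth) auto
  then have "C_k k (\<lambda>x::real^'n. e\<^sup>2 - x \<bullet> x)" by (simp add: inner_vec_def)
  then show ?thesis unfolding bump_def[abs_def] by (rule C_k_exp_bump)
qed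

lemma integrable_bump:
  assumes "e > 0" shows "integrable lborel (bump e :: real^'n::finite \<Rightarrow> real)"
proof (rule integrable_continuous_compact_support)
  show "continuous_on UNIV (bump e :: real^'n \<Rightarrow> real)" by (rule C_k_continuous[OF C_k_bump])
  show "bump e x = 0" if "x \<notin> cball 0 e" for x :: "real^'n"
    using bump_pos_iff[OF assms, of x] that by auto
qed (rule compact_cball)

lemma integral_bump_pos:
  assumes "e > 0"
  shows "(LINT y|lborel. bump e (y :: real^'n::finite)) > 0"
proof -
  have "(LINT y|lborel. bump e (y :: real^'n)) \<noteq> 0"
  proof
    assume "(LINT y|lborel. bump e (y :: real^'n)) = 0"
    then have "AE y :: real^'n in lborel. bump e y = 0"
      using integral_nonneg_eq_0_iff_AE[OF integrable_bump[OF assms]] bump_nonneg by auto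
    then have "AE y :: real^'n in lborel. y \<notin> ball 0 e" using bump_pos_iff[OF assms] by auto
    then have "ball (0::real^'n) e \<in> null_sets lborel" by (subst AE_iff_null_sets) auto
    then have "negligible (ball (0::real^'n) e)" by (simp add: negligible_iff_null_sets null_sets_completionI)
    then show False using open_not_negligible[of "ball (0::real^'n) e"] assms by simp
  qed
  then show ?thesis using Bochner_Integration.integral_nonneg[of lborel "bump e :: real^'n \<Rightarrow> real"] bump_nonneg
    by (metis less_eq_real_def)
qed

lemma moll_nonneg: "moll e x \<ge> 0"
  unfolding moll_def by (intro divide_nonneg_nonneg bump_nonneg Bochner_Integration.integral_nonneg)

lemma moll_eq_0: "e > 0 \<Longrightarrow> e \<le> norm x \<Longrightarrow> moll e x = 0"
  using bump_pos_iff[of e x] by (auto simp: moll_def)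

lemma C_k_moll: "C_k k (moll e :: real^'n::finite \<Rightarrow> real)"
proof -
  have "C_k k (\<lambda>x::real^'n. (1 / (LINT y|lborel. bump e (y::real^'n))) * bump e x)"
    by (intro C_k_mult C_k_const C_k_bump)
  then show ?thesis by (simp add: moll_def[abs_def])
qed

lemma integrable_moll: "e > 0 \<Longrightarrow> integrable lborel (moll e :: real^'n::finite \<Rightarrow> real)"
  unfolding moll_def[abs_def] by (intro integrable_divide_zero integrable_bump)

lemma integral_moll: "e > 0 \<Longrightarrow> (LINT x|lborel. moll e (x :: real^'n::finite)) = 1"
  using integral_bump_pos[where 'n='n, of e] unfolding moll_def by simp

lemma moll_minus [simp]: "moll e (- x) = moll e x"
  by (simp add: moll_def bump_def)

lemma partial_minus_arg:
  fixes f :: "real^'n::finite \<Rightarrow> real"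
  assumes "f differentiable (at (- x))" shows "partial i (\<lambda>x. f (- x)) x = - partial i f (- x)"
proof -
  have "((\<lambda>x. f (- x)) has_derivative (\<lambda>h. \<Sum>i\<in>UNIV. (- h) $ i * partial i f (- x))) (at x)"
    using has_derivative_compose[where f=uminus and g=f and f'=uminus, OF _ has_derivative_partial[OF assms]]
    by (auto intro!: derivative_eq_intros)
  from partial_eq[OF this, of i] show ?thesis by (simp add: sum_axis_mult sum_negf)
qed

lemma partial_moll_minus: "partial i (moll e) (- x :: real^'n::finite) = - partial i (moll e) x"
proof -
  have "moll e differentiable (at (- x))" using C_k_moll[of "Suc 0" e, where 'n='n] by simp
  from partial_minus_arg[OF this, of i] show ?thesis by simp
qed


section \<open>Mollification\<close>

definition conv :: "(real^'n::finite \<Rightarrow> real) \<Rightarrow> (real^'n \<Rightarrow> real) \<Rightarrow> real^'n \<Rightarrow> real" where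
  "conv r g x = (LINT y|lborel. r (x - y) * g y)"

lemma lborel_distr_reflect: "distr lborel borel (\<lambda>y. x - y) = (lborel :: (real^'n::finite) measure)"
proof -
  have "(lborel :: (real^'n) measure) = density (distr lborel borel (\<lambda>y. x + (-1) *\<^sub>R y)) (\<lambda>_. ennreal (\<bar>-1\<bar>^DIM(real^'n)))"
    by (rule lborel_affine) simp
  then show ?thesis by (simp add: density_1)
qed

lemma lborel_integral_reflect:
  fixes f :: "real^'n::finite \<Rightarrow> real"
  assumes [measurable]: "f \<in> borel_measurable borel"
  shows "(LINT y|lborel. f (x - y)) = (LINT y|lborel. f y)"
  by (subst (2) lborel_distr_reflect[of x, symmetric]) (simp add: integral_distr)

lemma lborel_integrable_reflect:
  fixes f :: "real^'n::finite \<Rightarrow> real"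
  assumes "integrable lborel f"
  shows "integrable lborel (\<lambda>y. f (x - y))"
proof -
  have [measurable]: "f \<in> borel_measurable borel" using assms by simp
  have "integrable (distr lborel borel (\<lambda>y. x - y)) f" using assms by (simp add: lborel_distr_reflect)
  then show ?thesis by (simp add: integrable_distr_eq)
qed

lemma lborel_integral_translate:
  fixes f :: "real^'n::finite \<Rightarrow> real"
  assumes [measurable]: "f \<in> borel_measurable borel"
  shows "(LINT y|lborel. f (c + y)) = (LINT y|lborel. f y)"
  by (subst (2) lborel_distr_plus[of c, symmetric]) (simp add: integral_distr)

lemma lborel_integrable_translate:
  fixes f :: "real^'n::finite \<Rightarrow> real"
  assumes "integrable lborel f"
  shows "integrable lborel (\<lambda>y. f (c + y))"
proof -
  have [measurable]: "f \<in> borel_measurable borel" using assms by simp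
  have "integrable (distr lborel borel ((+) c)) f" using assms by (simp add: lborel_distr_plus)
  then show ?thesis by (simp add: integrable_distr_eq)
qed

lemma integrable_mult_bounded:
  fixes f g :: "'a \<Rightarrow> real"
  assumes "integrable M g" "f \<in> borel_measurable M" "\<And>x. \<bar>f x\<bar> \<le> B"
  shows "integrable M (\<lambda>x. f x * g x)"
proof (rule Bochner_Integration.integrable_bound[of _ "\<lambda>x. B * g x"])
  show "AE x in M. norm (f x * g x) \<le> norm (B * g x)"
  proof (intro AE_I2)
    fix x
    have "\<bar>f x\<bar> \<le> \<bar>B\<bar>" using assms(3)[of x] by linarith
    then show "norm (f x * g x) \<le> norm (B * g x)" by (simp add: abs_mult mult_right_mono)
  qed
qed (use assms in auto)

text \<open>K is any compact set off which f vanishes rather than the support itself, so that one K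
  serves f, its derivatives and its products with other functions.\<close>

definition C_c :: "nat \<Rightarrow> (real^'n::finite) set \<Rightarrow> (real^'n \<Rightarrow> real) \<Rightarrow> bool" where
  "C_c k K f \<longleftrightarrow> C_k k f \<and> compact K \<and> (\<forall>x. x \<notin> K \<longrightarrow> f x = 0)"

lemma C_c_partial: "C_c (Suc k) K f \<Longrightarrow> C_c k K (partial i f)"
  by (auto simp: C_c_def compact_imp_closed intro: partial_outside_closed[of K])

lemma C_c_mono_k: "C_c (Suc k) K f \<Longrightarrow> C_c k K f"
  using C_k_SucD by (auto simp: C_c_def simp del: C_k.simps)

lemma C_c_cont: assumes "C_c k K f"
  shows "continuous_on UNIV f" "compact K" "\<And>x. x \<notin> K \<Longrightarrow> f x = 0"
  using assms by (auto simp: C_c_def C_k_continuous)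

lemma C_c_measurable: "C_c k K f \<Longrightarrow> f \<in> borel_measurable borel"
  by (intro borel_measurable_continuous_onI C_c_cont)

lemma C_c_integrable: "C_c k K f \<Longrightarrow> integrable lborel f"
  by (intro integrable_continuous_compact_support[of f K]) (auto dest: C_c_cont)

lemma C_c_bounded: assumes "C_c k K f" obtains B where "B > 0" "\<And>x. \<bar>f x\<bar> \<le> B"
  using bounded_continuous_compact_support[OF C_c_cont[OF assms]] by (metis real_norm_def)

lemma C_c_moll: "e > 0 \<Longrightarrow> C_c k (cball 0 e) (moll e)"
  by (auto simp: C_c_def C_k_moll moll_eq_0)

lemma conv_integrand_integrable:
  assumes r: "C_c k K r" and g: "integrable lborel g"
  shows "integrable lborel (\<lambda>y. r (x - y) * g y)"
proof -
  obtain B where "\<And>x. \<bar>r x\<bar> \<le> B" using C_c_bounded[OF r] by blast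
  moreover have [measurable]: "r \<in> borel_measurable borel" using C_c_measurable[OF r] .
  ultimately show ?thesis using g by (intro integrable_mult_bounded[of _ _ _ B]) auto
qed

text \<open>The gradient is uniformly continuous, so the first-order remainder is uniform in x. This
  is what permits differentiation under an integral over the whole space.\<close>

lemma C_c_differential_uniform:
  fixes f :: "real^'n::finite \<Rightarrow> real"
  assumes f: "C_c (Suc k) K f" and e: "e > 0"
  obtains d where "d > 0" "\<And>x h. norm h < d \<Longrightarrow> \<bar>f (x + h) - f x - (\<Sum>i\<in>UNIV. h $ i * partial i f x)\<bar> \<le> e * norm h"
proof -
  define G where "G x = (\<chi> i. partial i f x)" for x
  have ck: "C_c k K (partial i f)" for i using C_c_partial[OF f] .
  have G: "continuous_on UNIV G" unfolding G_def using C_c_cont(1)[OF ck] by (intro continuous_intros) auto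
  have G0: "G x = 0" if "x \<notin> K" for x using C_c_cont(3)[OF ck] that by (auto simp: G_def vec_eq_iff)
  obtain d where d: "d > 0" "\<And>x y. dist x y < d \<Longrightarrow> dist (G x) (G y) < e"
    using uniformly_continuous_compact_support[OF G C_c_cont(2)[OF f] G0 e] by blast
  have der: "(f has_derivative (\<lambda>h. h \<bullet> G x)) (at x within S)" for x S
  proof -
    have "f differentiable (at x)" using f by (simp add: C_c_def)
    from has_derivative_partial[OF this] show ?thesis
      by (auto simp: inner_vec_def G_def intro: has_derivative_at_withinI)
  qed
  show ?thesis
  proof (rule that[OF d(1)])
    fix x h :: "real^'n" assume h: "norm h < d"
    have "norm (f (x + h) - f x - (x + h - x) \<bullet> G x) \<le> norm (x + h - x) * e"
    proof (rule differentiable_bound_linearization[where S="ball x d" and f'="\<lambda>x h. h \<bullet> G x"])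
      show "x + t *\<^sub>R (x + h - x) \<in> ball x d" if "t \<in> {0..1}" for t
        using that h mult_left_le_one_le[of "norm h" t] by (simp add: dist_norm)
      show "onorm ((\<lambda>h. h \<bullet> G y) - (\<lambda>h. h \<bullet> G x)) \<le> e" if "y \<in> ball x d" for y
      proof (rule onorm_bound)
        show "norm (((\<lambda>h. h \<bullet> G y) - (\<lambda>h. h \<bullet> G x)) h) \<le> e * norm h" for h
        proof -
          have "((\<lambda>h. h \<bullet> G y) - (\<lambda>h. h \<bullet> G x)) h = h \<bullet> (G y - G x)" by (simp add: inner_diff_right)
          moreover have "\<bar>h \<bullet> (G y - G x)\<bar> \<le> norm h * norm (G y - G x)" by (rule Cauchy_Schwarz_ineq2)
          moreover have "norm h * norm (G y - G x) \<le> norm h * e"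
            using d(2)[of y x] that by (intro mult_left_mono) (auto simp: dist_norm norm_minus_commute)
          ultimately show ?thesis by (simp add: mult.commute)
        qed
      qed (use e in simp)
    qed (use der d in auto)
    then show "\<bar>f (x + h) - f x - (\<Sum>i\<in>UNIV. h $ i * partial i f x)\<bar> \<le> e * norm h"
      by (simp add: inner_vec_def G_def mult.commute)
  qed
qed

lemma conv_has_derivative:
  fixes r :: "real^'n::finite \<Rightarrow> real"
  assumes r: "C_c (Suc k) K r" and g: "integrable lborel g"
  shows "(conv r g has_derivative (\<lambda>h. \<Sum>i\<in>UNIV. h $ i * conv (partial i r) g x)) (at x)"
  unfolding has_derivative_at_alt
proof (intro conjI allI impI)
  have "linear (\<lambda>h. \<Sum>i\<in>UNIV. h $ i * conv (partial i r) g x)"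
    by (intro linearI) (auto simp: sum.distrib algebra_simps sum_distrib_left)
  then show "bounded_linear (\<lambda>h. \<Sum>i\<in>UNIV. h $ i * conv (partial i r) g x)" by (rule linear_conv_bounded_linear[THEN iffD1])
  fix e :: real assume e: "e > 0"
  define N where "N = (LINT y|lborel. \<bar>g y\<bar>)"
  have N: "N \<ge> 0" unfolding N_def by (intro Bochner_Integration.integral_nonneg) auto
  \<comment> \<open>The 1 is added because the integral N of \<bar>g\<bar> may vanish.\<close>
  have "e / (N + 1) > 0" using e N by auto
  from C_c_differential_uniform[OF r this]
  obtain d where d: "d > 0" "\<And>x h. norm h < d \<Longrightarrow> \<bar>r (x + h) - r x - (\<Sum>i\<in>UNIV. h $ i * partial i r x)\<bar> \<le> e / (N + 1) * norm h"
    by blast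
  show "\<exists>d>0. \<forall>y. norm (y - x) < d \<longrightarrow>
      norm (conv r g y - conv r g x - (\<Sum>i\<in>UNIV. (y - x) $ i * conv (partial i r) g x)) \<le> e * norm (y - x)"
  proof (intro exI[of _ d] conjI allI impI)
    fix y :: "real^'n" assume y: "norm (y - x) < d"
    define h where "h = y - x"
    have ig: "integrable lborel (\<lambda>z. r (x - z) * g z)" for x using conv_integrand_integrable[OF r g] .
    have igp: "integrable lborel (\<lambda>z. partial i r (x - z) * g z)" for x i
      using conv_integrand_integrable[OF C_c_partial[OF r] g] .
    have "conv r g y - conv r g x - (\<Sum>i\<in>UNIV. h $ i * conv (partial i r) g x) =
      (LINT z|lborel. r (y - z) * g z - r (x - z) * g z - (\<Sum>i\<in>UNIV. h $ i * (partial i r (x - z) * g z)))"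
      unfolding conv_def using ig igp by simp
    also have "\<dots> = (LINT z|lborel. (r (x - z + h) - r (x - z) - (\<Sum>i\<in>UNIV. h $ i * partial i r (x - z))) * g z)"
    proof (intro Bochner_Integration.integral_cong refl)
      fix z
      have xz: "r (x - z + h) = r (y - z)" by (simp add: h_def)
      show "r (y - z) * g z - r (x - z) * g z - (\<Sum>i\<in>UNIV. h $ i * (partial i r (x - z) * g z)) =
        (r (x - z + h) - r (x - z) - (\<Sum>i\<in>UNIV. h $ i * partial i r (x - z))) * g z"
        unfolding xz by (simp add: left_diff_distrib sum_distrib_right mult.assoc)
    qed
    also have "norm \<dots> \<le> (LINT z|lborel. norm ((r (x - z + h) - r (x - z) - (\<Sum>i\<in>UNIV. h $ i * partial i r (x - z))) * g z))"
      by (rule integral_norm_bound)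
    also have "\<dots> \<le> (LINT z|lborel. (e / (N + 1) * norm h) * \<bar>g z\<bar>)"
    proof (rule integral_mono')
      show "integrable lborel (\<lambda>z. (e / (N + 1) * norm h) * \<bar>g z\<bar>)" using g by auto
      fix z
      have "\<bar>r (x - z + h) - r (x - z) - (\<Sum>i\<in>UNIV. h $ i * partial i r (x - z))\<bar> \<le> e / (N + 1) * norm h"
        using d(2)[of h "x - z"] y unfolding h_def[symmetric] by blast
      then show "norm ((r (x - z + h) - r (x - z) - (\<Sum>i\<in>UNIV. h $ i * partial i r (x - z))) * g z) \<le> (e / (N + 1) * norm h) * \<bar>g z\<bar>"
        unfolding real_norm_def abs_mult by (intro mult_right_mono) auto
    qed (use e N in simp)
    also have "\<dots> = e / (N + 1) * norm h * N" by (simp add: N_def)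
    also have "\<dots> = (e * norm h) * (N / (N + 1))" by simp
    also have "\<dots> \<le> (e * norm h) * 1" using e N by (intro mult_left_mono) auto
    finally show "norm (conv r g y - conv r g x - (\<Sum>i\<in>UNIV. (y - x) $ i * conv (partial i r) g x)) \<le> e * norm (y - x)"
      by (simp add: h_def)
  qed (use d in auto)
qed

lemma partial_conv:
  assumes "C_c (Suc k) K r" "integrable lborel g"
  shows "partial i (conv r g) = conv (partial i r) g"
  using partial_eq[OF conv_has_derivative[OF assms], of i] by (intro ext) (simp add: sum_axis_mult)

lemma continuous_on_conv:
  fixes r :: "real^'n::finite \<Rightarrow> real"
  assumes r: "C_c k K r" and g: "integrable lborel g"
  shows "continuous_on UNIV (conv r g)"
proof -
  define N where "N = (LINT y|lborel. \<bar>g y\<bar>)"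
  have N: "N \<ge> 0" unfolding N_def by (intro Bochner_Integration.integral_nonneg) auto
  have "\<exists>d>0. \<forall>y. dist y x < d \<longrightarrow> dist (conv r g y) (conv r g x) < e" if e: "e > 0" for x e
  proof -
    have "e / (N + 1) > 0" using e N by auto
    from uniformly_continuous_compact_support[OF C_c_cont[OF r] this]
    obtain d where d: "d > 0" "\<And>x y. dist x y < d \<Longrightarrow> dist (r x) (r y) < e / (N + 1)" by blast
    show ?thesis
    proof (intro exI[of _ d] conjI allI impI)
      fix y assume y: "dist y x < d"
      have ig: "integrable lborel (\<lambda>z. r (x - z) * g z)" for x using conv_integrand_integrable[OF r g] .
      have "conv r g y - conv r g x = (LINT z|lborel. (r (y - z) - r (x - z)) * g z)"
        unfolding conv_def using ig by (simp add: left_diff_distrib)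
      also have "norm \<dots> \<le> (LINT z|lborel. norm ((r (y - z) - r (x - z)) * g z))" by (rule integral_norm_bound)
      also have "\<dots> \<le> (LINT z|lborel. e / (N + 1) * \<bar>g z\<bar>)"
      proof (rule integral_mono')
        show "integrable lborel (\<lambda>z. e / (N + 1) * \<bar>g z\<bar>)" using g by auto
        fix z
        have "dist (r (y - z)) (r (x - z)) < e / (N + 1)" using y by (intro d) (simp add: dist_norm)
        then show "norm ((r (y - z) - r (x - z)) * g z) \<le> e / (N + 1) * \<bar>g z\<bar>"
          unfolding real_norm_def dist_real_def abs_mult by (intro mult_right_mono) auto
      qed (use e N in simp)
      also have "\<dots> = e * (N / (N + 1))" by (simp add: N_def)
      also have "\<dots> < e * 1" using e N by (intro mult_strict_left_mono) auto
      finally show "dist (conv r g y) (conv r g x) < e" by (simp add: dist_norm)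
    qed (use d in auto)
  qed
  then show ?thesis by (auto simp: continuous_on_iff)
qed

lemma C_k_conv: "C_c k K r \<Longrightarrow> integrable lborel g \<Longrightarrow> C_k k (conv r g)"
proof (induction k arbitrary: r)
  case 0 then show ?case using continuous_on_conv by auto
next
  case (Suc k)
  have "conv r g differentiable (at x)" for x
    using conv_has_derivative[OF Suc.prems] by (auto simp: differentiable_def)
  moreover have "C_k k (conv (partial i r) g)" for i using Suc.IH[OF C_c_partial] Suc.prems by blast
  ultimately show ?case using partial_conv[OF Suc.prems] by simp
qed

text \<open>The mollifier is a probability density on the ball of radius e, so a bound valid there
  passes to the average. The one-sided form is the one that applies to the constraint on fields, a
  family of linear inequalities.\<close>

lemma conv_moll_le:
  fixes g :: "real^'n::finite \<Rightarrow> real"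
  assumes e: "e > 0" and g: "integrable lborel g" and c: "\<And>y. dist x y < e \<Longrightarrow> g y \<le> c"
  shows "conv (moll e) g x \<le> c"
proof -
  have m: "moll e \<in> borel_measurable (borel :: (real^'n) measure)" using C_k_moll by (rule borel_measurable_C_k)
  have "conv (moll e) g x \<le> (LINT y|lborel. moll e (x - y) * c)"
    unfolding conv_def
  proof (rule integral_mono)
    show "integrable lborel (\<lambda>y. moll e (x - y) * g y)" by (rule conv_integrand_integrable[OF C_c_moll[OF e] g])
    show "integrable lborel (\<lambda>y. moll e (x - y) * c)"
      using lborel_integrable_reflect[OF integrable_moll[OF e], of x] by simp
    show "moll e (x - y) * g y \<le> moll e (x - y) * c" for y
      using c[of y] moll_nonneg[of e "x - y"] moll_eq_0[OF e, of "x - y"]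
      by (cases "dist x y < e") (auto simp: dist_norm intro: mult_left_mono)
  qed
  also have "\<dots> = c" using lborel_integral_reflect[OF m, of x] integral_moll[OF e, where 'n='n] by simp
  finally show ?thesis .
qed

lemma conv_minus_right: "conv r (\<lambda>y. - g y) x = - conv r g x"
  unfolding conv_def by simp

lemma conv_moll_dist_le:
  fixes g :: "real^'n::finite \<Rightarrow> real"
  assumes e: "e > 0" and g: "integrable lborel g" and c: "\<And>y. dist x y < e \<Longrightarrow> \<bar>g y - b\<bar> \<le> c"
  shows "\<bar>conv (moll e) g x - b\<bar> \<le> c"
proof -
  have "conv (moll e) g x \<le> b + c" using c by (intro conv_moll_le[OF e g]) (fastforce simp: abs_le_iff)
  moreover have "conv (moll e) (\<lambda>y. - g y) x \<le> c - b"
    using g c by (intro conv_moll_le[OF e]) (auto, fastforce simp: abs_le_iff)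
  ultimately show ?thesis by (simp add: conv_minus_right abs_le_iff)
qed

lemma conv_moll_eq_0:
  assumes e: "e > 0" and "\<And>y. dist x y < e \<Longrightarrow> g y = 0"
  shows "conv (moll e) g x = 0"
proof -
  have "moll e (x - y) * g y = 0" for y
    using moll_eq_0[OF e, of "x - y"] assms(2)[of y] by (cases "dist x y < e") (auto simp: dist_norm)
  then have "(\<lambda>y. moll e (x - y) * g y) = (\<lambda>_. 0)" by blast
  then show ?thesis unfolding conv_def by (simp only:) simp
qed

lemma integrable_conv_pair:
  fixes r :: "real^'n::finite \<Rightarrow> real"
  assumes r: "C_c k K r" and g: "integrable lborel g"
  shows "integrable (lborel \<Otimes>\<^sub>M lborel) (\<lambda>(y, x). r (x - y) * g y)"
proof -
  have [measurable]: "r \<in> borel_measurable borel" "g \<in> borel_measurable borel" using C_c_measurable[OF r] g by auto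
  have tr: "integrable lborel (\<lambda>x. r (x - y))" for y
    using lborel_integrable_translate[OF C_c_integrable[OF r], of "- y"] by simp
  show ?thesis
  proof (rule lborel_pair.Fubini_integrable)
    show "AE y in lborel. integrable lborel (\<lambda>x. case (y, x) of (y, x) \<Rightarrow> r (x - y) * g y)" using tr by simp
    have "(LINT x|lborel. \<bar>r (x - y)\<bar>) = (LINT x|lborel. \<bar>r x\<bar>)" for y
      using lborel_integral_translate[of "\<lambda>x. \<bar>r x\<bar>" "- y"] by simp
    then show "integrable lborel (\<lambda>y. LINT x|lborel. norm (case (y, x) of (y, x) \<Rightarrow> r (x - y) * g y))"
      using g by (simp add: abs_mult)
  qed measurable
qed

lemma integrable_conv:
  fixes r :: "real^'n::finite \<Rightarrow> real"
  assumes r: "C_c k K r" and g: "integrable lborel g"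
  shows "integrable lborel (conv r g)"
proof -
  show ?thesis using lborel_pair.integrable_snd[OF integrable_conv_pair[OF r g]] by (simp add: conv_def[abs_def])
qed

text \<open>Fubini's theorem, with joint integrability from the boundedness of h: the adjoint of a
  convolution is the convolution with the reflected kernel.\<close>

lemma conv_duality:
  fixes r :: "real^'n::finite \<Rightarrow> real"
  assumes r: "C_c k K r" and g: "integrable lborel g"
    and h: "h \<in> borel_measurable borel" "\<And>x. \<bar>h x\<bar> \<le> B"
  shows "(LINT x|lborel. conv r g x * h x) = (LINT y|lborel. g y * conv (\<lambda>z. r (- z)) h y)"
proof -
  have i: "integrable (lborel \<Otimes>\<^sub>M lborel) (\<lambda>(y, x). r (x - y) * g y * h x)"
  proof -
    have "integrable (lborel \<Otimes>\<^sub>M lborel) (\<lambda>p. h (snd p) * (case p of (y, x) \<Rightarrow> r (x - y) * g y))"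
      using h by (intro integrable_mult_bounded[of _ _ _ B] integrable_conv_pair[OF r g]) auto
    then show ?thesis by (simp add: split_def mult_ac)
  qed
  have "(LINT x|lborel. conv r g x * h x) = (LINT x|lborel. LINT y|lborel. r (x - y) * g y * h x)"
    unfolding conv_def by simp
  also have "\<dots> = (LINT y|lborel. LINT x|lborel. r (x - y) * g y * h x)"
    by (rule lborel_pair.Fubini_integral[OF i])
  also have "\<dots> = (LINT y|lborel. g y * (LINT x|lborel. r (x - y) * h x))"
    by (simp add: mult_ac flip: integral_mult_right_zero)
  finally show ?thesis by (simp add: conv_def)
qed

lemma integral_abs_conv_moll_le:
  fixes g :: "real^'n::finite \<Rightarrow> real"
  assumes e: "e > 0" and g: "integrable lborel g"
  shows "(LINT x|lborel. \<bar>conv (moll e) g x\<bar>) \<le> (LINT x|lborel. \<bar>g x\<bar>)"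
proof -
  have [measurable]: "g \<in> borel_measurable borel" using g by simp
  have i: "integrable lborel (\<lambda>x. \<bar>g x\<bar>)" using g by simp
  have "(LINT x|lborel. \<bar>conv (moll e) g x\<bar>) \<le> (LINT x|lborel. conv (moll e) (\<lambda>y. \<bar>g y\<bar>) x * 1)"
  proof (rule integral_mono)
    show "integrable lborel (\<lambda>x. \<bar>conv (moll e) g x\<bar>)" "integrable lborel (\<lambda>x. conv (moll e) (\<lambda>y. \<bar>g y\<bar>) x * 1)"
      using integrable_conv[OF C_c_moll[OF e]] g i by auto
    fix x
    have "\<bar>conv (moll e) g x\<bar> \<le> (LINT y|lborel. \<bar>moll e (x - y) * g y\<bar>)"
      unfolding conv_def using integral_norm_bound[of lborel "\<lambda>y. moll e (x - y) * g y"] by simp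
    then show "\<bar>conv (moll e) g x\<bar> \<le> conv (moll e) (\<lambda>y. \<bar>g y\<bar>) x * 1"
      by (simp add: conv_def abs_mult moll_nonneg)
  qed
  also have "\<dots> = (LINT y|lborel. \<bar>g y\<bar> * conv (\<lambda>z. moll e (- z)) (\<lambda>_. 1) y)"
    by (rule conv_duality[OF C_c_moll[OF e] i, where B=1]) auto
  also have "\<dots> = (LINT y|lborel. \<bar>g y\<bar>)"
  proof -
    have "conv (\<lambda>z. moll e (- z)) (\<lambda>_. 1) y = 1" for y :: "real^'n"
      using lborel_integral_reflect[of "moll e" y] integral_moll[OF e, where 'n='n]
        borel_measurable_C_k[OF C_k_moll[of 0 e, where 'n='n]]
      by (simp add: conv_def)
    then show ?thesis by simp
  qed
  finally show ?thesis .
qed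

section \<open>Integration by parts on the whole space\<close>

lemma integral_partial_zero:
  fixes f :: "real^'n::finite \<Rightarrow> real"
  assumes f: "C_c (Suc 0) K f"
  shows "(LINT x|lborel. partial i f x) = 0"
proof -
  have [measurable]: "f \<in> borel_measurable borel" using C_c_measurable[OF f] .
  obtain d where d: "d > 0" "\<And>x h. norm h < d \<Longrightarrow> \<bar>f (x + h) - f x - (\<Sum>i\<in>UNIV. h $ i * partial i f x)\<bar> \<le> 1 * norm h"
    using C_c_differential_uniform[OF f, of 1] by auto
  define t where "t n = min 1 d / (real n + 2)" for n
  have t: "0 < t n" "t n < 1" "t n < d" for n
  proof -
    show "0 < t n" using d by (simp add: t_def)
    have "min 1 d / (real n + 2) < min 1 d / 1" using d by (intro divide_strict_left_mono) auto
    then show "t n < 1" "t n < d" by (auto simp: t_def)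
  qed
  have t0: "t \<longlonglongrightarrow> 0" unfolding t_def by real_asymp
  define v where "v n = t n *\<^sub>R axis i (1::real)" for n
  have nv: "norm (v n) = t n" for n using t[of n] by (simp add: v_def norm_axis_1)
  have sv: "(\<Sum>j\<in>UNIV. v n $ j * partial j f x) = t n * partial i f x" for n x
    using sum_axis_mult[of i "\<lambda>j. partial j f x"] by (simp add: v_def mult.assoc flip: sum_distrib_left)
  \<comment> \<open>Difference quotients in direction i integrate to 0 by translation invariance.
    Dominated convergence carries this over to the partial derivative.\<close>
  define q where "q n x = (f (v n + x) - f x) / t n" for n x
  have intq: "(LINT x|lborel. q n x) = 0" for n
    unfolding q_def using lborel_integral_translate[of f "v n"] lborel_integrable_translate[OF C_c_integrable[OF f], of "v n"] C_c_integrable[OF f]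
    by simp
  obtain B where B: "\<And>x. \<bar>partial i f x\<bar> \<le> B" using C_c_bounded[OF C_c_partial[OF f]] by metis
  \<comment> \<open>The increments are shorter than 1, so all quotients vanish off this unit
    enlargement of K. They are bounded by \<open>B + 1\<close>: the derivative contributes B, and
    the remainder is at most the length of the increment.\<close>
  define K' where "K' = {x + y |x y. x \<in> K \<and> y \<in> cball (0::real^'n) 1}"
  have K': "compact K'" unfolding K'_def using C_c_cont(2)[OF f] by (intro compact_sums) auto
  have "(\<lambda>n. LINT x|lborel. q n x) \<longlonglongrightarrow> (LINT x|lborel. partial i f x)"
  proof (rule integral_dominated_convergence[where w="\<lambda>x. (B + 1) * indicator K' x"])
    show "integrable lborel (\<lambda>x. (B + 1) * indicat_real K' x)"
      using emeasure_compact_finite[OF K'] K' by (auto simp: compact_imp_closed)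
    show "AE x in lborel. (\<lambda>n. q n x) \<longlonglongrightarrow> partial i f x"
    proof (intro AE_I2)
      fix x
      have "f differentiable (at x)" using f by (simp add: C_c_def)
      from has_derivative_partial[OF this]
      have "((\<lambda>y. norm ((f (x + y) - f x - (\<Sum>j\<in>UNIV. y $ j * partial j f x)) /\<^sub>R norm y)) \<longlongrightarrow> 0) (at 0)"
        by (simp add: has_derivative_at abs_mult divide_inverse mult.commute)
      then have D: "((\<lambda>y. (f (x + y) - f x - (\<Sum>j\<in>UNIV. y $ j * partial j f x)) /\<^sub>R norm y) \<longlongrightarrow> 0) (at 0)"
        by (rule tendsto_norm_zero_cancel)
      have "v n \<noteq> 0" for n using nv[of n] t(1)[of n] by auto
      moreover have "v \<longlonglongrightarrow> 0" by (rule tendsto_norm_zero_cancel) (simp add: nv t0)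
      ultimately have "filterlim v (at 0) sequentially" unfolding filterlim_at by simp
      from filterlim_compose[OF D this]
      have "(\<lambda>n. (f (x + v n) - f x - t n * partial i f x) / t n) \<longlonglongrightarrow> 0" unfolding sv nv by (simp add: divide_inverse_commute)
      moreover have "(f (x + v n) - f x - t n * partial i f x) / t n = q n x - partial i f x" for n
        using t[of n] by (simp add: q_def field_simps)
      ultimately show "(\<lambda>n. q n x) \<longlonglongrightarrow> partial i f x" by (simp add: LIM_zero_iff)
    qed
    show "AE x in lborel. norm (q n x) \<le> (B + 1) * indicator K' x" for n
    proof (intro AE_I2)
      fix x
      show "norm (q n x) \<le> (B + 1) * indicator K' x"
      proof (cases "x \<in> K'")
        case True
        have "\<bar>f (x + v n) - f x - t n * partial i f x\<bar> \<le> t n" using d(2)[of "v n" x] t[of n] by (simp add: nv sv)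
        moreover have "\<bar>t n * partial i f x\<bar> \<le> t n * B" using t[of n] B[of x] by (simp add: abs_mult)
        ultimately have "\<bar>f (x + v n) - f x\<bar> \<le> t n * (B + 1)" by (simp add: algebra_simps)
        then have "\<bar>f (v n + x) - f x\<bar> / t n \<le> B + 1" using t[of n] by (simp add: add.commute field_simps)
        with True t[of n] show ?thesis by (simp add: q_def)
      next
        case False
        have "x \<notin> K"
        proof
          assume "x \<in> K"
          moreover have "x = x + 0" "0 \<in> cball (0::real^'n) 1" by auto
          ultimately have "x \<in> K'" unfolding K'_def by blast
          with False show False by simp
        qed
        moreover have "v n + x \<notin> K"
        proof
          assume "v n + x \<in> K"
          moreover have "x = (v n + x) + (- v n)" "- v n \<in> cball 0 1" using t[of n] by (auto simp: nv)
          ultimately have "x \<in> K'" unfolding K'_def by blast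
          with False show False by simp
        qed
        ultimately show ?thesis using C_c_cont(3)[OF f] False by (simp add: q_def)
      qed
    qed
    show "partial i f \<in> borel_measurable lborel" using C_c_measurable[OF C_c_partial[OF f]] by simp
    show "q n \<in> borel_measurable lborel" for n unfolding q_def[abs_def] by measurable
  qed
  with intq show ?thesis by (simp add: LIMSEQ_const_iff)
qed

lemma integration_by_parts:
  fixes w \<phi> :: "real^'n::finite \<Rightarrow> real"
  assumes w: "C_k (Suc 0) w" and \<phi>: "C_c (Suc 0) K \<phi>"
  shows "(LINT x|lborel. w x * partial i \<phi> x) = - (LINT x|lborel. partial i w x * \<phi> x)"
proof -
  have p: "C_c (Suc 0) K (\<lambda>x. w x * \<phi> x)" using w \<phi> by (auto simp: C_c_def intro!: C_k_mult simp del: C_k.simps)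
  have d: "w differentiable (at x)" "\<phi> differentiable (at x)" for x using w \<phi> by (auto simp: C_c_def)
  have "C_c 0 K (\<lambda>x. w x * partial i \<phi> x)" "C_c 0 K (\<lambda>x. partial i w x * \<phi> x)"
    using C_c_partial[OF \<phi>, of i] C_c_mono_k[OF \<phi>] w C_k_SucD[OF w]
    by (auto simp: C_c_def intro!: continuous_intros)
  from this[THEN C_c_integrable] integral_partial_zero[OF p, of i]
  show ?thesis by (simp add: partial_mult[OF d])
qed

section \<open>Density of continuous functions, and convergence of mollifications in the
  mean\<close>

lemma inner_compact_approx:
  fixes M :: "'a::{second_countable_topology, complete_space} measure"
  assumes "finite_measure M" and sets: "sets M = sets borel" and B: "B \<in> sets borel" and e: "e > 0"
  obtains K where "K \<subseteq> B" "compact K" "measure M B - e < measure M K"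
\<comment> \<open>Only a nonnegative difference can be carried into \<open>ennreal\<close>, where
  inner regularity is formulated; in the other case the empty set serves.\<close>
proof (cases "measure M B - e < 0")
  case True
  then show ?thesis by (intro that[of "{}"]) auto
next
  case False
  interpret finite_measure M by fact
  have "ennreal (measure M B - e) < emeasure M B"
    using e False by (simp add: emeasure_eq_measure ennreal_less_iff)
  also have "emeasure M B = (SUP K \<in> {K. K \<subseteq> B \<and> compact K}. emeasure M K)"
    using emeasure_finite by (intro inner_regular sets B) auto
  finally obtain K where K: "K \<subseteq> B" "compact K" "ennreal (measure M B - e) < emeasure M K"
    unfolding less_SUP_iff by auto
  then show ?thesis using that[of K] False by (simp add: emeasure_eq_measure ennreal_less_iff)
qed

text \<open>Sums and dominated limits preserve the claim, so indicators of sets A of finite measure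
  decide it. A compact subset C exhausts A up to small measure, and tent functions around C decrease
  to the indicator of C.\<close>

lemma L1_approx_continuous:
  fixes u :: "real^'n::finite \<Rightarrow> real"
  assumes "integrable lborel u"
  shows "\<forall>e>0. \<exists>g K. C_c 0 K g \<and> (LINT x|lborel. \<bar>u x - g x\<bar>) < e"
  using assms
proof (induction rule: integrable_induct)
  case (base A c)
  show ?case
  proof (intro allI impI)
    fix e :: real assume e: "e > 0"
    have A[measurable]: "A \<in> sets borel" using base by simp
    \<comment> \<open>Lebesgue measure on A, which is finite, so that the approximation by compact
      sets applies to it.\<close>
    define M where "M = density lborel (indicator A)"
    have eM: "emeasure M B = emeasure lborel (A \<inter> B)" if [measurable]: "B \<in> sets borel" for B
      by (simp add: M_def emeasure_density flip: indicator_inter_arith)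
    have fM: "finite_measure M"
      using base eM[of UNIV] by (intro finite_measureI) (simp add: M_def less_top)
    define e' where "e' = e / (2 * (\<bar>c\<bar> + 1))"
    have e': "e' > 0" unfolding e'_def using e by (intro divide_pos_pos mult_pos_pos) auto
    obtain C where C: "C \<subseteq> A" "compact C" "measure M A - e' < measure M C"
      by (rule inner_compact_approx[OF fM _ A e']) (simp add: M_def)
    moreover have "measure M A = measure lborel A" "measure M C = measure lborel C"
      using C by (simp_all add: measure_def eM compact_imp_closed Int_absorb1)
    ultimately have C: "C \<subseteq> A" "compact C" "measure lborel A - e' < measure lborel C" by simp_all
    have Cb[measurable]: "C \<in> sets borel" using C by (auto simp: compact_imp_closed)
    have iA: "integrable lborel (indicat_real A)" and iC: "integrable lborel (indicat_real C)"
      using base emeasure_compact_finite[OF C(2)] by auto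
    define C' where "C' = {x + y |x y. x \<in> C \<and> y \<in> cball (0::real^'n) 1}"
    have C': "compact C'" unfolding C'_def using C by (intro compact_sums) auto
    show "\<exists>g K. C_c 0 K g \<and> (LINT x|lborel. \<bar>indicator A x *\<^sub>R c - g x\<bar>) < e"
    \<comment> \<open>By convention \<open>infdist x {}\<close> is 0, and the tent functions would
      be constantly 1. For empty C the measure of A is below \<open>e'\<close>, so that the zero
      function is close enough.\<close>
    proof (cases "C = {}")
      case True
      have "(LINT x|lborel. \<bar>indicator A x *\<^sub>R c - 0\<bar>) = \<bar>c\<bar> * measure lborel A"
        using A by (simp add: abs_mult)
      also have "\<dots> \<le> (\<bar>c\<bar> + 1) * measure lborel A" by (intro mult_right_mono) auto
      also have "\<dots> \<le> (\<bar>c\<bar> + 1) * e'" using C True by (intro mult_left_mono) auto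
      also have "\<dots> < e" using e by (simp add: e'_def field_simps add_pos_nonneg)
      finally show ?thesis by (intro exI[of _ "\<lambda>_. 0"] exI[of _ "{}"]) (simp add: C_c_def)
    next
      case False
      define g where "g n x = max 0 (1 - real n * infdist x C)" for n x
      have gc: "continuous_on UNIV (g n)" for n unfolding g_def by (intro continuous_intros)
      have g0: "g n x = 0" if "x \<notin> C'" "n \<ge> 1" for n x
      proof -
        have "infdist x C \<ge> 1"
        proof (rule ccontr)
          assume "\<not> infdist x C \<ge> 1"
          moreover obtain a where "a \<in> C" "infdist x C = dist x a" using infdist_attains_inf[OF _ False, of x] C compact_imp_closed by blast
          ultimately have "x = a + (x - a)" "x - a \<in> cball 0 1" "a \<in> C" by (auto simp: dist_norm norm_minus_commute)
          then have "x \<in> C'" unfolding C'_def by blast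
          with that show False by simp
        qed
        then have "real n * infdist x C \<ge> 1 * 1" using that by (intro mult_mono) auto
        then show ?thesis by (simp add: g_def)
      qed
      have glim: "(\<lambda>n. g n x) \<longlonglongrightarrow> indicator C x" for x
      proof (cases "x \<in> C")
        case True then show ?thesis by (simp add: g_def)
      next
        case F: False
        then have pos: "infdist x C > 0" using False C compact_imp_closed in_closed_iff_infdist_zero[of C x] infdist_nonneg[of x C] by force
        have "\<forall>\<^sub>F n in sequentially. g n x = 0"
        proof -
          obtain N where N: "1 / infdist x C < real N" using reals_Archimedean2 by blast
          have "g n x = 0" if "n \<ge> N" for n
          proof -
            have "1 / infdist x C < real n" using N that by linarith
            then have "1 < real n * infdist x C" using pos by (simp add: divide_less_eq)
            then show ?thesis by (simp add: g_def)
          qed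
          then show ?thesis by (auto simp: eventually_sequentially)
        qed
        then show ?thesis using F by (simp add: tendsto_eventually)
      qed
      have gb: "\<bar>g n x\<bar> \<le> 1" for n x by (simp add: g_def infdist_nonneg)
      have "(\<lambda>n. LINT x|lborel. \<bar>g (Suc n) x - indicator C x\<bar>) \<longlonglongrightarrow> (LINT x|(lborel :: (real^'n) measure). 0)"
      proof (rule integral_dominated_convergence[where w="\<lambda>x. 2 * indicator C' x"])
        show "integrable lborel (\<lambda>x. 2 * indicat_real C' x)"
          using emeasure_compact_finite[OF C'] C' by (auto simp: compact_imp_closed)
        show "AE x in lborel. (\<lambda>n. \<bar>g (Suc n) x - indicator C x\<bar>) \<longlonglongrightarrow> 0"
          using LIMSEQ_Suc[OF glim] by (auto intro!: tendsto_rabs_zero simp: LIM_zero_iff)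
        show "AE x in lborel. norm \<bar>g (Suc n) x - indicator C x\<bar> \<le> 2 * indicator C' x" for n
        proof (intro AE_I2)
          fix x
          have "x \<in> C'" if "x \<in> C" using that unfolding C'_def by (intro CollectI exI[of _ x] exI[of _ 0]) auto
          then show "norm \<bar>g (Suc n) x - indicator C x\<bar> \<le> 2 * indicator C' x"
            using g0[of x "Suc n"] gb[of "Suc n" x] by (auto simp: indicator_def abs_le_iff split: if_splits)
        qed
        show "(\<lambda>x. \<bar>g (Suc n) x - indicat_real C x\<bar>) \<in> borel_measurable lborel" for n
          using borel_measurable_continuous_onI[OF gc] by simp
      qed simp
      then have "\<forall>\<^sub>F n in sequentially. (LINT x|lborel. \<bar>g (Suc n) x - indicator C x\<bar>) < e'"
        using e' by (intro order_tendstoD(2)[where y=0]) auto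
      then obtain n where n: "(LINT x|lborel. \<bar>g (Suc n) x - indicator C x\<bar>) < e'" by (auto simp: eventually_sequentially)
      have gC: "C_c 0 C' (g (Suc n))" using gc g0 C' by (auto simp: C_c_def)
      then have gi: "integrable lborel (g (Suc n))" by (rule C_c_integrable)
      have "(LINT x|lborel. \<bar>indicator A x *\<^sub>R c - c * g (Suc n) x\<bar>) = \<bar>c\<bar> * (LINT x|lborel. \<bar>indicator A x - g (Suc n) x\<bar>)"
        by (simp add: abs_mult[symmetric] algebra_simps flip: integral_mult_right_zero)
      also have "(LINT x|lborel. \<bar>indicator A x - g (Suc n) x\<bar>) \<le>
          (LINT x|lborel. (indicator A x - indicator C x) + \<bar>g (Suc n) x - indicator C x\<bar>)"
      proof (rule integral_mono)
        show "\<bar>indicator A x - g (Suc n) x\<bar> \<le> (indicator A x - indicator C x) + \<bar>g (Suc n) x - indicator C x\<bar>" for x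
          using C(1) by (auto simp: indicator_def)
      qed (use iA iC gi in simp_all)
      also have "\<dots> = (measure lborel A - measure lborel C) + (LINT x|lborel. \<bar>g (Suc n) x - indicator C x\<bar>)"
        using iA iC gi by simp
      also have "\<dots> \<le> 2 * e'" using n C(3) by simp
      also have "\<bar>c\<bar> * (2 * e') < (\<bar>c\<bar> + 1) * (2 * e')" using e' by (intro mult_strict_right_mono) auto
      also have "\<dots> = e" using e by (simp add: e'_def field_simps)
      finally have "(LINT x|lborel. \<bar>indicator A x *\<^sub>R c - c * g (Suc n) x\<bar>) < e" by (simp add: mult_left_mono)
      moreover have "C_c 0 C' (\<lambda>x. c * g (Suc n) x)" using gC by (auto simp: C_c_def intro!: continuous_intros)
      ultimately show ?thesis by blast
    qed
  qed
next
  case (add f g)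
  show ?case
  proof (intro allI impI)
    fix e :: real assume "e > 0"
    then have e2: "e / 2 > 0" by simp
    obtain f' K where f': "C_c 0 K f'" "(LINT x|lborel. \<bar>f x - f' x\<bar>) < e / 2"
      using add.IH(1)[rule_format, OF e2] by blast
    obtain g' K' where g': "C_c 0 K' g'" "(LINT x|lborel. \<bar>g x - g' x\<bar>) < e / 2"
      using add.IH(2)[rule_format, OF e2] by blast
    have i: "integrable lborel f'" "integrable lborel g'" using f' g' C_c_integrable by blast+
    have "(LINT x|lborel. \<bar>(f x + g x) - (f' x + g' x)\<bar>) \<le> (LINT x|lborel. \<bar>f x - f' x\<bar> + \<bar>g x - g' x\<bar>)"
      using add.hyps i by (intro integral_mono) auto
    also have "\<dots> < e" using add.hyps i f' g' by simp
    finally have "(LINT x|lborel. \<bar>(f x + g x) - (f' x + g' x)\<bar>) < e" .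
    moreover have "C_c 0 (K \<union> K') (\<lambda>x. f' x + g' x)" using f' g' by (auto simp: C_c_def intro!: continuous_intros)
    ultimately show "\<exists>h K. C_c 0 K h \<and> (LINT x|lborel. \<bar>(f x + g x) - h x\<bar>) < e" by blast
  qed
next
  case (lim f s)
  show ?case
  proof (intro allI impI)
    fix e :: real assume e: "e > 0"
    have [measurable]: "f \<in> borel_measurable borel" "s n \<in> borel_measurable borel" for n using lim.hyps by auto
    have "(\<lambda>n. LINT x|lborel. \<bar>f x - s n x\<bar>) \<longlonglongrightarrow> (LINT x|(lborel :: (real^'n) measure). 0)"
    proof (rule integral_dominated_convergence[where w="\<lambda>x. 3 * \<bar>f x\<bar>"])
      show "AE x in lborel. (\<lambda>n. \<bar>f x - s n x\<bar>) \<longlonglongrightarrow> 0"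
      proof (intro AE_I2)
        fix x
        have "(\<lambda>n. f x - s n x) \<longlonglongrightarrow> f x - f x" using lim.hyps(2) by (intro tendsto_intros) auto
        then show "(\<lambda>n. \<bar>f x - s n x\<bar>) \<longlonglongrightarrow> 0" by (intro tendsto_rabs_zero) simp
      qed
      show "AE x in lborel. norm \<bar>f x - s n x\<bar> \<le> 3 * \<bar>f x\<bar>" for n
      proof (intro AE_I2)
        fix x show "norm \<bar>f x - s n x\<bar> \<le> 3 * \<bar>f x\<bar>" using lim.hyps(3)[of x n] by (simp add: abs_if split: if_splits)
      qed
    qed (use lim.hyps in auto)
    then have "\<forall>\<^sub>F n in sequentially. (LINT x|lborel. \<bar>f x - s n x\<bar>) < e / 2"
      using e by (intro order_tendstoD(2)[where y=0]) auto
    then obtain n where n: "(LINT x|lborel. \<bar>f x - s n x\<bar>) < e / 2" by (auto simp: eventually_sequentially)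
    obtain g K where g: "C_c 0 K g" "(LINT x|lborel. \<bar>s n x - g x\<bar>) < e / 2" using lim.IH[of n] half_gt_zero[OF e] by blast
    have i: "integrable lborel g" using g C_c_integrable by blast
    have "(LINT x|lborel. \<bar>f x - g x\<bar>) \<le> (LINT x|lborel. \<bar>f x - s n x\<bar> + \<bar>s n x - g x\<bar>)"
      using lim.hyps i by (intro integral_mono) auto
    also have "\<dots> < e" using lim.hyps i g n by simp
    finally show "\<exists>g K. C_c 0 K g \<and> (LINT x|lborel. \<bar>f x - g x\<bar>) < e" using g by blast
  qed
qed

text \<open>Three errors: u is replaced by a continuous g of compact support, mollification does not
  increase that error in the mean, and for g the convergence is uniform with everything supported in
  one compact set.\<close>

lemma conv_moll_L1:
  fixes u :: "real^'n::finite \<Rightarrow> real"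
  assumes u: "integrable lborel u" and eta: "\<eta> > 0"
  obtains e0 where "e0 > 0" "\<And>e. 0 < e \<Longrightarrow> e < e0 \<Longrightarrow> (LINT x|lborel. \<bar>conv (moll e) u x - u x\<bar>) < \<eta>"
proof -
  obtain g K where g: "C_c 0 K g" "(LINT x|lborel. \<bar>u x - g x\<bar>) < \<eta> / 3"
    using L1_approx_continuous[OF u] eta by (metis divide_pos_pos zero_less_numeral)
  have gi: "integrable lborel g" using g C_c_integrable by blast
  define K' where "K' = {x + y |x y. x \<in> K \<and> y \<in> cball (0::real^'n) 1}"
  have K': "compact K'" unfolding K'_def using C_c_cont(2)[OF g(1)] by (intro compact_sums) auto
  define m where "m = measure lborel K'"
  have m: "m \<ge> 0" by (simp add: m_def)
  define c where "c = \<eta> / (3 * (m + 1))"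
  have c: "c > 0" using eta m by (simp add: c_def)
  obtain d where d: "d > 0" "\<And>x y. dist x y < d \<Longrightarrow> dist (g x) (g y) < c"
    using uniformly_continuous_compact_support[OF C_c_cont[OF g(1)] c] by blast
  have iK': "integrable lborel (indicat_real K')" using emeasure_compact_finite[OF K'] K' by (auto simp: compact_imp_closed)
  show ?thesis
  proof (rule that[of "min d 1"])
    fix e assume e: "0 < e" "e < min d 1"
    have "\<bar>conv (moll e) g x - g x\<bar> \<le> c * indicator K' x" for x
    proof (cases "x \<in> K'")
      case True
      have "\<bar>conv (moll e) g x - g x\<bar> \<le> c"
      proof (rule conv_moll_dist_le[OF e(1) gi])
        fix y assume "dist x y < e"
        then have "dist (g y) (g x) < c" using e by (intro d) (simp add: dist_commute)
        then show "\<bar>g y - g x\<bar> \<le> c" by (simp add: dist_real_def)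
      qed
      with True show ?thesis by simp
    next
      case False
      have z: "y \<notin> K" if "dist x y \<le> 1" for y
      proof
        assume "y \<in> K"
        moreover have "x = y + (x - y)" "x - y \<in> cball 0 1" using that by (auto simp: dist_norm norm_minus_commute)
        ultimately show False using False unfolding K'_def by blast
      qed
      then have "g y = 0" if "dist x y < e" for y using that e C_c_cont(3)[OF g(1)] by simp
      then have "conv (moll e) g x = 0" by (intro conv_moll_eq_0 e)
      moreover have "g x = 0" using z[of x] C_c_cont(3)[OF g(1)] by simp
      ultimately show ?thesis using False by simp
    qed
    then have A: "(LINT x|lborel. \<bar>conv (moll e) g x - g x\<bar>) \<le> c * m"
      using integral_mono'[of lborel "\<lambda>x. c * indicator K' x" "\<lambda>x. \<bar>conv (moll e) g x - g x\<bar>"] iK' K' c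
      by (simp add: m_def compact_imp_closed)
    have cm: "c * m < \<eta> / 3" using eta m by (simp add: c_def field_simps)
    have diff: "conv (moll e) (\<lambda>y. u y - g y) x = conv (moll e) u x - conv (moll e) g x" for x
      using conv_integrand_integrable[OF C_c_moll[OF e(1)] u] conv_integrand_integrable[OF C_c_moll[OF e(1)] gi]
      by (simp add: conv_def right_diff_distrib)
    have B: "(LINT x|lborel. \<bar>conv (moll e) (\<lambda>y. u y - g y) x\<bar>) < \<eta> / 3"
      using integral_abs_conv_moll_le[OF e(1), of "\<lambda>y. u y - g y"] u gi g(2) by simp
    have ic: "integrable lborel (conv (moll e) f)" if "integrable lborel f" for f using integrable_conv[OF C_c_moll[OF e(1)] that] .
    have "(LINT x|lborel. \<bar>conv (moll e) u x - u x\<bar>) \<le>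
      (LINT x|lborel. \<bar>conv (moll e) (\<lambda>y. u y - g y) x\<bar> + \<bar>conv (moll e) g x - g x\<bar> + \<bar>u x - g x\<bar>)"
    proof (rule integral_mono)
      show "integrable lborel (\<lambda>x. \<bar>conv (moll e) u x - u x\<bar>)" using ic[OF u] u by simp
      have "integrable lborel (\<lambda>y. u y - g y)" using u gi by simp
      from ic[OF this] show "integrable lborel (\<lambda>x. \<bar>conv (moll e) (\<lambda>y. u y - g y) x\<bar> + \<bar>conv (moll e) g x - g x\<bar> + \<bar>u x - g x\<bar>)"
        using ic[OF gi] u gi by simp
      show "\<bar>conv (moll e) u x - u x\<bar> \<le> \<bar>conv (moll e) (\<lambda>y. u y - g y) x\<bar> + \<bar>conv (moll e) g x - g x\<bar> + \<bar>u x - g x\<bar>" for x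
        unfolding diff by linarith
    qed
    also have "\<dots> = (LINT x|lborel. \<bar>conv (moll e) (\<lambda>y. u y - g y) x\<bar>) + (LINT x|lborel. \<bar>conv (moll e) g x - g x\<bar>) + (LINT x|lborel. \<bar>u x - g x\<bar>)"
      using ic[of "\<lambda>y. u y - g y"] ic[OF gi] ic[OF u] u gi by simp
    also have "\<dots> < \<eta>" using A B cm g(2) by simp
    finally show "(LINT x|lborel. \<bar>conv (moll e) u x - u x\<bar>) < \<eta>" .
  qed (use d in auto)
qed


section \<open>Anisotropic variation and truncation\<close>

text \<open>For \<psi> of the class the inequality says that \<open>\<phi> x\<close> lies in the
  subdifferential of \<open>\<psi> x\<close> at 0, a convex set.\<close>

definition admissible :: "(real^'n::finite) set \<Rightarrow> (real^'n \<Rightarrow> real^'n \<Rightarrow> real) \<Rightarrow> (real^'n \<Rightarrow> real^'n) \<Rightarrow> bool" where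
  "admissible \<Omega> \<psi> \<phi> \<longleftrightarrow> (\<forall>i. test_fun \<Omega> (\<lambda>x. \<phi> x $ i)) \<and> (\<forall>x \<xi>. \<phi> x \<bullet> \<xi> \<le> \<psi> x \<xi>)"

definition diverg :: "(real^'n::finite \<Rightarrow> real^'n) \<Rightarrow> real^'n \<Rightarrow> real" where
  "diverg \<phi> x = (\<Sum>i\<in>UNIV. partial i (\<lambda>x. \<phi> x $ i) x)"

definition pairing :: "(real^'n::finite \<Rightarrow> real) \<Rightarrow> (real^'n \<Rightarrow> real^'n) \<Rightarrow> real" where
  "pairing w \<phi> = - (LINT x|lborel. w x * diverg \<phi> x)"

text \<open>\<open>ennreal\<close> turns negative pairings into 0. This leaves the supremum
  unchanged as soon as the zero field is admissible.\<close>

definition aniso_var :: "(real^'n::finite) set \<Rightarrow> (real^'n \<Rightarrow> real^'n \<Rightarrow> real) \<Rightarrow> (real^'n \<Rightarrow> real) \<Rightarrow> ennreal" where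
  "aniso_var \<Omega> \<psi> w = (SUP \<phi>\<in>{\<phi>. admissible \<Omega> \<psi> \<phi>}. ennreal (pairing w \<phi>))"

text \<open>Functions are Borel on the whole space but integrable only on \<Omega>. Their values
  elsewhere do not enter pairings, because the divergence of a test field vanishes there.\<close>

definition L1_on :: "(real^'n::finite) set \<Rightarrow> (real^'n \<Rightarrow> real) \<Rightarrow> bool" where
  "L1_on \<Omega> w \<longleftrightarrow> w \<in> borel_measurable borel \<and> integrable lborel (\<lambda>x. indicator \<Omega> x * w x)"

lemma aniso_var_le_iff: "aniso_var \<Omega> \<psi> w \<le> M \<longleftrightarrow> (\<forall>\<phi>. admissible \<Omega> \<psi> \<phi> \<longrightarrow> ennreal (pairing w \<phi>) \<le> M)"
  unfolding aniso_var_def by (auto simp: SUP_le_iff)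

lemma pairing_le_aniso_var: "admissible \<Omega> \<psi> \<phi> \<Longrightarrow> ennreal (pairing w \<phi>) \<le> aniso_var \<Omega> \<psi> w"
  unfolding aniso_var_def by (rule SUP_upper) simp

lemma test_fun_C_c:
  assumes "test_fun \<Omega> \<phi>" obtains K where "K \<subseteq> \<Omega>" "\<And>k. C_c k K \<phi>"
  using test_fun_support[OF assms] test_fun_C_k[OF assms] unfolding C_c_def by metis

lemma test_fun_partial_outside: "test_fun \<Omega> \<phi> \<Longrightarrow> x \<notin> \<Omega> \<Longrightarrow> partial i \<phi> x = 0"
  using test_fun_support[of \<Omega> \<phi>] by (metis subset_iff)

lemma diverg_outside:
  assumes "\<forall>i. test_fun \<Omega> (\<lambda>x. \<phi> x $ i)" "x \<notin> \<Omega>"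
  shows "diverg \<phi> x = 0"
  using test_fun_partial_outside[OF assms(1)[rule_format] assms(2)] by (simp add: diverg_def)

lemma diverg_bounded:
  assumes "\<forall>i. test_fun \<Omega> (\<lambda>x. \<phi> x $ i)"
  obtains B where "B > 0" "\<And>x. \<bar>diverg \<phi> x\<bar> \<le> B"
proof -
  have "\<exists>B. \<forall>x. \<bar>partial i (\<lambda>x. \<phi> x $ i) x\<bar> \<le> B" for i
  proof -
    obtain K where "\<And>k. C_c k K (\<lambda>x. \<phi> x $ i)" using assms test_fun_C_c by metis
    then have "C_c 0 K (partial i (\<lambda>x. \<phi> x $ i))" using C_c_partial by blast
    then show ?thesis using C_c_bounded by blast
  qed
  then obtain B where B: "\<And>i x. \<bar>partial i (\<lambda>x. \<phi> x $ i) x\<bar> \<le> B i" by metis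
  have "\<bar>diverg \<phi> x\<bar> \<le> 1 + (\<Sum>i\<in>UNIV. \<bar>B i\<bar>)" for x
  proof -
    have "\<bar>diverg \<phi> x\<bar> \<le> (\<Sum>i\<in>UNIV. \<bar>partial i (\<lambda>x. \<phi> x $ i) x\<bar>)" unfolding diverg_def by (rule sum_abs)
    also have "\<dots> \<le> (\<Sum>i\<in>UNIV. \<bar>B i\<bar>)" by (intro sum_mono order_trans[OF B]) simp
    finally show ?thesis by simp
  qed
  moreover have "1 + (\<Sum>i\<in>UNIV. \<bar>B i\<bar>) > 0" by (intro add_pos_nonneg sum_nonneg) auto
  ultimately show ?thesis using that by blast
qed

lemma diverg_measurable:
  assumes "\<forall>i. test_fun \<Omega> (\<lambda>x. \<phi> x $ i)"
  shows "diverg \<phi> \<in> borel_measurable borel"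
proof -
  have "partial i (\<lambda>x. \<phi> x $ i) \<in> borel_measurable borel" for i
  proof -
    have "C_k (Suc 0) (\<lambda>x. \<phi> x $ i)" using assms test_fun_C_k by blast
    then show ?thesis by (auto intro!: borel_measurable_continuous_onI)
  qed
  then show ?thesis unfolding diverg_def[abs_def] by measurable
qed

lemma L1_on_diverg_integrable:
  assumes w: "L1_on \<Omega> w" and \<phi>: "\<forall>i. test_fun \<Omega> (\<lambda>x. \<phi> x $ i)"
  shows "integrable lborel (\<lambda>x. w x * diverg \<phi> x)"
proof -
  obtain B where B: "\<And>x. \<bar>diverg \<phi> x\<bar> \<le> B" using diverg_bounded[OF \<phi>] by blast
  have "integrable lborel (\<lambda>x. diverg \<phi> x * (indicator \<Omega> x * w x))"
    using w diverg_measurable[OF \<phi>] B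
    by (intro integrable_mult_bounded[of _ "\<lambda>x. indicator \<Omega> x * w x" "diverg \<phi>" B]) (auto simp: L1_on_def)
  moreover have "diverg \<phi> x * (indicator \<Omega> x * w x) = w x * diverg \<phi> x" for x
    using diverg_outside[OF \<phi>, of x] by (cases "x \<in> \<Omega>") auto
  ultimately show ?thesis by simp
qed

lemma L1_on_add: "L1_on \<Omega> v \<Longrightarrow> L1_on \<Omega> w \<Longrightarrow> L1_on \<Omega> (\<lambda>x. v x + w x)"
  by (auto simp: L1_on_def distrib_left)

lemma L1_on_cmult: "L1_on \<Omega> w \<Longrightarrow> L1_on \<Omega> (\<lambda>x. c * w x)"
  by (auto simp: L1_on_def mult.left_commute)

lemma L1_on_diff: "L1_on \<Omega> v \<Longrightarrow> L1_on \<Omega> w \<Longrightarrow> L1_on \<Omega> (\<lambda>x. v x - w x)"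
  by (auto simp: L1_on_def right_diff_distrib)

lemma pairing_add:
  assumes "L1_on \<Omega> v" "L1_on \<Omega> w" "\<forall>i. test_fun \<Omega> (\<lambda>x. \<phi> x $ i)"
  shows "pairing (\<lambda>x. v x + w x) \<phi> = pairing v \<phi> + pairing w \<phi>"
  using L1_on_diverg_integrable[OF assms(1,3)] L1_on_diverg_integrable[OF assms(2,3)]
  by (simp add: pairing_def distrib_right)

lemma pairing_cmult: "pairing (\<lambda>x. c * w x) \<phi> = c * pairing w \<phi>"
  by (simp add: pairing_def mult.assoc)

lemma pairing_dist_le:
  assumes "L1_on \<Omega> v" "L1_on \<Omega> w" "\<forall>i. test_fun \<Omega> (\<lambda>x. \<phi> x $ i)" "\<And>x. \<bar>diverg \<phi> x\<bar> \<le> B"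
  shows "\<bar>pairing v \<phi> - pairing w \<phi>\<bar> \<le> B * (LINT x|lborel. \<bar>indicator \<Omega> x * (v x - w x)\<bar>)"
proof -
  have "pairing v \<phi> - pairing w \<phi> = - (LINT x|lborel. (v x - w x) * diverg \<phi> x)"
    using L1_on_diverg_integrable[OF assms(1,3)] L1_on_diverg_integrable[OF assms(2,3)]
    by (simp add: pairing_def left_diff_distrib)
  then have "\<bar>pairing v \<phi> - pairing w \<phi>\<bar> \<le> (LINT x|lborel. \<bar>(v x - w x) * diverg \<phi> x\<bar>)"
    using integral_norm_bound[of lborel "\<lambda>x. (v x - w x) * diverg \<phi> x"] by simp
  also have "\<dots> \<le> (LINT x|lborel. B * \<bar>indicator \<Omega> x * (v x - w x)\<bar>)"
  proof (rule integral_mono')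
    have "integrable lborel (\<lambda>x. indicator \<Omega> x * (v x - w x))"
      using L1_on_diff[OF assms(1,2)] by (simp add: L1_on_def)
    then show "integrable lborel (\<lambda>x. B * \<bar>indicator \<Omega> x * (v x - w x)\<bar>)" by auto
    fix x
    show "\<bar>(v x - w x) * diverg \<phi> x\<bar> \<le> B * \<bar>indicator \<Omega> x * (v x - w x)\<bar>"
      using diverg_outside[OF assms(3), of x] mult_left_mono[OF assms(4)[of x], of "\<bar>v x - w x\<bar>"]
      by (cases "x \<in> \<Omega>") (auto simp: abs_mult mult.commute)
    show "0 \<le> B * \<bar>indicator \<Omega> x * (v x - w x)\<bar>" using assms(4)[of x] by (intro mult_nonneg_nonneg) auto
  qed
  finally show ?thesis by simp
qed

lemma compact_margin:
  fixes K \<Omega> :: "'a::euclidean_space set"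
  assumes "compact K" "K \<subseteq> \<Omega>" "open \<Omega>"
  obtains d where "d > 0" "\<And>x. x \<in> K \<Longrightarrow> cball x d \<subseteq> \<Omega>"
proof (cases "K = {}")
  case True then show ?thesis using that[of 1] by auto
next
  case False
  obtain e where e: "e > 0" "{x. infdist x K \<le> e} \<subseteq> \<Omega>"
    using compact_in_open_separated[OF False assms(1,3,2)] by blast
  show ?thesis
  proof (rule that[OF e(1)])
    fix x assume "x \<in> K"
    then have "infdist y K \<le> e" if "y \<in> cball x e" for y using that infdist_le2[of x K y e] by (simp add: dist_commute)
    then show "cball x e \<subseteq> \<Omega>" using e(2) by blast
  qed
qed

lemma test_fun_conv_moll:
  fixes g :: "real^'n::finite \<Rightarrow> real"
  assumes e: "e > 0" and K: "compact K" "\<And>x. x \<in> K \<Longrightarrow> cball x e \<subseteq> \<Omega>"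
    and g: "integrable lborel g" "\<And>x. x \<notin> K \<Longrightarrow> g x = 0"
  shows "test_fun \<Omega> (conv (moll e) g)"
proof (rule test_funI)
  define K' where "K' = {x + y |x y. x \<in> K \<and> y \<in> cball (0::real^'n) e}"
  show "compact K'" unfolding K'_def using K(1) by (intro compact_sums) auto
  show "C_k k (conv (moll e) g)" for k by (rule C_k_conv[OF C_c_moll[OF e] g(1)])
  show "K' \<subseteq> \<Omega>"
  proof
    fix z assume "z \<in> K'"
    then obtain x y where "x \<in> K" "y \<in> cball 0 e" "z = x + y" unfolding K'_def by blast
    then have "z \<in> cball x e" by (simp add: dist_norm)
    with K(2)[OF \<open>x \<in> K\<close>] show "z \<in> \<Omega>" by blast
  qed
  show "conv (moll e) g x = 0" if x: "x \<notin> K'" for x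
  proof (rule conv_moll_eq_0[OF e])
    fix y assume y: "dist x y < e"
    have "y \<notin> K"
    proof
      assume "y \<in> K"
      moreover have "x = y + (x - y)" "x - y \<in> cball 0 e" using y by (auto simp: dist_norm norm_minus_commute)
      ultimately have "x \<in> K'" unfolding K'_def by blast
      with x show False by simp
    qed
    then show "g y = 0" by (rule g(2))
  qed
qed

lemma conv_moll_partial_duality:
  fixes w \<theta> :: "real^'n::finite \<Rightarrow> real"
  assumes e: "e > 0" and w: "integrable lborel w" and \<theta>: "integrable lborel \<theta>" "\<And>x. \<bar>\<theta> x\<bar> \<le> B"
  shows "(LINT x|lborel. partial i (conv (moll e) w) x * \<theta> x) = - (LINT x|lborel. w x * partial i (conv (moll e) \<theta>) x)"
proof -
  have Cm: "C_c (Suc 0) (cball 0 e) (moll e :: real^'n \<Rightarrow> real)" by (rule C_c_moll[OF e])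
  have "(LINT x|lborel. partial i (conv (moll e) w) x * \<theta> x) =
     (LINT y|lborel. w y * conv (\<lambda>z. partial i (moll e) (- z)) \<theta> y)"
    unfolding partial_conv[OF Cm w] using \<theta>(1) by (intro conv_duality[OF C_c_partial[OF Cm] w _ \<theta>(2)]) auto
  also have "conv (\<lambda>z. partial i (moll e) (- z)) \<theta> = (\<lambda>y. - partial i (conv (moll e) \<theta>) y)"
    unfolding partial_conv[OF Cm \<theta>(1)] by (auto simp: conv_def partial_moll_minus)
  finally show ?thesis by simp
qed

text \<open>Mollification is moved from the field to the function. So \<Theta> need only be bounded
  and integrable, and the derivative falls on a smooth function even though w may have none.\<close>

lemma pairing_conv_moll:
  fixes w :: "real^'n::finite \<Rightarrow> real" and \<Theta> :: "real^'n \<Rightarrow> real^'n"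
  assumes e: "e > 0" and w: "L1_on \<Omega> w"
    and \<Theta>: "\<And>i. integrable lborel (\<lambda>x. \<Theta> x $ i)" "\<And>i x. \<bar>\<Theta> x $ i\<bar> \<le> B"
    and tf: "\<And>i. test_fun \<Omega> (conv (moll e) (\<lambda>x. \<Theta> x $ i))"
  shows "pairing w (\<lambda>x. \<chi> i. conv (moll e) (\<lambda>x. \<Theta> x $ i) x) =
    (\<Sum>i\<in>UNIV. LINT x|lborel. partial i (conv (moll e) (\<lambda>x. indicator \<Omega> x * w x)) x * \<Theta> x $ i)"
proof -
  let ?w = "\<lambda>x. indicator \<Omega> x * w x"
  have wi: "integrable lborel ?w" using w by (simp add: L1_on_def)
  have one: "(LINT x|lborel. partial i (conv (moll e) ?w) x * \<Theta> x $ i) =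
      - (LINT x|lborel. w x * partial i (conv (moll e) (\<lambda>x. \<Theta> x $ i)) x)" for i
  proof -
    have "(LINT x|lborel. partial i (conv (moll e) ?w) x * \<Theta> x $ i) =
        - (LINT y|lborel. ?w y * partial i (conv (moll e) (\<lambda>x. \<Theta> x $ i)) y)"
      by (rule conv_moll_partial_duality[OF e wi \<Theta>])
    \<comment> \<open>Extending w by zero changes nothing, since the derivatives of a test function
      vanish off \<Omega>.\<close>
    also have "(\<lambda>y. ?w y * partial i (conv (moll e) (\<lambda>x. \<Theta> x $ i)) y) = (\<lambda>y. w y * partial i (conv (moll e) (\<lambda>x. \<Theta> x $ i)) y)"
    proof
      fix y
      show "?w y * partial i (conv (moll e) (\<lambda>x. \<Theta> x $ i)) y = w y * partial i (conv (moll e) (\<lambda>x. \<Theta> x $ i)) y"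
        using test_fun_partial_outside[OF tf[of i], of y] by (cases "y \<in> \<Omega>") auto
    qed
    finally show ?thesis .
  qed
  have int: "integrable lborel (\<lambda>x. w x * partial i (conv (moll e) (\<lambda>x. \<Theta> x $ i)) x)" for i
  proof -
    obtain K where K: "K \<subseteq> \<Omega>" "\<And>k. C_c k K (conv (moll e) (\<lambda>x. \<Theta> x $ i))" using test_fun_C_c[OF tf] by blast
    have p: "C_c 0 K (partial i (conv (moll e) (\<lambda>x. \<Theta> x $ i)))" using C_c_partial[OF K(2)] .
    obtain B where "\<And>x. \<bar>partial i (conv (moll e) (\<lambda>x. \<Theta> x $ i)) x\<bar> \<le> B" using C_c_bounded[OF p] by blast
    then have "integrable lborel (\<lambda>x. partial i (conv (moll e) (\<lambda>x. \<Theta> x $ i)) x * ?w x)"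
      using wi C_c_measurable[OF p]
      by (intro integrable_mult_bounded[of _ ?w "partial i (conv (moll e) (\<lambda>x. \<Theta> x $ i))" B]) auto
    moreover have "partial i (conv (moll e) (\<lambda>x. \<Theta> x $ i)) x * ?w x = w x * partial i (conv (moll e) (\<lambda>x. \<Theta> x $ i)) x" for x
      using C_c_cont(3)[OF p, of x] K(1) by (cases "x \<in> \<Omega>") auto
    ultimately show ?thesis by simp
  qed
  show ?thesis
    unfolding pairing_def diverg_def one using int by (simp add: sum_distrib_left sum_negf)
qed

section \<open>Mollified competitors for an integrand of the class\<close>

locale anisotropy =
  fixes \<Omega> :: "(real^'n::finite) set" and \<psi> :: "real^'n \<Rightarrow> real^'n \<Rightarrow> real" and l L :: real
  assumes open_dom: "open \<Omega>" and bounded_dom: "bounded \<Omega>" and l_pos: "0 < l" and psi: "\<psi> \<in> class_G l L"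
begin

abbreviation "V \<equiv> aniso_var \<Omega> \<psi>"

lemma psi_nonneg: "0 \<le> \<psi> x \<xi>" using psi by (auto simp: class_G_def)
lemma psi_cont: "continuous_on UNIV (\<lambda>(x, \<xi>). \<psi> x \<xi>)" using psi by (auto simp: class_G_def)
lemma psi_scaleR: "0 < t \<Longrightarrow> \<psi> x (t *\<^sub>R \<xi>) = t * \<psi> x \<xi>" using psi by (auto simp: class_G_def)
lemma psi_lower: "l * norm \<xi> \<le> \<psi> x \<xi>" using psi by (auto simp: class_G_def)
lemma psi_upper: "\<psi> x \<xi> \<le> L * norm \<xi>" using psi by (auto simp: class_G_def)
lemma psi_0 [simp]: "\<psi> x 0 = 0" using psi_lower[of 0 x] psi_upper[of x 0] by simp

lemma psi_scaleR_nonneg: "0 \<le> t \<Longrightarrow> \<psi> x (t *\<^sub>R \<xi>) = t * \<psi> x \<xi>"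
  using psi_scaleR[of t] by (cases "t = 0") auto

text \<open>Uniform continuity on a ball times the unit sphere gives an additive error, which
  \<open>l * norm \<xi> \<le> \<psi> x \<xi>\<close> converts into a relative one. Homogeneity
  extends the estimate from unit vectors to all \<xi>. The radius \<open>R + 1\<close> leaves room
  for y outside \<Omega>.\<close>

lemma psi_uniform:
  assumes \<delta>: "\<delta> > 0"
  obtains e0 where "e0 > 0" "\<And>x y \<xi>. x \<in> \<Omega> \<Longrightarrow> dist x y < e0 \<Longrightarrow> \<psi> y \<xi> \<le> (1 + \<delta>) * \<psi> x \<xi>"
proof -
  obtain R where R: "\<Omega> \<subseteq> cball 0 R" using bounded_dom by (auto simp: bounded_iff subset_iff)
  have "uniformly_continuous_on (cball 0 (R + 1) \<times> sphere 0 1) (\<lambda>(x, \<xi>). \<psi> x \<xi>)"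
    using psi_cont by (intro compact_uniformly_continuous compact_Times) (auto intro: continuous_on_subset)
  then obtain d where d: "d > 0" "\<And>p q. p \<in> cball 0 (R + 1) \<times> sphere 0 1 \<Longrightarrow> q \<in> cball 0 (R + 1) \<times> sphere 0 1 \<Longrightarrow>
      dist q p < d \<Longrightarrow> dist (case q of (x, \<xi>) \<Rightarrow> \<psi> x \<xi>) (case p of (x, \<xi>) \<Rightarrow> \<psi> x \<xi>) < \<delta> * l"
    unfolding uniformly_continuous_on_def using mult_pos_pos[OF \<delta> l_pos] by metis
  show ?thesis
  proof (rule that[of "min d 1"])
    show "min d 1 > 0" using d by simp
    fix x y \<xi> :: "real^'n" assume x: "x \<in> \<Omega>" and xy: "dist x y < min d 1"
    show "\<psi> y \<xi> \<le> (1 + \<delta>) * \<psi> x \<xi>"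
    proof (cases "\<xi> = 0")
      case False
      define u where "u = \<xi> /\<^sub>R norm \<xi>"
      have u: "norm u = 1" "\<xi> = norm \<xi> *\<^sub>R u" using False by (auto simp: u_def)
      have nx: "norm x \<le> R" using x R by auto
      have "norm y \<le> norm x + norm (x - y)" by (metis norm_triangle_sub norm_minus_commute)
      then have ny: "norm y \<le> R + 1" using nx xy by (simp add: dist_norm)
      have "dist (\<psi> y u) (\<psi> x u) < \<delta> * l"
        using d(2)[of "(x, u)" "(y, u)"] nx ny u xy by (simp add: dist_Pair_Pair dist_commute)
      then have "\<psi> y u \<le> \<psi> x u + \<delta> * l" by (simp add: dist_real_def)
      also have "\<delta> * l \<le> \<delta> * \<psi> x u" using psi_lower[of u x] u \<delta> by (intro mult_left_mono) auto
      finally have "\<psi> y u \<le> (1 + \<delta>) * \<psi> x u" by (simp add: algebra_simps)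
      then have "norm \<xi> * \<psi> y u \<le> norm \<xi> * ((1 + \<delta>) * \<psi> x u)" by (intro mult_left_mono) auto
      moreover have "\<psi> z \<xi> = norm \<xi> * \<psi> z u" for z using u(2) psi_scaleR_nonneg[of "norm \<xi>" z u] by simp
      ultimately show ?thesis by (simp add: mult.left_commute)
    qed simp
  qed
qed

lemma finite_emeasure_dom: "emeasure lborel \<Omega> < \<infinity>"
  using bounded_dom emeasure_bounded_finite by blast

lemma dom_borel [measurable]: "\<Omega> \<in> sets borel" using open_dom by simp

lemma integrable_indicator_dom: "integrable lborel (indicat_real \<Omega>)"
  using finite_emeasure_dom by simp

lemma L1_on_bound:
  assumes "w \<in> borel_measurable borel" "\<And>x. x \<in> \<Omega> \<Longrightarrow> \<bar>w x\<bar> \<le> a + \<bar>v x\<bar>" "L1_on \<Omega> v"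
  shows "L1_on \<Omega> w"
  unfolding L1_on_def
proof
  show "integrable lborel (\<lambda>x. indicator \<Omega> x * w x)"
  proof (rule Bochner_Integration.integrable_bound[of _ "\<lambda>x. \<bar>a\<bar> * indicator \<Omega> x + \<bar>indicator \<Omega> x * v x\<bar>"])
    show "integrable lborel (\<lambda>x. \<bar>a\<bar> * indicat_real \<Omega> x + \<bar>indicat_real \<Omega> x * v x\<bar>)"
      using assms(3) integrable_indicator_dom by (auto simp: L1_on_def)
    show "AE x in lborel. norm (indicator \<Omega> x * w x) \<le> norm (\<bar>a\<bar> * indicat_real \<Omega> x + \<bar>indicat_real \<Omega> x * v x\<bar>)"
    proof (intro AE_I2)
      fix x show "norm (indicator \<Omega> x * w x) \<le> norm (\<bar>a\<bar> * indicat_real \<Omega> x + \<bar>indicat_real \<Omega> x * v x\<bar>)"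
        using assms(2)[of x] by (cases "x \<in> \<Omega>") auto
    qed
  qed (use assms(1) in measurable)
qed fact

lemma L1_on_const [simp]: "L1_on \<Omega> (\<lambda>_. c)"
  using integrable_indicator_dom by (auto simp: L1_on_def)

lemma admissible_test_fun: "admissible \<Omega> \<psi> \<phi> \<Longrightarrow> \<forall>i. test_fun \<Omega> (\<lambda>x. \<phi> x $ i)"
  by (simp add: admissible_def)

text \<open>For fixed \<xi> the constraint is linear in the field, so averaging over the ball of
  radius e preserves it; c accounts for the comparison of \<psi> at neighbouring points. For x
  outside \<Omega> this ball misses K, and the mollified field is 0.\<close>

lemma admissible_conv_moll:
  fixes \<Theta> :: "real^'n \<Rightarrow> real^'n"
  assumes e: "e > 0" and K: "compact K" "\<And>x. x \<in> K \<Longrightarrow> cball x e \<subseteq> \<Omega>" and c: "c > 0"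
    and \<Theta>: "\<And>i. integrable lborel (\<lambda>x. \<Theta> x $ i)" "\<And>x. x \<notin> K \<Longrightarrow> \<Theta> x = 0"
    and le: "\<And>x y \<xi>. x \<in> \<Omega> \<Longrightarrow> dist x y < e \<Longrightarrow> \<Theta> y \<bullet> \<xi> \<le> c * \<psi> x \<xi>"
  shows "admissible \<Omega> \<psi> (\<lambda>x. inverse c *\<^sub>R (\<chi> i. conv (moll e) (\<lambda>x. \<Theta> x $ i) x))"
  unfolding admissible_def
proof (intro conjI allI)
  fix i
  have tf: "test_fun \<Omega> (conv (moll e) (\<lambda>x. inverse c * \<Theta> x $ i))"
    by (rule test_fun_conv_moll[OF e K]) (use \<Theta> in auto)
  have "conv (moll e) (\<lambda>x. inverse c * \<Theta> x $ i) = (\<lambda>x. inverse c * conv (moll e) (\<lambda>x. \<Theta> x $ i) x)"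
    unfolding conv_def by (rule ext, subst integral_mult_right_zero[symmetric]) (simp add: mult.left_commute)
  with tf show "test_fun \<Omega> (\<lambda>x. (inverse c *\<^sub>R (\<chi> i. conv (moll e) (\<lambda>x. \<Theta> x $ i) x)) $ i)"
    by simp
next
  fix x \<xi>
  have "(\<chi> i. conv (moll e) (\<lambda>x. \<Theta> x $ i) x) \<bullet> \<xi> = conv (moll e) (\<lambda>x. \<Theta> x \<bullet> \<xi>) x"
    unfolding inner_vec_def conv_def sum_distrib_left
    using conv_integrand_integrable[OF C_c_moll[OF e] \<Theta>(1)]
    by (subst Bochner_Integration.integral_sum) (auto simp: mult.assoc[symmetric])
  moreover have "conv (moll e) (\<lambda>x. \<Theta> x \<bullet> \<xi>) x \<le> c * \<psi> x \<xi>"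
  proof (cases "x \<in> \<Omega>")
    case True
    have "integrable lborel (\<lambda>x. \<Theta> x \<bullet> \<xi>)" unfolding inner_vec_def using \<Theta>(1) by auto
    then show ?thesis using le[OF True] by (intro conv_moll_le[OF e]) auto
  next
    case False
    have "\<Theta> y \<bullet> \<xi> = 0" if "dist x y < e" for y
    proof -
      have "x \<in> cball y e" using that by (simp add: dist_commute)
      then have "y \<notin> K" using K(2)[of y] False by blast
      then show ?thesis using \<Theta>(2) by simp
    qed
    then have "conv (moll e) (\<lambda>x. \<Theta> x \<bullet> \<xi>) x = 0" by (rule conv_moll_eq_0[OF e])
    then show ?thesis using psi_nonneg[of x \<xi>] c by simp
  qed
  ultimately show "inverse c *\<^sub>R (\<chi> i. conv (moll e) (\<lambda>x. \<Theta> x $ i) x) \<bullet> \<xi> \<le> \<psi> x \<xi>"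
    using c by (simp add: field_simps)
qed

lemma pairing_scaleR_field:
  assumes "\<forall>i. test_fun \<Omega> (\<lambda>x. \<phi> x $ i)"
  shows "pairing w (\<lambda>x. c *\<^sub>R \<phi> x) = c * pairing w \<phi>"
proof -
  have "(\<lambda>x. \<phi> x $ i) differentiable (at x)" for i x
    using assms test_fun_C_k[of \<Omega> "\<lambda>x. \<phi> x $ i" "Suc 0"] by simp
  then have "diverg (\<lambda>x. c *\<^sub>R \<phi> x) x = c * diverg \<phi> x" for x
    by (simp add: diverg_def partial_cmult sum_distrib_left)
  then show ?thesis by (simp add: pairing_def mult.left_commute)
qed

lemma pairing_conv_moll_le:
  fixes \<Theta> :: "real^'n \<Rightarrow> real^'n"
  assumes e: "e > 0" and K: "compact K" "\<And>x. x \<in> K \<Longrightarrow> cball x e \<subseteq> \<Omega>" and c: "c > 0"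
    and \<Theta>: "\<And>i. integrable lborel (\<lambda>x. \<Theta> x $ i)" "\<And>x. x \<notin> K \<Longrightarrow> \<Theta> x = 0"
    and le: "\<And>x y \<xi>. x \<in> \<Omega> \<Longrightarrow> dist x y < e \<Longrightarrow> \<Theta> y \<bullet> \<xi> \<le> c * \<psi> x \<xi>"
    and M: "0 \<le> M" "V w \<le> ennreal M"
  shows "pairing w (\<lambda>x. \<chi> i. conv (moll e) (\<lambda>x. \<Theta> x $ i) x) \<le> c * M"
proof -
  note adm = admissible_conv_moll[OF e K c \<Theta> le]
  have tf: "\<forall>i. test_fun \<Omega> (\<lambda>x. (\<chi> i. conv (moll e) (\<lambda>x. \<Theta> x $ i) x) $ i)"
    using test_fun_conv_moll[OF e K \<Theta>(1)] \<Theta>(2) by simp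
  have "ennreal (pairing w (\<lambda>x. inverse c *\<^sub>R (\<chi> i. conv (moll e) (\<lambda>x. \<Theta> x $ i) x))) \<le> ennreal M"
    using pairing_le_aniso_var[OF adm, of w] M(2) by (rule order_trans)
  then have "pairing w (\<lambda>x. inverse c *\<^sub>R (\<chi> i. conv (moll e) (\<lambda>x. \<Theta> x $ i) x)) \<le> M"
    using M(1) by (simp add: ennreal_le_iff)
  then show ?thesis using c unfolding pairing_scaleR_field[OF tf] by (simp add: field_simps)
qed

text \<open>Mollify w to \<open>w\<^sub>e\<close> and test with \<open>d1 w\<^sub>e \<phi>1 + d2 w\<^sub>e \<phi>2\<close>; integration by
  parts moves \<open>d1\<close>, \<open>d2\<close> onto \<open>w\<^sub>e\<close> and produces \<open>\<eta>1 w\<^sub>e\<close>, \<open>\<eta>2 w\<^sub>e\<close>.\<close>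

lemma pairing_split_smooth:
  assumes \<eta>1: "\<And>s. DERIV \<eta>1 s :> d1 s" "continuous_on UNIV d1" "\<And>s. 0 \<le> d1 s"
    and \<eta>2: "\<And>s. DERIV \<eta>2 s :> d2 s" "continuous_on UNIV d2" "\<And>s. 0 \<le> d2 s"
    and d: "\<And>s. d1 s + d2 s \<le> 1"
    and w: "L1_on \<Omega> w" and M: "0 \<le> M" "V w \<le> ennreal M"
    and \<phi>1: "admissible \<Omega> \<psi> \<phi>1" and \<phi>2: "admissible \<Omega> \<psi> \<phi>2"
  shows "pairing (\<lambda>x. \<eta>1 (w x)) \<phi>1 + pairing (\<lambda>x. \<eta>2 (w x)) \<phi>2 \<le> M"
proof (rule field_le_epsilon)
  fix \<tau> :: real assume \<tau>: "\<tau> > 0"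
  let ?w = "\<lambda>x. indicator \<Omega> x * w x"
  have wi: "integrable lborel ?w" using w by (simp add: L1_on_def)
  note tf1 = admissible_test_fun[OF \<phi>1] and tf2 = admissible_test_fun[OF \<phi>2]
  have "\<exists>K. K \<subseteq> \<Omega> \<and> (\<forall>k. C_c k K (\<lambda>x. \<phi>1 x $ i))" for i using test_fun_C_c[OF tf1[rule_format, of i]] by metis
  then obtain K1 where K1: "\<And>i. K1 i \<subseteq> \<Omega>" "\<And>i k. C_c k (K1 i) (\<lambda>x. \<phi>1 x $ i)" by metis
  have "\<exists>K. K \<subseteq> \<Omega> \<and> (\<forall>k. C_c k K (\<lambda>x. \<phi>2 x $ i))" for i using test_fun_C_c[OF tf2[rule_format, of i]] by metis
  then obtain K2 where K2: "\<And>i. K2 i \<subseteq> \<Omega>" "\<And>i k. C_c k (K2 i) (\<lambda>x. \<phi>2 x $ i)" by metis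
  define K where "K = (\<Union>i. K1 i) \<union> (\<Union>i. K2 i)"
  have "compact (K1 i)" "compact (K2 i)" for i using C_c_cont(2)[OF K1(2)] C_c_cont(2)[OF K2(2)] by auto
  then have K: "compact K" unfolding K_def by (intro compact_Un compact_UN) auto
  have K\<Omega>: "K \<subseteq> \<Omega>" unfolding K_def using K1(1) K2(1) by blast
  have z: "\<phi>1 x = 0" "\<phi>2 x = 0" if "x \<notin> K" for x
  proof -
    have "x \<notin> K1 i" "x \<notin> K2 i" for i using that by (auto simp: K_def)
    then have "\<phi>1 x $ i = 0" "\<phi>2 x $ i = 0" for i
      using C_c_cont(3)[OF K1(2)[of 0 i], of x] C_c_cont(3)[OF K2(2)[of 0 i], of x] by simp_all
    then show "\<phi>1 x = 0" "\<phi>2 x = 0" by (simp_all add: vec_eq_iff)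
  qed
  obtain dm where dm: "dm > 0" "\<And>x. x \<in> K \<Longrightarrow> cball x dm \<subseteq> \<Omega>" using compact_margin[OF K K\<Omega> open_dom] by blast
  obtain B1 where B1: "B1 > 0" "\<And>x. \<bar>diverg \<phi>1 x\<bar> \<le> B1" using diverg_bounded[OF tf1] by blast
  obtain B2 where B2: "B2 > 0" "\<And>x. \<bar>diverg \<phi>2 x\<bar> \<le> B2" using diverg_bounded[OF tf2] by blast
  \<comment> \<open>The error \<tau> is split in two. The oscillation of \<psi> costs
    \<open>\<delta> * M\<close>, at most \<open>\<tau> / 2\<close>, and the passage from w to its
    mollification costs \<open>(B1 + B2) * \<eta>\<close>, which is
    \<open>\<tau> / 2\<close>.\<close>
  define \<delta> where "\<delta> = \<tau> / (2 * (M + 1))"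
  have \<delta>: "\<delta> > 0" using \<tau> M by (simp add: \<delta>_def)
  obtain e1 where e1: "e1 > 0" "\<And>x y \<xi>. x \<in> \<Omega> \<Longrightarrow> dist x y < e1 \<Longrightarrow> \<psi> y \<xi> \<le> (1 + \<delta>) * \<psi> x \<xi>"
    using psi_uniform[OF \<delta>] by blast
  define \<eta> where "\<eta> = \<tau> / (2 * (B1 + B2))"
  have \<eta>: "\<eta> > 0" using \<tau> B1 B2 by (simp add: \<eta>_def)
  obtain e2 where e2: "e2 > 0" "\<And>e. 0 < e \<Longrightarrow> e < e2 \<Longrightarrow> (LINT x|lborel. \<bar>conv (moll e) ?w x - ?w x\<bar>) < \<eta>"
    using conv_moll_L1[OF wi \<eta>] by blast
  define e where "e = min dm (min e1 e2) / 2"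
  have e: "e > 0" "e < e1" "e < e2" "e \<le> dm" using dm e1 e2 by (auto simp: e_def)
  have Km: "cball x e \<subseteq> \<Omega>" if "x \<in> K" for x using dm(2)[OF that] e(4) by (meson order_trans subset_cball)
  define W where "W = conv (moll e) ?w"
  have CW: "C_k k W" for k unfolding W_def by (rule C_k_conv[OF C_c_moll[OF e(1)] wi])
  have dW: "W differentiable (at x)" for x using CW[of "Suc 0"] by simp
  have Wm: "W \<in> borel_measurable borel" using borel_measurable_C_k[OF CW[of 0]] .
  have Wi: "integrable lborel W" unfolding W_def by (rule integrable_conv[OF C_c_moll[OF e(1)] wi])
  have LW: "L1_on \<Omega> W"
    using Wi Wm integrable_real_mult_indicator[of \<Omega> lborel W] by (simp add: L1_on_def mult.commute)
  have lip: "\<bar>\<eta>0 a - \<eta>0 b\<bar> \<le> \<bar>a - b\<bar>" if "\<And>s. DERIV \<eta>0 s :> d0 s" "\<And>s. 0 \<le> d0 s" "\<And>s. d0 s \<le> 1" for \<eta>0 d0 :: "real \<Rightarrow> real" and a b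
  proof -
    have "norm (\<eta>0 a - \<eta>0 b) \<le> 1 * norm (a - b)"
      by (rule field_differentiable_bound[of UNIV \<eta>0 d0]) (use that in \<open>auto simp: abs_of_nonneg\<close>)
    then show ?thesis by simp
  qed
  \<comment> \<open>The outer functions are 1-Lipschitz, so the distance in the mean from w to W,
    times the bound on the divergence, controls the change of the pairing.\<close>
  have step: "pairing (\<lambda>x. \<eta>0 (w x)) \<phi> \<le> pairing (\<lambda>x. \<eta>0 (W x)) \<phi> + B * \<eta>"
    if "\<And>s. DERIV \<eta>0 s :> d0 s" "\<And>s. 0 \<le> d0 s" "\<And>s. d0 s \<le> 1" "\<forall>i. test_fun \<Omega> (\<lambda>x. \<phi> x $ i)" "B > 0" "\<And>x. \<bar>diverg \<phi> x\<bar> \<le> B"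
    for \<eta>0 d0 :: "real \<Rightarrow> real" and \<phi> B
  proof -
    note lp = lip[of \<eta>0 d0, OF that(1-3)]
    have [measurable]: "\<eta>0 \<in> borel_measurable borel"
      using that(1) DERIV_isCont by (intro borel_measurable_continuous_onI continuous_at_imp_continuous_on) blast
    have b: "\<bar>\<eta>0 s\<bar> \<le> \<bar>\<eta>0 0\<bar> + \<bar>s\<bar>" for s using lp[of s 0] by linarith
    have 1: "L1_on \<Omega> (\<lambda>x. \<eta>0 (w x))" using w b by (intro L1_on_bound[OF _ _ w]) (auto simp: L1_on_def)
    have 2: "L1_on \<Omega> (\<lambda>x. \<eta>0 (W x))" using Wm b by (intro L1_on_bound[OF _ _ LW]) auto
    have "\<bar>pairing (\<lambda>x. \<eta>0 (w x)) \<phi> - pairing (\<lambda>x. \<eta>0 (W x)) \<phi>\<bar>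
       \<le> B * (LINT x|lborel. \<bar>indicator \<Omega> x * (\<eta>0 (w x) - \<eta>0 (W x))\<bar>)"
      by (rule pairing_dist_le[OF 1 2 that(4) that(6)])
    also have "\<dots> \<le> B * (LINT x|lborel. \<bar>W x - ?w x\<bar>)"
    proof (intro mult_left_mono integral_mono')
      show "integrable lborel (\<lambda>x. \<bar>W x - ?w x\<bar>)" using Wi wi by simp
      show "\<bar>indicator \<Omega> x * (\<eta>0 (w x) - \<eta>0 (W x))\<bar> \<le> \<bar>W x - ?w x\<bar>" for x
        using lp[of "w x" "W x"] by (cases "x \<in> \<Omega>") auto
    qed (use that in auto)
    also have "\<dots> \<le> B * \<eta>" using e2(2)[OF e(1) e(3)] that(5) unfolding W_def by (intro mult_left_mono) auto
    finally show ?thesis by linarith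
  qed
  have ibp: "pairing (\<lambda>x. \<eta>0 (W x)) \<phi> = (\<Sum>i\<in>UNIV. LINT x|lborel. partial i W x * (d0 (W x) * \<phi> x $ i))"
    and ibp_int: "integrable lborel (\<lambda>x. partial i W x * (d0 (W x) * \<phi> x $ i))"
    if "\<And>s. DERIV \<eta>0 s :> d0 s" "continuous_on UNIV d0" "\<And>i k. C_c k (KK i) (\<lambda>x. \<phi> x $ i)"
    for \<eta>0 d0 :: "real \<Rightarrow> real" and \<phi> and KK :: "'n \<Rightarrow> (real^'n) set" and i
  proof -
    have pc: "partial i (\<lambda>x. \<eta>0 (W x)) = (\<lambda>x. d0 (W x) * partial i W x)" for i
      using partial_chain[OF that(1) dW] by blast
    have cW: "continuous_on UNIV W" using CW[of 0] by simp
    have c1: "C_k (Suc 0) (\<lambda>x. \<eta>0 (W x))"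
    proof -
      have "(\<lambda>x. \<eta>0 (W x)) differentiable (at x)" for x
        using has_derivative_compose[OF has_derivative_partial[OF dW] that(1)[unfolded has_field_derivative_def]]
        unfolding differentiable_def by blast
      moreover have "continuous_on UNIV (\<lambda>x. d0 (W x) * partial i W x)" for i
        using CW[of "Suc 0"] cW that(2) by (auto intro!: continuous_intros intro: continuous_on_compose2)
      ultimately show ?thesis by (simp add: pc)
    qed
    have "C_c 0 (KK i) (\<lambda>x. \<eta>0 (W x) * partial i (\<lambda>x. \<phi> x $ i) x)" for i
      using C_c_partial[OF that(3)[where k="Suc 0"], of i] C_k_continuous[OF c1] by (auto simp: C_c_def intro!: continuous_intros)
    from this[THEN C_c_integrable]
    have "pairing (\<lambda>x. \<eta>0 (W x)) \<phi> = (\<Sum>i\<in>UNIV. - (LINT x|lborel. \<eta>0 (W x) * partial i (\<lambda>x. \<phi> x $ i) x))"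
      by (simp add: pairing_def diverg_def sum_distrib_left sum_negf)
    also have "\<dots> = (\<Sum>i\<in>UNIV. LINT x|lborel. partial i (\<lambda>x. \<eta>0 (W x)) x * \<phi> x $ i)"
      using integration_by_parts[OF c1 that(3)] by simp
    finally show "pairing (\<lambda>x. \<eta>0 (W x)) \<phi> = (\<Sum>i\<in>UNIV. LINT x|lborel. partial i W x * (d0 (W x) * \<phi> x $ i))"
      by (simp add: pc mult_ac)
    have "C_c 0 (KK i) (\<lambda>x. partial i W x * (d0 (W x) * \<phi> x $ i))"
      using that(3)[of 0 i] CW[of "Suc 0"] cW that(2)
      by (auto simp: C_c_def intro!: continuous_intros intro: continuous_on_compose2)
    then show "integrable lborel (\<lambda>x. partial i W x * (d0 (W x) * \<phi> x $ i))" by (rule C_c_integrable)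
  qed
  \<comment> \<open>Since \<open>d1 + d2 \<le> 1\<close>, this is pointwise a convex combination of
    \<open>\<phi>1\<close>, \<open>\<phi>2\<close> and 0. It is merely continuous, because
    \<open>d1\<close> and \<open>d2\<close> are, and becomes a test field only after a mollification
    of its own.\<close>
  define \<Theta> where "\<Theta> x = d1 (W x) *\<^sub>R \<phi>1 x + d2 (W x) *\<^sub>R \<phi>2 x" for x
  have cW: "continuous_on UNIV W" using CW[of 0] by simp
  have \<Theta>C: "C_c 0 K (\<lambda>x. \<Theta> x $ i)" for i
  proof -
    have "continuous_on UNIV (\<lambda>x. d1 (W x) * \<phi>1 x $ i + d2 (W x) * \<phi>2 x $ i)"
      by (intro continuous_on_add continuous_on_mult continuous_on_compose2[OF \<eta>1(2) cW]
          continuous_on_compose2[OF \<eta>2(2) cW] C_c_cont(1)[OF K1(2)] C_c_cont(1)[OF K2(2)]) auto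
    then show ?thesis using z K by (simp add: C_c_def \<Theta>_def)
  qed
  have \<Theta>0: "\<Theta> x = 0" if "x \<notin> K" for x using z[OF that] by (simp add: \<Theta>_def)
  have \<Theta>i: "integrable lborel (\<lambda>x. \<Theta> x $ i)" for i by (rule C_c_integrable[OF \<Theta>C])
  have "\<exists>B. \<forall>x. \<bar>\<Theta> x $ i\<bar> \<le> B" for i using C_c_bounded[OF \<Theta>C] by blast
  then obtain Bi where Bi: "\<And>i x. \<bar>\<Theta> x $ i\<bar> \<le> Bi i" by metis
  have \<Theta>b: "\<bar>\<Theta> x $ i\<bar> \<le> (\<Sum>i\<in>UNIV. \<bar>Bi i\<bar>)" for i x
    using member_le_sum[of i UNIV "\<lambda>i. \<bar>Bi i\<bar>"] Bi[of x i] by simp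
  have \<Theta>psi: "\<Theta> y \<bullet> \<xi> \<le> \<psi> y \<xi>" for y \<xi>
  proof -
    have "\<Theta> y \<bullet> \<xi> = d1 (W y) * (\<phi>1 y \<bullet> \<xi>) + d2 (W y) * (\<phi>2 y \<bullet> \<xi>)" by (simp add: \<Theta>_def inner_add_left)
    also have "\<dots> \<le> d1 (W y) * \<psi> y \<xi> + d2 (W y) * \<psi> y \<xi>"
      using \<phi>1 \<phi>2 \<eta>1(3) \<eta>2(3) by (intro add_mono mult_left_mono) (auto simp: admissible_def)
    also have "\<dots> \<le> 1 * \<psi> y \<xi>" using d[of "W y"] psi_nonneg[of y \<xi>] by (simp only: distrib_right[symmetric]) (intro mult_right_mono)
    finally show ?thesis by simp
  qed
  have le: "\<Theta> y \<bullet> \<xi> \<le> (1 + \<delta>) * \<psi> x \<xi>" if "x \<in> \<Omega>" "dist x y < e" for x y \<xi>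
    using \<Theta>psi[of y \<xi>] e1(2)[OF that(1), of y \<xi>] that(2) e(2) by linarith
  have "pairing (\<lambda>x. \<eta>1 (W x)) \<phi>1 + pairing (\<lambda>x. \<eta>2 (W x)) \<phi>2 = (\<Sum>i\<in>UNIV. LINT x|lborel. partial i W x * \<Theta> x $ i)"
    unfolding ibp[OF \<eta>1(1,2) K1(2)] ibp[OF \<eta>2(1,2) K2(2)] sum.distrib[symmetric]
    using ibp_int[OF \<eta>1(1,2) K1(2)] ibp_int[OF \<eta>2(1,2) K2(2)]
    by (intro sum.cong refl) (subst Bochner_Integration.integral_add[symmetric], auto simp: \<Theta>_def distrib_left)
  also have "\<dots> = pairing w (\<lambda>x. \<chi> i. conv (moll e) (\<lambda>x. \<Theta> x $ i) x)"
    unfolding W_def using test_fun_conv_moll[OF e(1) K Km \<Theta>i] \<Theta>0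
    by (intro pairing_conv_moll[OF e(1) w \<Theta>i \<Theta>b, symmetric]) auto
  also have "\<dots> \<le> (1 + \<delta>) * M"
    by (rule pairing_conv_moll_le[OF e(1) K Km _ \<Theta>i \<Theta>0 le M]) (use \<delta> in auto)
  finally have main: "pairing (\<lambda>x. \<eta>1 (W x)) \<phi>1 + pairing (\<lambda>x. \<eta>2 (W x)) \<phi>2 \<le> (1 + \<delta>) * M" .
  have "d1 s \<le> 1" "d2 s \<le> 1" for s using d[of s] \<eta>1(3)[of s] \<eta>2(3)[of s] by linarith+
  then have "pairing (\<lambda>x. \<eta>1 (w x)) \<phi>1 + pairing (\<lambda>x. \<eta>2 (w x)) \<phi>2 \<le> (1 + \<delta>) * M + (B1 + B2) * \<eta>"
    using step[OF \<eta>1(1,3) _ tf1 B1] step[OF \<eta>2(1,3) _ tf2 B2] main by (fastforce simp: algebra_simps)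
  also have "(B1 + B2) * \<eta> = \<tau> / 2"
  proof -
    define B where "B = B1 + B2"
    have "B \<noteq> 0" using B1(1) B2(1) by (simp add: B_def)
    then show ?thesis unfolding \<eta>_def B_def[symmetric] by simp
  qed
  also have "(1 + \<delta>) * M \<le> M + \<tau> / 2"
  proof -
    have "\<delta> * M = \<tau> / 2 * (M / (M + 1))" by (simp add: \<delta>_def)
    also have "\<dots> \<le> \<tau> / 2 * 1" using \<tau> M by (intro mult_left_mono) auto
    finally show ?thesis by (simp add: algebra_simps)
  qed
  finally show "pairing (\<lambda>x. \<eta>1 (w x)) \<phi>1 + pairing (\<lambda>x. \<eta>2 (w x)) \<phi>2 \<le> M + \<tau>" by simp
qed

end


section \<open>Selection of level sets\<close>

context anisotropy begin

text \<open>The upper branch of the hyperbola \<open>y * (y - s) = \<kappa>\<^sup>2 / 4\<close>,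
  whose asymptotes form the graph of \<open>max s 0\<close>.\<close>

definition smooth_pos :: "real \<Rightarrow> real \<Rightarrow> real" where
  "smooth_pos \<kappa> s = (s + sqrt (s\<^sup>2 + \<kappa>\<^sup>2)) / 2"

lemma DERIV_smooth_pos:
  assumes "\<kappa> > 0"
  shows "DERIV (smooth_pos \<kappa>) s :> (1 + s / sqrt (s\<^sup>2 + \<kappa>\<^sup>2)) / 2"
proof -
  have "s\<^sup>2 + \<kappa>\<^sup>2 > 0" using assms by (simp add: add_nonneg_pos)
  then show ?thesis unfolding smooth_pos_def[abs_def]
    by (auto intro!: derivative_eq_intros simp: field_simps)
qed

lemma smooth_pos_deriv_bounds:
  assumes "\<kappa> > 0"
  shows "0 \<le> (1 + s / sqrt (s\<^sup>2 + \<kappa>\<^sup>2)) / 2" "(1 + s / sqrt (s\<^sup>2 + \<kappa>\<^sup>2)) / 2 \<le> 1"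
proof -
  have p: "sqrt (s\<^sup>2 + \<kappa>\<^sup>2) > 0" using assms by (simp add: add_nonneg_pos)
  have "\<bar>s\<bar> \<le> sqrt (s\<^sup>2 + \<kappa>\<^sup>2)" by (rule real_sqrt_ge_abs1)
  then have "- sqrt (s\<^sup>2 + \<kappa>\<^sup>2) \<le> s" "s \<le> sqrt (s\<^sup>2 + \<kappa>\<^sup>2)" by linarith+
  then have "-1 \<le> s / sqrt (s\<^sup>2 + \<kappa>\<^sup>2)" "s / sqrt (s\<^sup>2 + \<kappa>\<^sup>2) \<le> 1"
    using p by (simp_all add: pos_le_divide_eq pos_divide_le_eq)
  then show "0 \<le> (1 + s / sqrt (s\<^sup>2 + \<kappa>\<^sup>2)) / 2" "(1 + s / sqrt (s\<^sup>2 + \<kappa>\<^sup>2)) / 2 \<le> 1" by simp_all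
qed

lemma smooth_pos_close:
  assumes "\<kappa> > 0" shows "\<bar>smooth_pos \<kappa> s - max s 0\<bar> \<le> \<kappa>"
proof -
  have "\<bar>s\<bar> \<le> sqrt (s\<^sup>2 + \<kappa>\<^sup>2)" by (rule real_sqrt_ge_abs1)
  moreover have "sqrt (s\<^sup>2 + \<kappa>\<^sup>2) \<le> \<bar>s\<bar> + \<bar>\<kappa>\<bar>" by (rule sqrt_sum_squares_le_sum_abs)
  moreover define R where "R = sqrt (s\<^sup>2 + \<kappa>\<^sup>2)"
  ultimately have R: "\<bar>s\<bar> \<le> R" "R \<le> \<bar>s\<bar> + \<bar>\<kappa>\<bar>" by simp_all
  show ?thesis unfolding smooth_pos_def R_def[symmetric]
    using R assms by (cases "s \<ge> 0") (simp_all add: max_def abs_le_iff field_simps)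
qed

lemma L1_on_min: "L1_on \<Omega> w \<Longrightarrow> L1_on \<Omega> (\<lambda>x. min (w x) t)"
  by (rule L1_on_bound[where v=w and a="\<bar>t\<bar>"]) (auto simp: L1_on_def min_def)

lemma L1_on_max: "L1_on \<Omega> w \<Longrightarrow> L1_on \<Omega> (\<lambda>x. max (w x - t) 0)"
  by (rule L1_on_bound[where v=w and a="\<bar>t\<bar>"]) (auto simp: L1_on_def max_def)

lemma pairing_uniform_dist:
  assumes "L1_on \<Omega> v" "L1_on \<Omega> w" "\<forall>i. test_fun \<Omega> (\<lambda>x. \<phi> x $ i)" "\<And>x. \<bar>diverg \<phi> x\<bar> \<le> B"
    and k: "\<And>x. \<bar>v x - w x\<bar> \<le> \<kappa>"
  shows "\<bar>pairing v \<phi> - pairing w \<phi>\<bar> \<le> B * (\<kappa> * measure lborel \<Omega>)"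
proof -
  have \<kappa>: "\<kappa> \<ge> 0" using k[of undefined] by linarith
  have B: "B \<ge> 0" using assms(4)[of undefined] by linarith
  have "(LINT x|lborel. \<bar>indicator \<Omega> x * (v x - w x)\<bar>) \<le> (LINT x|lborel. \<kappa> * indicator \<Omega> x)"
  proof (rule integral_mono')
    show "integrable lborel (\<lambda>x. \<kappa> * indicat_real \<Omega> x)" using integrable_indicator_dom by auto
    show "\<bar>indicator \<Omega> x * (v x - w x)\<bar> \<le> \<kappa> * indicator \<Omega> x" for x using k[of x] by (simp add: indicator_def)
  qed (use \<kappa> in auto)
  also have "\<dots> = \<kappa> * measure lborel \<Omega>" by simp
  finally show ?thesis using pairing_dist_le[OF assms(1-4)] B by (meson mult_left_mono order_trans)
qed

text \<open>\<open>min s t\<close> is \<open>s - max (s - t) 0\<close> and is approximated by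
  \<open>s - \<eta> s\<close> with the same \<eta> as the other part, so that the two derivatives
  add up to exactly 1. Uniform closeness on a set of finite measure controls both pairings.\<close>

lemma pairing_split:
  assumes w: "L1_on \<Omega> w" and M: "0 \<le> M" "V w \<le> ennreal M"
    and \<phi>1: "admissible \<Omega> \<psi> \<phi>1" and \<phi>2: "admissible \<Omega> \<psi> \<phi>2"
  shows "pairing (\<lambda>x. min (w x) t) \<phi>1 + pairing (\<lambda>x. max (w x - t) 0) \<phi>2 \<le> M"
proof (rule field_le_epsilon)
  fix \<tau> :: real assume \<tau>: "\<tau> > 0"
  note tf1 = admissible_test_fun[OF \<phi>1] and tf2 = admissible_test_fun[OF \<phi>2]
  obtain B1 where B1: "B1 > 0" "\<And>x. \<bar>diverg \<phi>1 x\<bar> \<le> B1" using diverg_bounded[OF tf1] by blast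
  obtain B2 where B2: "B2 > 0" "\<And>x. \<bar>diverg \<phi>2 x\<bar> \<le> B2" using diverg_bounded[OF tf2] by blast
  define m where "m = measure lborel \<Omega>"
  have m: "m \<ge> 0" by (simp add: m_def)
  define \<kappa> where "\<kappa> = \<tau> / ((B1 + B2) * (m + 1))"
  have \<kappa>: "\<kappa> > 0" using \<tau> B1 B2 m by (simp add: \<kappa>_def)
  define d where "d s = (1 + (s - t) / sqrt ((s - t)\<^sup>2 + \<kappa>\<^sup>2)) / 2" for s
  define \<eta> where "\<eta> s = smooth_pos \<kappa> (s - t)" for s
  have D: "DERIV \<eta> s :> d s" for s
    unfolding \<eta>_def[abs_def] d_def
    by (rule DERIV_chain2[where g="\<lambda>s. s - t" and f="smooth_pos \<kappa>", OF DERIV_smooth_pos[OF \<kappa>], THEN DERIV_cong]) (auto intro!: derivative_eq_intros)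
  have dc: "continuous_on UNIV d"
  proof -
    have "sqrt ((s - t)\<^sup>2 + \<kappa>\<^sup>2) \<noteq> 0" for s using \<kappa> by (smt (verit) real_sqrt_eq_zero_cancel_iff zero_le_power2 zero_less_power)
    then show ?thesis unfolding d_def by (intro continuous_intros) auto
  qed
  have db: "0 \<le> d s" "d s \<le> 1" for s using smooth_pos_deriv_bounds[OF \<kappa>] by (auto simp: d_def)
  have D1: "DERIV (\<lambda>s. s - \<eta> s) s :> 1 - d s" for s using D by (auto intro!: derivative_eq_intros)
  have main: "pairing (\<lambda>x. w x - \<eta> (w x)) \<phi>1 + pairing (\<lambda>x. \<eta> (w x)) \<phi>2 \<le> M"
    using db dc by (intro pairing_split_smooth[OF D1 _ _ D dc db(1) _ w M \<phi>1 \<phi>2]) (auto intro!: continuous_intros)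
  have close: "\<bar>max (s - t) 0 - \<eta> s\<bar> \<le> \<kappa>" for s using smooth_pos_close[OF \<kappa>, of "s - t"] by (simp add: \<eta>_def abs_minus_commute)
  have [measurable]: "w \<in> borel_measurable borel" using w by (simp add: L1_on_def)
  have [measurable]: "\<eta> \<in> borel_measurable borel"
    using D DERIV_isCont by (intro borel_measurable_continuous_onI continuous_at_imp_continuous_on) blast
  have L2: "L1_on \<Omega> (\<lambda>x. \<eta> (w x))"
    by (rule L1_on_bound[where v="\<lambda>x. max (w x - t) 0" and a=\<kappa>, OF _ _ L1_on_max[OF w]]) (use close in \<open>auto, smt (verit)\<close>)
  have L1: "L1_on \<Omega> (\<lambda>x. w x - \<eta> (w x))" by (rule L1_on_diff[OF w L2])
  have "\<bar>pairing (\<lambda>x. min (w x) t) \<phi>1 - pairing (\<lambda>x. w x - \<eta> (w x)) \<phi>1\<bar> \<le> B1 * (\<kappa> * m)"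
    unfolding m_def
  proof (rule pairing_uniform_dist[OF L1_on_min[OF w] L1 tf1 B1(2)])
    show "\<bar>min (w x) t - (w x - \<eta> (w x))\<bar> \<le> \<kappa>" for x using close[of "w x"] by (auto simp: min_def max_def)
  qed
  moreover have "\<bar>pairing (\<lambda>x. max (w x - t) 0) \<phi>2 - pairing (\<lambda>x. \<eta> (w x)) \<phi>2\<bar> \<le> B2 * (\<kappa> * m)"
    unfolding m_def by (rule pairing_uniform_dist[OF L1_on_max[OF w] L2 tf2 B2(2) close])
  ultimately have "pairing (\<lambda>x. min (w x) t) \<phi>1 + pairing (\<lambda>x. max (w x - t) 0) \<phi>2 \<le> M + (B1 + B2) * (\<kappa> * m)"
    using main by (simp add: distrib_right)
  also have "(B1 + B2) * (\<kappa> * m) = \<tau> * (m / (m + 1))"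
  proof -
    define B where "B = B1 + B2"
    have "B \<noteq> 0" using B1(1) B2(1) by (simp add: B_def)
    then show ?thesis unfolding \<kappa>_def B_def[symmetric] by simp
  qed
  also have "\<tau> * (m / (m + 1)) \<le> \<tau> * 1" using \<tau> m by (intro mult_left_mono) auto
  finally show "pairing (\<lambda>x. min (w x) t) \<phi>1 + pairing (\<lambda>x. max (w x - t) 0) \<phi>2 \<le> M + \<tau>" by simp
qed

lemma admissible_0: "admissible \<Omega> \<psi> (\<lambda>_. 0)"
  by (auto simp: admissible_def psi_nonneg intro!: test_funI[of _ "{}"])

lemma pairing_zero_field [simp]: "pairing w (\<lambda>_. 0) = 0"
  by (simp add: pairing_def diverg_def)

text \<open>A real inequality for all pairs of competitors has to control a sum in
  \<open>ennreal\<close>, where negative pairings count as 0. The zero field realises this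
  value.\<close>

lemma admissible_pos_part:
  assumes "admissible \<Omega> \<psi> \<phi>"
  obtains \<phi>' where "admissible \<Omega> \<psi> \<phi>'" "pairing w \<phi>' = max 0 (pairing w \<phi>)"
proof (cases "pairing w \<phi> \<ge> 0")
  case True then show ?thesis using that[of \<phi>] assms by simp
next
  case False then show ?thesis using that[OF admissible_0] by simp
qed

text \<open>The two competitors vary independently, so the bound for every pair is a bound for the
  sum of the two suprema.\<close>

lemma V_split:
  assumes w: "L1_on \<Omega> w"
  shows "V (\<lambda>x. min (w x) t) + V (\<lambda>x. max (w x - t) 0) \<le> V w"
proof (cases "V w = \<infinity>")
  case False
  define M where "M = enn2real (V w)"
  have M: "0 \<le> M" "V w = ennreal M" using False by (auto simp: M_def less_top)
  let ?v1 = "\<lambda>x. min (w x) t" and ?v2 = "\<lambda>x. max (w x - t) 0"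
  let ?A = "{\<phi>. admissible \<Omega> \<psi> \<phi>}"
  have ne: "?A \<noteq> {}" using admissible_0 by blast
  have key: "ennreal (pairing ?v1 \<phi>1) + ennreal (pairing ?v2 \<phi>2) \<le> ennreal M"
    if a: "admissible \<Omega> \<psi> \<phi>1" "admissible \<Omega> \<psi> \<phi>2" for \<phi>1 \<phi>2
  proof -
    obtain p1 where p1: "admissible \<Omega> \<psi> p1" "pairing ?v1 p1 = max 0 (pairing ?v1 \<phi>1)" using admissible_pos_part[OF a(1)] by blast
    obtain p2 where p2: "admissible \<Omega> \<psi> p2" "pairing ?v2 p2 = max 0 (pairing ?v2 \<phi>2)" using admissible_pos_part[OF a(2)] by blast
    have "pairing ?v1 p1 + pairing ?v2 p2 \<le> M" using pairing_split[OF w M(1) _ p1(1) p2(1)] M(2) by simp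
    then have le: "max 0 (pairing ?v1 \<phi>1) + max 0 (pairing ?v2 \<phi>2) \<le> M" unfolding p1(2) p2(2) .
    have e0: "ennreal z = ennreal (max 0 z)" for z by (simp add: max_def ennreal_neg)
    have "ennreal (pairing ?v1 \<phi>1) + ennreal (pairing ?v2 \<phi>2) = ennreal (max 0 (pairing ?v1 \<phi>1) + max 0 (pairing ?v2 \<phi>2))"
      unfolding e0[of "pairing ?v1 \<phi>1"] e0[of "pairing ?v2 \<phi>2"] by (intro ennreal_plus[symmetric]) auto
    also have "\<dots> \<le> ennreal M" using le by (rule ennreal_leI)
    finally show ?thesis .
  qed
  have "V ?v1 + V ?v2 = (SUP \<phi>\<in>?A. ennreal (pairing ?v1 \<phi>) + V ?v2)"
    unfolding aniso_var_def[of _ _ ?v1] by (rule ennreal_SUP_add_left[OF ne, symmetric])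
  also have "\<dots> \<le> ennreal M"
  proof (rule SUP_least)
    fix \<phi>1 assume "\<phi>1 \<in> ?A"
    have "ennreal (pairing ?v1 \<phi>1) + V ?v2 = (SUP \<phi>\<in>?A. ennreal (pairing ?v1 \<phi>1) + ennreal (pairing ?v2 \<phi>))"
      unfolding aniso_var_def[of _ _ ?v2] by (rule ennreal_SUP_add_right[OF ne])
    also have "\<dots> \<le> ennreal M" using key \<open>\<phi>1 \<in> ?A\<close> by (intro SUP_least) auto
    finally show "ennreal (pairing ?v1 \<phi>1) + V ?v2 \<le> ennreal M" .
  qed
  finally show ?thesis using M(2) by simp
qed simp

lemma V_max_le: "L1_on \<Omega> w \<Longrightarrow> V (\<lambda>x. max (w x - t) 0) \<le> V w"
  using V_split[of w t] by (meson add_increasing dual_order.refl le_add2 order_trans zero_le)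

lemma ennreal_max_0: "ennreal (max 0 z) = ennreal z"
  by (simp add: max_def ennreal_neg)

lemma ennreal_add_le: "ennreal (a + b) \<le> ennreal a + ennreal b"
proof -
  have "ennreal (a + b) \<le> ennreal (max 0 a + max 0 b)" by (intro ennreal_leI) auto
  then show ?thesis by (simp add: ennreal_max_0)
qed

lemma V_add_le:
  assumes "L1_on \<Omega> v" "L1_on \<Omega> w" shows "V (\<lambda>x. v x + w x) \<le> V v + V w"
  unfolding aniso_var_le_iff
proof (intro allI impI)
  fix \<phi> assume a: "admissible \<Omega> \<psi> \<phi>"
  have "ennreal (pairing (\<lambda>x. v x + w x) \<phi>) \<le> ennreal (pairing v \<phi>) + ennreal (pairing w \<phi>)"
    unfolding pairing_add[OF assms admissible_test_fun[OF a]] by (rule ennreal_add_le)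
  also have "\<dots> \<le> V v + V w" using a by (intro add_mono pairing_le_aniso_var)
  finally show "ennreal (pairing (\<lambda>x. v x + w x) \<phi>) \<le> V v + V w" .
qed

lemma V_cmult: "c \<ge> 0 \<Longrightarrow> V (\<lambda>x. c * w x) = ennreal c * V w"
  unfolding aniso_var_def pairing_cmult by (simp add: ennreal_mult' SUP_mult_left_ennreal)

text \<open>The divergence of a compactly supported field has integral 0.\<close>

lemma V_const: "V (\<lambda>_. c) = 0"
proof -
  have "pairing (\<lambda>_. c) \<phi> = 0" if "admissible \<Omega> \<psi> \<phi>" for \<phi>
  proof -
    note tf = admissible_test_fun[OF that]
    have "(LINT x|lborel. partial i (\<lambda>x. \<phi> x $ i) x) = 0 \<and> integrable lborel (partial i (\<lambda>x. \<phi> x $ i))" for i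
    proof -
      obtain K where K: "\<And>k. C_c k K (\<lambda>x. \<phi> x $ i)" using test_fun_C_c[OF tf[rule_format, of i]] by metis
      show ?thesis using integral_partial_zero[OF K] C_c_integrable[OF C_c_partial[OF K]] by blast
    qed
    then show ?thesis by (simp add: pairing_def diverg_def)
  qed
  then have "V (\<lambda>_. c) \<le> 0" by (subst aniso_var_le_iff) simp
  then show ?thesis by simp
qed

lemma L1_on_sum: "finite I \<Longrightarrow> (\<And>i. i \<in> I \<Longrightarrow> L1_on \<Omega> (f i)) \<Longrightarrow> L1_on \<Omega> (\<lambda>x. \<Sum>i\<in>I. f i x)"
  by (induction I rule: finite_induct) (auto intro: L1_on_add)

lemma V_sum_le:
  assumes "finite I" "\<And>i. i \<in> I \<Longrightarrow> L1_on \<Omega> (f i)"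
  shows "V (\<lambda>x. \<Sum>i\<in>I. f i x) \<le> (\<Sum>i\<in>I. V (f i))"
  using assms
proof (induction I rule: finite_induct)
  case empty then show ?case by (simp add: V_const)
next
  case (insert i I)
  have "V (\<lambda>x. f i x + (\<Sum>i\<in>I. f i x)) \<le> V (f i) + V (\<lambda>x. \<Sum>i\<in>I. f i x)"
    using insert by (intro V_add_le L1_on_sum) auto
  also have "\<dots> \<le> V (f i) + (\<Sum>i\<in>I. V (f i))" using insert by (intro add_left_mono) auto
  finally show ?case using insert by simp
qed

text \<open>For a fixed field the pairing passes to the limit, because the divergence is bounded and
  vanishes off a set of finite measure. A supremum of continuous functionals is lower
  semicontinuous.\<close>

lemma V_lim:
  assumes m: "\<And>j. f j \<in> borel_measurable borel" "w \<in> borel_measurable borel"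
    and b: "\<And>j x. \<bar>f j x\<bar> \<le> b" and lim: "\<And>x. (\<lambda>j. f j x) \<longlonglongrightarrow> w x"
    and V: "\<And>j. V (f j) \<le> M"
  shows "V w \<le> M"
  unfolding aniso_var_le_iff
proof (intro allI impI)
  fix \<phi> assume a: "admissible \<Omega> \<psi> \<phi>"
  note tf = admissible_test_fun[OF a]
  obtain B where B: "B > 0" "\<And>x. \<bar>diverg \<phi> x\<bar> \<le> B" using diverg_bounded[OF tf] by blast
  have [measurable]: "diverg \<phi> \<in> borel_measurable borel" by (rule diverg_measurable[OF tf])
  have [measurable]: "f j \<in> borel_measurable borel" "w \<in> borel_measurable borel" for j using m by auto
  have "(\<lambda>j. LINT x|lborel. f j x * diverg \<phi> x) \<longlonglongrightarrow> (LINT x|lborel. w x * diverg \<phi> x)"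
  proof (rule integral_dominated_convergence[where w="\<lambda>x. (b * B) * indicator \<Omega> x"])
    show "integrable lborel (\<lambda>x. (b * B) * indicat_real \<Omega> x)" using integrable_indicator_dom by auto
    show "AE x in lborel. (\<lambda>j. f j x * diverg \<phi> x) \<longlonglongrightarrow> w x * diverg \<phi> x" using lim by (auto intro!: tendsto_intros)
    show "AE x in lborel. norm (f j x * diverg \<phi> x) \<le> b * B * indicator \<Omega> x" for j
    proof (intro AE_I2)
      fix x show "norm (f j x * diverg \<phi> x) \<le> b * B * indicator \<Omega> x"
        using diverg_outside[OF tf, of x] mult_mono[OF b[of j x] B(2)[of x]] b[of j x]
        by (cases "x \<in> \<Omega>") (auto simp: abs_mult)
    qed
  qed auto
  then have "(\<lambda>j. ennreal (pairing (f j) \<phi>)) \<longlonglongrightarrow> ennreal (pairing w \<phi>)"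
    unfolding pairing_def by (intro tendsto_intros)
  moreover have "ennreal (pairing (f j) \<phi>) \<le> M" for j using pairing_le_aniso_var[OF a] V by (rule order_trans)
  ultimately show "ennreal (pairing w \<phi>) \<le> M" by (intro LIMSEQ_le_const2) auto
qed

section \<open>Slabs of a function between two levels\<close>

definition clip :: "real \<Rightarrow> real \<Rightarrow> real \<Rightarrow> real" where
  "clip a b s = min (max (s - a) 0) (b - a)"

lemma L1_on_clip: "L1_on \<Omega> w \<Longrightarrow> L1_on \<Omega> (\<lambda>x. clip a b (w x))"
  unfolding clip_def by (intro L1_on_min L1_on_max)

text \<open>\<open>clip\<close> is shifted to start at 0. Hence the slab below m is the truncation
  of the whole slab at height \<open>m - a\<close>, and the slab above m is the excess over that
  height.\<close>

lemma V_clip_split: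
  assumes "L1_on \<Omega> w" "a \<le> m" "m \<le> b"
  shows "V (\<lambda>x. clip a m (w x)) + V (\<lambda>x. clip m b (w x)) \<le> V (\<lambda>x. clip a b (w x))"
proof -
  have "min (clip a b s) (m - a) = clip a m s" "max (clip a b s - (m - a)) 0 = clip m b s" for s
    using assms(2,3) by (auto simp: clip_def)
  then show ?thesis using V_split[OF L1_on_clip[OF assms(1)], of a b "m - a"] by simp
qed

lemma V_clip_sum:
  assumes w: "L1_on \<Omega> w" and h: "h \<ge> 0"
  shows "(\<Sum>i<N. V (\<lambda>x. clip (a + real i * h) (a + real (Suc i) * h) (w x))) \<le> V (\<lambda>x. clip a (a + real N * h) (w x))"
proof (induction N)
  case (Suc N)
  have "(\<Sum>i<Suc N. V (\<lambda>x. clip (a + real i * h) (a + real (Suc i) * h) (w x))) \<le>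
      V (\<lambda>x. clip a (a + real N * h) (w x)) + V (\<lambda>x. clip (a + real N * h) (a + real (Suc N) * h) (w x))"
    using Suc by (simp add: add_right_mono)
  also have "\<dots> \<le> V (\<lambda>x. clip a (a + real (Suc N) * h) (w x))"
    using h by (intro V_clip_split[OF w]) (auto simp: algebra_simps)
  finally show ?case .
qed simp

text \<open>Here r is the variation per unit of height. If each of the N slabs exceeded its share,
  their sum would exceed the variation of the whole slab.\<close>

lemma V_clip_pigeonhole:
  assumes w: "L1_on \<Omega> w" and ab: "a < b" and r: "0 \<le> r" "V (\<lambda>x. clip a b (w x)) \<le> ennreal (r * (b - a))"
    and N: "N > 0"
  obtains t where "a \<le> t" "t + (b - a) / real N \<le> b" "V (\<lambda>x. clip t (t + (b - a) / real N) (w x)) \<le> ennreal (r * ((b - a) / real N))"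
proof -
  define h where "h = (b - a) / real N"
  have h: "h > 0" "real N * h = b - a" using ab N by (simp_all add: h_def)
  have "\<exists>i<N. V (\<lambda>x. clip (a + real i * h) (a + real (Suc i) * h) (w x)) \<le> ennreal (r * h)"
  proof (rule ccontr)
    assume "\<not> ?thesis"
    then have gt: "ennreal (r * h) < V (\<lambda>x. clip (a + real i * h) (a + real (Suc i) * h) (w x))" if "i < N" for i
      using that by (auto simp: not_le)
    have fin: "V (\<lambda>x. clip a b (w x)) < \<infinity>" using r(2) by (simp add: order_le_less_trans)
    have le: "(\<Sum>i<N. V (\<lambda>x. clip (a + real i * h) (a + real (Suc i) * h) (w x))) \<le> V (\<lambda>x. clip a b (w x))"
      using V_clip_sum[OF w, where h=h and N=N and a=a] h by simp
    define f where "f i = enn2real (V (\<lambda>x. clip (a + real i * h) (a + real (Suc i) * h) (w x)))" for i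
    have f: "V (\<lambda>x. clip (a + real i * h) (a + real (Suc i) * h) (w x)) = ennreal (f i)" if "i < N" for i
    proof -
      have "V (\<lambda>x. clip (a + real i * h) (a + real (Suc i) * h) (w x)) \<le> (\<Sum>i<N. V (\<lambda>x. clip (a + real i * h) (a + real (Suc i) * h) (w x)))"
        using that by (intro member_le_sum) auto
      with le fin have "V (\<lambda>x. clip (a + real i * h) (a + real (Suc i) * h) (w x)) < \<infinity>" by (meson order_le_less_trans)
      then show ?thesis by (simp add: f_def)
    qed
    have f0: "0 \<le> f i" for i by (simp add: f_def)
    have "r * h < f i" if "i < N" for i using gt[OF that] f[OF that] f0[of i] r h by (simp add: ennreal_less_iff)
    then have "(\<Sum>i<N. r * h) < (\<Sum>i<N. f i)" using N by (intro sum_strict_mono) auto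
    moreover have "ennreal (\<Sum>i<N. f i) \<le> ennreal (r * (b - a))"
    proof -
      have "ennreal (\<Sum>i<N. f i) = (\<Sum>i<N. V (\<lambda>x. clip (a + real i * h) (a + real (Suc i) * h) (w x)))"
        using f f0 by (subst sum_ennreal[symmetric]) auto
      then show ?thesis using le r(2) by simp
    qed
    then have "(\<Sum>i<N. f i) \<le> r * (b - a)" using r ab by (subst (asm) ennreal_le_iff) auto
    ultimately show False using h(2) by (simp add: mult.left_commute)
  qed
  then obtain i where i: "i < N" "V (\<lambda>x. clip (a + real i * h) (a + real (Suc i) * h) (w x)) \<le> ennreal (r * h)" by blast
  have "real (Suc i) * h \<le> real N * h" using i h by (intro mult_right_mono) auto
  then have "a + real i * h + h \<le> b" using h by (simp add: algebra_simps)
  moreover have "a + real (Suc i) * h = a + real i * h + h" by (simp add: algebra_simps)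
  ultimately show ?thesis using that[of "a + real i * h"] i(2) h unfolding h_def[symmetric] by (simp add: add.assoc)
qed

lemma V_level_set:
  assumes w: "L1_on \<Omega> w" and ab: "a < b" and r: "0 \<le> r" "V (\<lambda>x. clip a b (w x)) \<le> ennreal (r * (b - a))"
  obtains A where "A \<in> sets borel" "{x. b < w x} \<subseteq> A" "A \<subseteq> {x. a \<le> w x}" "V (indicat_real A) \<le> ennreal r"
proof -
  have [measurable]: "w \<in> borel_measurable borel" using w by (simp add: L1_on_def)
  define h where "h j = (b - a) / real (Suc j)" for j
  have h: "h j > 0" for j using ab by (simp add: h_def)
  have h0: "h \<longlonglongrightarrow> 0" unfolding h_def by real_asymp
  have "\<exists>t. a \<le> t \<and> t + h j \<le> b \<and> V (\<lambda>x. clip t (t + h j) (w x)) \<le> ennreal (r * h j)" for j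
    using V_clip_pigeonhole[OF w ab r, of "Suc j"] unfolding h_def by (metis zero_less_Suc)
  then obtain t where t: "\<And>j. a \<le> t j" "\<And>j. t j + h j \<le> b" "\<And>j. V (\<lambda>x. clip (t j) (t j + h j) (w x)) \<le> ennreal (r * h j)"
    by metis
  \<comment> \<open>Two successive subsequences are extracted: the lower levels converge to some
    \<open>t0\<close>, and then the values at \<open>t0\<close> of the rescaled slabs converge to
    some \<theta>. Away from \<open>t0\<close> the limit is determined, but at \<open>t0\<close>
    itself the ramps might oscillate.\<close>
  have "t j \<in> {a..b}" for j using t(1)[of j] t(2)[of j] h[of j] by auto
  then obtain t0 s1 where t0: "t0 \<in> {a..b}" "strict_mono s1" "(t \<circ> s1) \<longlonglongrightarrow> t0"
    using compact_Icc[of a b] unfolding compact_eq_seq_compact_metric seq_compact_def by metis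
  \<comment> \<open>Ramps from 0 to 1. Dividing a slab by its height cancels the factor
    \<open>h j\<close> in the pigeonhole bound.\<close>
  define g where "g j s = clip (t j) (t j + h j) s / h j" for j s
  have g01: "0 \<le> g j s" "g j s \<le> 1" for j s using h[of j] by (auto simp: g_def clip_def)
  then have "g (s1 j) t0 \<in> {0..1}" for j by auto
  then obtain \<theta> s2 where \<theta>: "\<theta> \<in> {0..1}" "strict_mono s2" "((\<lambda>j. g (s1 j) t0) \<circ> s2) \<longlonglongrightarrow> \<theta>"
    using compact_Icc[of "0::real" 1] unfolding compact_eq_seq_compact_metric seq_compact_def by metis
  define s where "s = s1 \<circ> s2"
  have s: "strict_mono s" using t0(2) \<theta>(2) by (simp add: s_def strict_mono_o)
  have ts: "(\<lambda>j. t (s j)) \<longlonglongrightarrow> t0" using LIMSEQ_subseq_LIMSEQ[OF t0(3) \<theta>(2)] by (simp add: s_def o_def)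
  have hs: "(\<lambda>j. h (s j)) \<longlonglongrightarrow> 0" using LIMSEQ_subseq_LIMSEQ[OF h0 s] by (simp add: o_def)
  have \<theta>s: "(\<lambda>j. g (s j) t0) \<longlonglongrightarrow> \<theta>" using \<theta>(3) by (simp add: s_def o_def)
  define G where "G y = (if y < t0 then 0 else if y = t0 then \<theta> else 1)" for y :: real
  have lim: "(\<lambda>j. g (s j) y) \<longlonglongrightarrow> G y" for y
  proof -
    consider "y < t0" | "y = t0" | "y > t0" by linarith
    then show ?thesis
    proof cases
      case 1
      have "\<forall>\<^sub>F j in sequentially. y < t (s j)" using order_tendstoD(1)[OF ts 1] .
      then have "\<forall>\<^sub>F j in sequentially. g (s j) y = 0"
      proof (rule eventually_mono)
        fix j assume "y < t (s j)"
        then show "g (s j) y = 0" using h[of "s j"] by (simp add: g_def clip_def)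
      qed
      then show ?thesis using 1 by (simp add: G_def tendsto_eventually)
    next
      case 2 then show ?thesis using \<theta>s by (simp add: G_def)
    next
      case 3
      have "(\<lambda>j. t (s j) + h (s j)) \<longlonglongrightarrow> t0 + 0" by (intro tendsto_add ts hs)
      then have "\<forall>\<^sub>F j in sequentially. t (s j) + h (s j) < y" using 3 by (intro order_tendstoD(2)) auto
      then have "\<forall>\<^sub>F j in sequentially. g (s j) y = 1"
      proof (rule eventually_mono)
        fix j assume "t (s j) + h (s j) < y"
        then show "g (s j) y = 1" using h[of "s j"] by (simp add: g_def clip_def)
      qed
      then show ?thesis using 3 by (simp add: G_def tendsto_eventually)
    qed
  qed
  have [measurable]: "g j \<in> borel_measurable borel" for j unfolding g_def[abs_def] clip_def by measurable
  have [measurable]: "G \<in> borel_measurable borel" unfolding G_def[abs_def] by measurable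
  have VG: "V (\<lambda>x. G (w x)) \<le> ennreal r"
  proof (rule V_lim[where f="\<lambda>j x. g (s j) (w x)" and b=1])
    show "\<bar>g (s j) (w x)\<bar> \<le> 1" for j x using g01[of "s j" "w x"] by simp
    show "V (\<lambda>x. g (s j) (w x)) \<le> ennreal r" for j
    proof -
      have "V (\<lambda>x. g (s j) (w x)) = ennreal (1 / h (s j)) * V (\<lambda>x. clip (t (s j)) (t (s j) + h (s j)) (w x))"
        using V_cmult[of "1 / h (s j)" "\<lambda>x. clip (t (s j)) (t (s j) + h (s j)) (w x)"] h[of "s j"] by (simp add: g_def)
      also have "\<dots> \<le> ennreal (1 / h (s j)) * ennreal (r * h (s j))" using t(3) by (intro mult_left_mono) auto
      also have "\<dots> = ennreal r" using h[of "s j"] r by (simp add: ennreal_mult'[symmetric])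
      finally show ?thesis .
    qed
  qed (use lim in auto)
  \<comment> \<open>The level set of \<open>t0\<close> may have positive measure, so \<open>G \<circ> w\<close> need not be an indicator; but it
    is a convex combination of two, which truncation at \<open>\<theta>\<close> separates.\<close>
  let ?A1 = "{x. t0 \<le> w x}" and ?A2 = "{x. t0 < w x}"
  have LG: "L1_on \<Omega> (\<lambda>x. G (w x))"
  proof (rule L1_on_bound[where v="\<lambda>_. 0" and a=1])
    show "\<bar>G (w x)\<bar> \<le> 1 + \<bar>0\<bar>" for x using \<theta>(1) by (simp add: G_def)
  qed auto
  have e1: "(\<lambda>x. min (G (w x)) \<theta>) = (\<lambda>x. \<theta> * indicator ?A1 x)" and e2: "(\<lambda>x. max (G (w x) - \<theta>) 0) = (\<lambda>x. (1 - \<theta>) * indicator ?A2 x)"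
    using \<theta>(1) by (auto simp: G_def fun_eq_iff indicator_def)
  have "ennreal \<theta> * V (indicat_real ?A1) + ennreal (1 - \<theta>) * V (indicat_real ?A2) \<le> ennreal r"
    using V_split[OF LG, of \<theta>] VG \<theta>(1) unfolding e1 e2 by (simp add: V_cmult)
  \<comment> \<open>A convex combination is at least the smaller of its terms, so one of the two
    level sets inherits the bound.\<close>
  moreover have "min (V (indicat_real ?A1)) (V (indicat_real ?A2)) \<le>
      ennreal \<theta> * V (indicat_real ?A1) + ennreal (1 - \<theta>) * V (indicat_real ?A2)"
  proof -
    let ?m = "min (V (indicat_real ?A1)) (V (indicat_real ?A2))"
    have "?m = (ennreal \<theta> + ennreal (1 - \<theta>)) * ?m" using \<theta>(1) by (subst ennreal_plus[symmetric]) auto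
    also have "\<dots> = ennreal \<theta> * ?m + ennreal (1 - \<theta>) * ?m" by (rule distrib_right)
    also have "\<dots> \<le> ennreal \<theta> * V (indicat_real ?A1) + ennreal (1 - \<theta>) * V (indicat_real ?A2)"
      by (intro add_mono mult_left_mono) auto
    finally show ?thesis .
  qed
  ultimately have "min (V (indicat_real ?A1)) (V (indicat_real ?A2)) \<le> ennreal r" by (rule order_trans[rotated])
  then have "V (indicat_real ?A1) \<le> ennreal r \<or> V (indicat_real ?A2) \<le> ennreal r" by (simp add: min_le_iff_disj)
  moreover have "{x. b < w x} \<subseteq> ?A1" "{x. b < w x} \<subseteq> ?A2" "?A1 \<subseteq> {x. a \<le> w x}" "?A2 \<subseteq> {x. a \<le> w x}"
    using t0(1) by auto
  moreover have "?A1 \<in> sets borel" "?A2 \<in> sets borel" by measurable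
  ultimately show ?thesis using that by blast
qed

section \<open>Rounding by selected superlevel sets\<close>

lemma L1_on_indicator:
  assumes "A \<in> sets borel" shows "L1_on \<Omega> (indicat_real A)"
proof (rule L1_on_bound[where v="\<lambda>_. 0" and a=1])
  show "\<bar>indicat_real A x\<bar> \<le> 1 + \<bar>0\<bar>" for x by (simp add: indicator_def)
qed (use assms in auto)

text \<open>The slabs between \<open>a i\<close> and \<open>b i\<close> do not overlap, so their
  variations add up to at most \<open>V w\<close>. Each is traded for an indicator of height
  \<open>D i\<close>, at the price \<open>D i / (b i - a i) = 1 / (1 - \<epsilon>)\<close>.\<close>

lemma V_rounding:
  fixes c :: "nat \<Rightarrow> real"
  assumes w: "L1_on \<Omega> w" and fin: "V w < \<infinity>" and c: "\<And>i. i < M \<Longrightarrow> c i < c (Suc i)" and \<epsilon>: "0 < \<epsilon>" "\<epsilon> < 1"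
  obtains A where "\<And>i. i < M \<Longrightarrow> A i \<in> sets borel"
    "\<And>i x. i < M \<Longrightarrow> c (Suc i) - \<epsilon> / 2 * (c (Suc i) - c i) < w x \<Longrightarrow> x \<in> A i"
    "\<And>i x. i < M \<Longrightarrow> x \<in> A i \<Longrightarrow> c i + \<epsilon> / 2 * (c (Suc i) - c i) \<le> w x"
    "ennreal (1 - \<epsilon>) * V (\<lambda>x. c 0 + (\<Sum>i<M. (c (Suc i) - c i) * indicator (A i) x)) \<le> V w"
proof -
  define D where "D i = c (Suc i) - c i" for i
  define a where "a i = c i + \<epsilon> / 2 * D i" for i
  define b where "b i = c (Suc i) - \<epsilon> / 2 * D i" for i
  have D: "D i > 0" if "i < M" for i using c[OF that] by (simp add: D_def)
  have ba: "b i - a i = (1 - \<epsilon>) * D i" for i by (simp add: a_def b_def D_def field_simps)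
  have ab: "a i < b i" if "i < M" for i using ba[of i] D[OF that] \<epsilon> by (metis diff_gt_0_iff_gt mult_pos_pos)
  have cm: "c i \<le> c j" if "i \<le> j" "j \<le> M" for i j
    using that
  proof (induction j rule: dec_induct)
    case (step n) then show ?case using c[of n] by simp
  qed simp
  have bam: "b i \<le> a m" if "i < m" "m < M" for i m
  proof -
    have "\<epsilon> / 2 * D i \<ge> 0" "\<epsilon> / 2 * D m \<ge> 0" using \<epsilon> D[of i] D[of m] that by auto
    moreover have "c (Suc i) \<le> c m" using that by (intro cm) auto
    ultimately show ?thesis by (simp add: a_def b_def)
  qed
  \<comment> \<open>The part of w above s is kept along in the induction. The hypothesis, used at
    level \<open>a m\<close>, provides the part above \<open>a m\<close>, from which slab m and the
    part above s are cut.\<close>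
  have sum: "(\<Sum>i<m. V (\<lambda>x. clip (a i) (b i) (w x))) + V (\<lambda>x. max (w x - s) 0) \<le> V w"
    if "m \<le> M" "\<And>i. i < m \<Longrightarrow> b i \<le> s" for m s
    using that
  proof (induction m arbitrary: s)
    case 0 then show ?case using V_max_le[OF w] by simp
  next
    case (Suc m)
    have am: "a m < b m" "b m \<le> s" using Suc.prems ab by auto
    have IH: "(\<Sum>i<m. V (\<lambda>x. clip (a i) (b i) (w x))) + V (\<lambda>x. max (w x - a m) 0) \<le> V w"
      using Suc.prems bam by (intro Suc.IH) auto
    have "min (max (y - a m) 0) (b m - a m) = clip (a m) (b m) y" "max (max (y - a m) 0 - (b m - a m)) 0 = max (y - b m) 0"
       "max (max (y - b m) 0 - (s - b m)) 0 = max (y - s) 0" for y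
      using am by (auto simp: clip_def)
    then have "V (\<lambda>x. clip (a m) (b m) (w x)) + V (\<lambda>x. max (w x - b m) 0) \<le> V (\<lambda>x. max (w x - a m) 0)"
      and "V (\<lambda>x. max (w x - s) 0) \<le> V (\<lambda>x. max (w x - b m) 0)"
      using V_split[OF L1_on_max[OF w, of "a m"], of "b m - a m"] V_max_le[OF L1_on_max[OF w, of "b m"], of "s - b m"] by simp_all
    then have "V (\<lambda>x. clip (a m) (b m) (w x)) + V (\<lambda>x. max (w x - s) 0) \<le> V (\<lambda>x. max (w x - a m) 0)"
      by (meson add_left_mono order_trans)
    then have "(\<Sum>i<m. V (\<lambda>x. clip (a i) (b i) (w x))) + (V (\<lambda>x. clip (a m) (b m) (w x)) + V (\<lambda>x. max (w x - s) 0)) \<le> V w"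
      using IH by (meson add_left_mono order_trans)
    then show ?case by (simp add: add.assoc)
  qed
  have tot: "(\<Sum>i<M. V (\<lambda>x. clip (a i) (b i) (w x))) \<le> V w"
  proof -
    \<comment> \<open>Any common upper bound of the \<open>b i\<close> serves; 0 is inserted for the
      case \<open>M = 0\<close>.\<close>
    define s where "s = Max (insert 0 (b ` {..<M}))"
    have "b i \<le> s" if "i < M" for i using that by (auto simp: s_def intro!: Max_ge)
    then have "(\<Sum>i<M. V (\<lambda>x. clip (a i) (b i) (w x))) + V (\<lambda>x. max (w x - s) 0) \<le> V w" by (intro sum) auto
    moreover have "(\<Sum>i<M. V (\<lambda>x. clip (a i) (b i) (w x))) \<le> (\<Sum>i<M. V (\<lambda>x. clip (a i) (b i) (w x))) + V (\<lambda>x. max (w x - s) 0)" by simp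
    ultimately show ?thesis by (rule order_trans[rotated])
  qed
  define \<rho> where "\<rho> i = enn2real (V (\<lambda>x. clip (a i) (b i) (w x))) / (b i - a i)" for i
  have \<rho>: "0 \<le> \<rho> i" "V (\<lambda>x. clip (a i) (b i) (w x)) = ennreal (\<rho> i * (b i - a i))" if "i < M" for i
  proof -
    show "0 \<le> \<rho> i" using ab[OF that] by (simp add: \<rho>_def)
    have "V (\<lambda>x. clip (a i) (b i) (w x)) \<le> (\<Sum>i<M. V (\<lambda>x. clip (a i) (b i) (w x)))" using that by (intro member_le_sum) auto
    then have "V (\<lambda>x. clip (a i) (b i) (w x)) < \<infinity>" using tot fin by (meson order_le_less_trans)
    then show "V (\<lambda>x. clip (a i) (b i) (w x)) = ennreal (\<rho> i * (b i - a i))" using ab[OF that] by (simp add: \<rho>_def)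
  qed
  have "\<exists>A. i < M \<longrightarrow> A \<in> sets borel \<and> {x. b i < w x} \<subseteq> A \<and> A \<subseteq> {x. a i \<le> w x} \<and> V (indicat_real A) \<le> ennreal (\<rho> i)" for i
    using V_level_set[OF w ab \<rho>(1), of i] \<rho>(2)[of i] by (metis order_refl)
  then obtain A where A: "\<And>i. i < M \<Longrightarrow> A i \<in> sets borel" "\<And>i. i < M \<Longrightarrow> {x. b i < w x} \<subseteq> A i"
    "\<And>i. i < M \<Longrightarrow> A i \<subseteq> {x. a i \<le> w x}" "\<And>i. i < M \<Longrightarrow> V (indicat_real (A i)) \<le> ennreal (\<rho> i)" by metis
  show ?thesis
  proof (rule that[of A])
    have LI: "L1_on \<Omega> (\<lambda>x. D i * indicator (A i) x)" if "i < M" for i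
      using L1_on_indicator[OF A(1)[OF that]] by (rule L1_on_cmult)
    have "V (\<lambda>x. c 0 + (\<Sum>i<M. D i * indicator (A i) x)) \<le> V (\<lambda>_. c 0) + V (\<lambda>x. \<Sum>i<M. D i * indicator (A i) x)"
      using LI by (intro V_add_le L1_on_sum) auto
    also have "\<dots> \<le> (\<Sum>i<M. V (\<lambda>x. D i * indicator (A i) x))" using V_sum_le[of "{..<M}" "\<lambda>i x. D i * indicator (A i) x"] LI by (simp add: V_const)
    also have "\<dots> = (\<Sum>i<M. ennreal (D i) * V (indicat_real (A i)))" using D by (intro sum.cong refl V_cmult) (auto intro: less_imp_le)
    also have "\<dots> \<le> (\<Sum>i<M. ennreal (D i) * ennreal (\<rho> i))" using A(4) by (intro sum_mono mult_left_mono) auto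
    finally have "ennreal (1 - \<epsilon>) * V (\<lambda>x. c 0 + (\<Sum>i<M. D i * indicator (A i) x)) \<le> ennreal (1 - \<epsilon>) * (\<Sum>i<M. ennreal (D i) * ennreal (\<rho> i))"
      by (rule mult_left_mono) simp
    also have "\<dots> = (\<Sum>i<M. V (\<lambda>x. clip (a i) (b i) (w x)))"
      unfolding sum_distrib_left
    proof (intro sum.cong refl)
      fix i assume "i \<in> {..<M}"
      then have i: "i < M" by simp
      show "ennreal (1 - \<epsilon>) * (ennreal (D i) * ennreal (\<rho> i)) = V (\<lambda>x. clip (a i) (b i) (w x))"
        unfolding \<rho>(2)[OF i] ba using D[OF i] \<rho>(1)[OF i] \<epsilon> by (simp add: ennreal_mult'[symmetric] mult_ac)
    qed
    also have "\<dots> \<le> V w" by (rule tot)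
    finally show "ennreal (1 - \<epsilon>) * V (\<lambda>x. c 0 + (\<Sum>i<M. (c (Suc i) - c i) * indicator (A i) x)) \<le> V w"
      by (simp add: D_def)
    show "A i \<in> sets borel" if "i < M" for i using A(1)[OF that] .
    show "x \<in> A i" if "i < M" "c (Suc i) - \<epsilon> / 2 * (c (Suc i) - c i) < w x" for i x
      using A(2)[OF that(1)] that(2) by (auto simp: b_def D_def)
    show "c i + \<epsilon> / 2 * (c (Suc i) - c i) \<le> w x" if "i < M" "x \<in> A i" for i x
      using A(3)[OF that(1)] that(2) by (auto simp: a_def D_def)
  qed
qed

end


section \<open>Energy and anisotropic variation\<close>

text \<open>The definitions integrate Lebesgue measurable functions over
  \<open>lebesgue_on \<Omega>\<close>, the argument integrates Borel functions over
  \<open>lborel\<close>. These two facts, together with \<open>borel_representative\<close>, are the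
  passage between the two settings.\<close>

lemma
  fixes f g :: "real^'n::finite \<Rightarrow> real"
  assumes \<Omega>[measurable]: "\<Omega> \<in> sets borel" and f: "f \<in> borel_measurable (lebesgue_on \<Omega>)" and g[measurable]: "g \<in> borel_measurable borel"
    and ae: "AE x in lborel. x \<in> \<Omega> \<longrightarrow> f x = g x"
  shows integral_lebesgue_on_borel: "(LINT x|lebesgue_on \<Omega>. f x) = (LINT x|lborel. indicator \<Omega> x * g x)"
    and integrable_lebesgue_on_borel: "integrable (lebesgue_on \<Omega>) f \<longleftrightarrow> integrable lborel (\<lambda>x. indicator \<Omega> x * g x)"
proof -
  have S: "\<Omega> \<inter> space lebesgue \<in> sets lebesgue" using \<Omega> by simp
  have fm: "(\<lambda>x. indicator \<Omega> x *\<^sub>R f x) \<in> borel_measurable lebesgue"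
    using f borel_measurable_restrict_space_iff[OF S, of f] by simp
  have gm: "(\<lambda>x. indicator \<Omega> x * g x) \<in> borel_measurable lborel" by simp
  then have gm': "(\<lambda>x. indicator \<Omega> x * g x) \<in> borel_measurable lebesgue" by (rule measurable_completion)
  have ae': "AE x in lebesgue. indicator \<Omega> x *\<^sub>R f x = indicator \<Omega> x * g x"
    using AE_completion[OF ae] by eventually_elim (auto simp: indicator_def)
  have "(LINT x|lebesgue_on \<Omega>. f x) = (LINT x|lebesgue. indicator \<Omega> x *\<^sub>R f x)"
    by (rule integral_restrict_space[OF S])
  also have "\<dots> = (LINT x|lebesgue. indicator \<Omega> x * g x)" by (rule integral_cong_AE[OF fm gm' ae'])
  also have "\<dots> = (LINT x|lborel. indicator \<Omega> x * g x)" by (rule integral_completion[OF gm])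
  finally show "(LINT x|lebesgue_on \<Omega>. f x) = (LINT x|lborel. indicator \<Omega> x * g x)" .
  have "integrable (lebesgue_on \<Omega>) f \<longleftrightarrow> integrable lebesgue (\<lambda>x. indicator \<Omega> x *\<^sub>R f x)"
    by (rule integrable_restrict_space[OF S])
  also have "\<dots> \<longleftrightarrow> integrable lebesgue (\<lambda>x. indicator \<Omega> x * g x)" by (rule integrable_cong_AE[OF fm gm' ae'])
  also have "\<dots> \<longleftrightarrow> integrable lborel (\<lambda>x. indicator \<Omega> x * g x)" by (rule integrable_completion[OF gm])
  finally show "integrable (lebesgue_on \<Omega>) f \<longleftrightarrow> integrable lborel (\<lambda>x. indicator \<Omega> x * g x)" .
qed

lemma borel_representative:
  fixes u :: "real^'n::finite \<Rightarrow> real"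
  assumes \<Omega>: "\<Omega> \<in> sets borel" and u: "u \<in> borel_measurable (lebesgue_on \<Omega>)"
  obtains w where "w \<in> borel_measurable borel" "AE x in lborel. x \<in> \<Omega> \<longrightarrow> u x = w x"
proof -
  have S: "\<Omega> \<inter> space lebesgue \<in> sets lebesgue" using \<Omega> by simp
  have "(\<lambda>x. indicator \<Omega> x *\<^sub>R u x) \<in> borel_measurable lebesgue"
    using u borel_measurable_restrict_space_iff[OF S, of u] by simp
  then obtain w where w: "w \<in> borel_measurable lborel" "AE x in lborel. indicator \<Omega> x *\<^sub>R u x = w x"
    using completion_ex_borel_measurable_real by blast
  have "AE x in lborel. x \<in> \<Omega> \<longrightarrow> u x = w x" using w(2) by eventually_elim (auto simp: indicator_def)
  with w(1) show ?thesis using that[of w] by simp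
qed

lemma test_fun_integral_lebesgue_on:
  fixes u w :: "real^'n::finite \<Rightarrow> real"
  assumes \<Omega>: "\<Omega> \<in> sets borel" and u: "u \<in> borel_measurable (lebesgue_on \<Omega>)" and w: "w \<in> borel_measurable borel"
    and ae: "AE x in lborel. x \<in> \<Omega> \<longrightarrow> u x = w x" and \<phi>: "test_fun \<Omega> \<phi>"
  shows "(LINT x|lebesgue_on \<Omega>. u x * partial i \<phi> x) = (LINT x|lborel. w x * partial i \<phi> x)"
proof -
  have "C_k (Suc 0) \<phi>" using \<phi> by (rule test_fun_C_k)
  then have pm: "partial i \<phi> \<in> borel_measurable borel" by (auto intro!: borel_measurable_continuous_onI)
  then have pm': "partial i \<phi> \<in> borel_measurable (lebesgue_on \<Omega>)"
    by (intro measurable_restrict_space1 measurable_completion) simp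
  have "(LINT x|lebesgue_on \<Omega>. u x * partial i \<phi> x) = (LINT x|lborel. indicator \<Omega> x * (w x * partial i \<phi> x))"
    using u w pm pm' ae by (intro integral_lebesgue_on_borel \<Omega>) auto
  also have "(\<lambda>x. indicator \<Omega> x * (w x * partial i \<phi> x)) = (\<lambda>x. w x * partial i \<phi> x)"
  proof
    show "indicator \<Omega> x * (w x * partial i \<phi> x) = w x * partial i \<phi> x" for x
      using test_fun_partial_outside[OF \<phi>, of x i] by (cases "x \<in> \<Omega>") auto
  qed
  finally show ?thesis .
qed

lemma continuous_measurable_restrict:
  "continuous_on UNIV f \<Longrightarrow> f \<in> borel_measurable (restrict_space borel \<Omega>)"
  by (intro measurable_restrict_space1 borel_measurable_continuous_onI)

text \<open>The defining identity of the derivative is summed over the coordinates of the field. It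
  concerns u, while V sees its Borel representative w; the integrals agree because the two functions
  coincide almost everywhere on \<Omega>.\<close>

lemma has_distr_deriv_pairing:
  fixes u w :: "real^'n::finite \<Rightarrow> real"
  assumes \<Omega>: "\<Omega> \<in> sets borel" and u: "u \<in> borel_measurable (lebesgue_on \<Omega>)" and w: "L1_on \<Omega> w"
    and ae: "AE x in lborel. x \<in> \<Omega> \<longrightarrow> u x = w x" and \<mu>: "has_distr_deriv \<Omega> u \<mu>"
    and \<phi>: "\<forall>i. test_fun \<Omega> (\<lambda>x. \<phi> x $ i)"
  defines "\<tau> \<equiv> total_variation (borel_on \<Omega>) \<mu>"
  shows "integrable \<tau> (\<lambda>x. \<phi> x \<bullet> vec_RN_deriv \<tau> \<mu> x)"
    and "pairing w \<phi> = (LINT x|\<tau>. \<phi> x \<bullet> vec_RN_deriv \<tau> \<mu> x)"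
proof -
  have vm: "vector_measure (borel_on \<Omega>) \<mu>" using \<mu> by (simp add: has_distr_deriv_def)
  have \<nu>: "integrable \<tau> (vec_RN_deriv \<tau> \<mu>)" unfolding \<tau>_def by (rule vec_RN_deriv_total_variation[OF vm])
  have m: "(\<lambda>x. \<phi> x $ i) \<in> borel_measurable \<tau>" for i
    unfolding \<tau>_def using test_fun_C_k[OF \<phi>[rule_format, of i], of 0]
    by (simp add: measurable_cong_sets[OF sets_total_variation refl] continuous_measurable_restrict)
  have int: "integrable \<tau> (\<lambda>x. \<phi> x $ i *\<^sub>R vec_RN_deriv \<tau> \<mu> x)" for i
  proof -
    obtain K where "C_c 0 K (\<lambda>x. \<phi> x $ i)" using test_fun_C_c[OF \<phi>[rule_format, of i]] by metis
    from C_c_bounded[OF this] obtain B where B: "\<And>x. \<bar>\<phi> x $ i\<bar> \<le> B" by blast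
    show ?thesis
    proof (rule Bochner_Integration.integrable_bound[of _ "\<lambda>x. B *\<^sub>R vec_RN_deriv \<tau> \<mu> x"])
      show "integrable \<tau> (\<lambda>x. B *\<^sub>R vec_RN_deriv \<tau> \<mu> x)" using \<nu> by auto
      show "(\<lambda>x. \<phi> x $ i *\<^sub>R vec_RN_deriv \<tau> \<mu> x) \<in> borel_measurable \<tau>" using m \<nu> by auto
      show "AE x in \<tau>. norm (\<phi> x $ i *\<^sub>R vec_RN_deriv \<tau> \<mu> x) \<le> norm (B *\<^sub>R vec_RN_deriv \<tau> \<mu> x)"
      proof (intro AE_I2)
        fix x
        have "\<bar>\<phi> x $ i\<bar> \<le> \<bar>B\<bar>" using B[of x] by linarith
        then show "norm (\<phi> x $ i *\<^sub>R vec_RN_deriv \<tau> \<mu> x) \<le> norm (B *\<^sub>R vec_RN_deriv \<tau> \<mu> x)" by (simp add: mult_right_mono)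
      qed
    qed
  qed
  have int': "integrable \<tau> (\<lambda>x. \<phi> x $ i * vec_RN_deriv \<tau> \<mu> x $ i)" for i
    using integrable_bounded_linear[OF bounded_linear_vec_nth int, of i i] by simp
  then show "integrable \<tau> (\<lambda>x. \<phi> x \<bullet> vec_RN_deriv \<tau> \<mu> x)" by (simp add: inner_vec_def)
  have wi: "integrable lborel (\<lambda>x. w x * partial i (\<lambda>x. \<phi> x $ i) x)" for i
  proof -
    obtain K where K: "K \<subseteq> \<Omega>" "\<And>k. C_c k K (\<lambda>x. \<phi> x $ i)" using test_fun_C_c[OF \<phi>[rule_format, of i]] by metis
    have p: "C_c 0 K (partial i (\<lambda>x. \<phi> x $ i))" using C_c_partial[OF K(2)] .
    from C_c_bounded[OF p] obtain B where B: "\<And>x. \<bar>partial i (\<lambda>x. \<phi> x $ i) x\<bar> \<le> B" by blast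
    have "integrable lborel (\<lambda>x. partial i (\<lambda>x. \<phi> x $ i) x * (indicator \<Omega> x * w x))"
      using w C_c_measurable[OF p] B
      by (intro integrable_mult_bounded[of _ "\<lambda>x. indicator \<Omega> x * w x" "partial i (\<lambda>x. \<phi> x $ i)" B]) (auto simp: L1_on_def)
    moreover have "partial i (\<lambda>x. \<phi> x $ i) x * (indicator \<Omega> x * w x) = w x * partial i (\<lambda>x. \<phi> x $ i) x" for x
      using C_c_cont(3)[OF p, of x] K(1) by (cases "x \<in> \<Omega>") auto
    ultimately show ?thesis by simp
  qed
  have "pairing w \<phi> = (\<Sum>i\<in>UNIV. - (LINT x|lborel. w x * partial i (\<lambda>x. \<phi> x $ i) x))"
    unfolding pairing_def diverg_def using wi by (simp add: sum_distrib_left sum_negf)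
  also have "\<dots> = (\<Sum>i\<in>UNIV. vec_integral (borel_on \<Omega>) \<mu> (\<lambda>x. \<phi> x $ i) $ i)"
  proof (intro sum.cong refl)
    fix i
    have "(LINT x|lborel. w x * partial i (\<lambda>x. \<phi> x $ i) x) = (LINT x|lebesgue_on \<Omega>. u x * partial i (\<lambda>x. \<phi> x $ i) x)"
      using w ae \<phi> by (intro test_fun_integral_lebesgue_on[OF \<Omega> u, symmetric]) (auto simp: L1_on_def)
    also have "\<dots> = - (vec_integral (borel_on \<Omega>) \<mu> (\<lambda>x. \<phi> x $ i) $ i)"
      using \<mu> \<phi> unfolding has_distr_deriv_def by blast
    finally show "- (LINT x|lborel. w x * partial i (\<lambda>x. \<phi> x $ i) x) = vec_integral (borel_on \<Omega>) \<mu> (\<lambda>x. \<phi> x $ i) $ i" by simp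
  qed
  also have "\<dots> = (\<Sum>i\<in>UNIV. LINT x|\<tau>. \<phi> x $ i * vec_RN_deriv \<tau> \<mu> x $ i)"
    unfolding vec_integral_def \<tau>_def[symmetric]
    using integral_bounded_linear[OF bounded_linear_vec_nth int] by simp
  also have "\<dots> = (LINT x|\<tau>. \<phi> x \<bullet> vec_RN_deriv \<tau> \<mu> x)"
    using int' by (simp add: inner_vec_def)
  finally show "pairing w \<phi> = (LINT x|\<tau>. \<phi> x \<bullet> vec_RN_deriv \<tau> \<mu> x)" .
qed

section \<open>Approximate support vectors and nearly optimal fields\<close>

lemma disjoint_compacts_separated:
  fixes K :: "nat \<Rightarrow> 'a::heine_borel set"
  assumes "\<And>i. i < N \<Longrightarrow> compact (K i)" "\<And>i j. i < N \<Longrightarrow> j < N \<Longrightarrow> i \<noteq> j \<Longrightarrow> K i \<inter> K j = {}"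
  obtains d where "d > 0" "\<And>i j x y. i < N \<Longrightarrow> j < N \<Longrightarrow> i \<noteq> j \<Longrightarrow> x \<in> K i \<Longrightarrow> y \<in> K j \<Longrightarrow> d \<le> dist x y"
proof -
  have "\<exists>d>0. i < N \<and> j < N \<and> i \<noteq> j \<longrightarrow> (\<forall>x\<in>K i. \<forall>y\<in>K j. d \<le> dist x y)" for i j
  proof (cases "i < N \<and> j < N \<and> i \<noteq> j")
    case True
    then show ?thesis using separate_compact_closed[of "K i" "K j"] assms compact_imp_closed by metis
  next
    case False
    then show ?thesis using zero_less_one by blast
  qed
  then obtain D :: "nat \<Rightarrow> nat \<Rightarrow> real" where D: "\<And>i j. D i j > 0"
    "\<And>i j x y. i < N \<Longrightarrow> j < N \<Longrightarrow> i \<noteq> j \<Longrightarrow> x \<in> K i \<Longrightarrow> y \<in> K j \<Longrightarrow> D i j \<le> dist x y" by metis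
  \<comment> \<open>The value 1 keeps the set nonempty when \<open>N = 0\<close>.\<close>
  define S where "S = insert 1 ((\<lambda>(i, j). D i j) ` ({..<N} \<times> {..<N}))"
  have fS: "finite S" by (simp add: S_def)
  show ?thesis
  proof (rule that[of "Min S"])
    show "Min S > 0" using D(1) fS by (subst Min_gr_iff) (auto simp: S_def)
    fix i j x y assume a: "i < N" "j < N" "i \<noteq> j" "x \<in> K i" "y \<in> K j"
    have "D i j \<in> S" using a unfolding S_def by (intro insertI2 image_eqI[of _ _ "(i, j)"]) auto
    then have "Min S \<le> D i j" using fS by (rule Min_le[rotated])
    with D(2)[OF a] show "Min S \<le> dist x y" by simp
  qed
qed

text \<open>The point at depth \<delta> below the graph lies off the epigraph, a closed convex cone,
  and is strictly separated from it. The cone property removes the constant term of the hyperplane,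
  and finiteness of f at z excludes a vertical one.\<close>

lemma convex_epigraph_support:
  fixes f :: "'a::euclidean_space \<Rightarrow> real"
  assumes conv: "convex_on UNIV f" and cont: "continuous_on UNIV f"
    and hom: "\<And>t x. 0 < t \<Longrightarrow> f (t *\<^sub>R x) = t * f x" and f0: "f 0 = 0" and \<delta>: "\<delta> > 0"
  obtains p where "\<And>x. p \<bullet> x \<le> f x" "f z - \<delta> \<le> p \<bullet> z"
proof -
  define S where "S = {q :: 'a \<times> real. f (fst q) \<le> snd q}"
  have cl: "closed S"
  proof -
    have "continuous_on UNIV (\<lambda>q :: 'a \<times> real. f (fst q))"
      by (rule continuous_on_compose2[OF cont]) (auto intro!: continuous_intros)
    then show ?thesis unfolding S_def by (intro closed_Collect_le continuous_intros)
  qed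
  have cvx: "convex S"
    unfolding convex_def
  proof (intro ballI allI impI)
    fix a b :: "'a \<times> real" and u v :: real assume ab: "a \<in> S" "b \<in> S" and uv: "0 \<le> u" "0 \<le> v" "u + v = 1"
    have "f (u *\<^sub>R fst a + v *\<^sub>R fst b) \<le> u * f (fst a) + v * f (fst b)"
      using conv uv unfolding convex_on_def by blast
    also have "\<dots> \<le> u * snd a + v * snd b" using ab uv by (intro add_mono mult_left_mono) (auto simp: S_def)
    finally show "u *\<^sub>R a + v *\<^sub>R b \<in> S" by (simp add: S_def)
  qed
  have nin: "(z, f z - \<delta>) \<notin> S" using \<delta> by (simp add: S_def)
  obtain a b where ab: "a \<bullet> (z, f z - \<delta>) < b" "\<And>q. q \<in> S \<Longrightarrow> b < a \<bullet> q"
    using separating_hyperplane_closed_point[OF cvx cl nin] by blast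
  define g \<alpha> where "g = fst a" "\<alpha> = snd a"
  have z: "g \<bullet> z + \<alpha> * (f z - \<delta>) < b" using ab(1) by (simp add: g_\<alpha>_def inner_prod_def)
  have S': "b < g \<bullet> x + \<alpha> * s" if "f x \<le> s" for x s
    using ab(2)[of "(x, s)"] that by (simp add: g_\<alpha>_def inner_prod_def S_def)
  have b: "b < 0" using S'[of 0 0] f0 by simp
  \<comment> \<open>A negative value on the cone could be rescaled to equal b exactly, which strict
    separation forbids.\<close>
  have nn: "0 \<le> g \<bullet> x + \<alpha> * s" if s: "f x \<le> s" for x s
  proof (rule ccontr)
    assume "\<not> ?thesis"
    then have neg: "g \<bullet> x + \<alpha> * s < 0" by simp
    define t where "t = b / (g \<bullet> x + \<alpha> * s)"
    have t: "t > 0" using b neg by (simp add: t_def divide_neg_neg)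
    have "f (t *\<^sub>R x) \<le> t * s" using hom[OF t, of x] s t by simp
    from S'[OF this] have "b < t * (g \<bullet> x + \<alpha> * s)" by (simp add: distrib_left mult.left_commute)
    then show False using neg by (simp add: t_def)
  qed
  have \<alpha>: "\<alpha> > 0"
  proof (rule ccontr)
    assume "\<not> \<alpha> > 0"
    moreover have "\<alpha> \<ge> 0" using nn[of 0 1] f0 by simp
    ultimately have "\<alpha> = 0" by simp
    then show False using z b nn[of z "f z"] by simp
  qed
  show ?thesis
  proof (rule that[of "- (g /\<^sub>R \<alpha>)"])
    fix x
    have "0 \<le> (g \<bullet> x + \<alpha> * f x) / \<alpha>" using nn[of x "f x"] \<alpha> by simp
    also have "\<dots> = g \<bullet> x / \<alpha> + f x" using \<alpha> by (simp add: add_divide_distrib)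
    finally show "- (g /\<^sub>R \<alpha>) \<bullet> x \<le> f x" using \<alpha> by (simp add: inverse_eq_divide)
  next
    have "(g \<bullet> z + \<alpha> * (f z - \<delta>)) / \<alpha> < 0" using z b \<alpha> by (intro divide_neg_pos) auto
    moreover have "(g \<bullet> z + \<alpha> * (f z - \<delta>)) / \<alpha> = g \<bullet> z / \<alpha> + (f z - \<delta>)" using \<alpha> by (simp add: add_divide_distrib)
    ultimately show "f z - \<delta> \<le> - (g /\<^sub>R \<alpha>) \<bullet> z" using \<alpha> by (simp add: inverse_eq_divide)
  qed
qed

context anisotropy begin

lemma psi_continuous_snd: "continuous_on UNIV (\<psi> x)"
proof -
  have "continuous_on UNIV (\<lambda>\<xi>. (x, \<xi>))" by (intro continuous_on_Pair continuous_on_const continuous_on_id)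
  from continuous_on_compose2[OF psi_cont this] show ?thesis by simp
qed

lemma psi_support:
  assumes "\<delta> > 0"
  obtains p where "\<And>\<xi>. p \<bullet> \<xi> \<le> \<psi> x \<xi>" "\<psi> x z - \<delta> \<le> p \<bullet> z"
  using convex_epigraph_support[of "\<psi> x" \<delta> z] psi psi_continuous_snd psi_scaleR assms
  by (auto simp: class_G_def)

lemma psi_measurable:
  assumes "sets \<tau> = sets (borel_on \<Omega>)" "\<nu> \<in> borel_measurable \<tau>"
  shows "(\<lambda>y. \<psi> y (\<nu> y)) \<in> borel_measurable \<tau>"
proof -
  have p: "(\<lambda>(x, \<xi>). \<psi> x \<xi>) \<in> borel_measurable borel" using psi_cont by (rule borel_measurable_continuous_onI)
  have "(\<lambda>y. y) \<in> borel_measurable \<tau>"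
    unfolding measurable_cong_sets[OF assms(1) refl] by (rule continuous_measurable_restrict[OF continuous_on_id])
  then have "(\<lambda>y. (y, \<nu> y)) \<in> borel_measurable \<tau>" using assms(2) by (rule borel_measurable_Pair)
  from measurable_compose[OF this p] show ?thesis by simp
qed

lemma psi_integrable:
  assumes "sets \<tau> = sets (borel_on \<Omega>)" "integrable \<tau> \<nu>"
  shows "integrable \<tau> (\<lambda>y. \<psi> y (\<nu> y))"
proof (rule Bochner_Integration.integrable_bound[of _ "\<lambda>y. L *\<^sub>R \<nu> y"])
  show "AE y in \<tau>. norm (\<psi> y (\<nu> y)) \<le> norm (L *\<^sub>R \<nu> y)"
    using psi_nonneg psi_upper by (intro AE_I2) (simp, meson abs_ge_self mult_right_mono norm_ge_zero order_trans)
qed (use assms psi_measurable in auto)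

lemma BV_distr_deriv: "(\<exists>\<mu>. has_distr_deriv \<Omega> u \<mu>) \<Longrightarrow> has_distr_deriv \<Omega> u (distr_deriv \<Omega> u)"
  unfolding distr_deriv_def using someI_ex[of "has_distr_deriv \<Omega> u"] .

text \<open>The constraint, taken at the density \<nu> of the derivative, reads
  \<open>\<phi> y \<bullet> \<nu> y \<le> \<psi> y (\<nu> y)\<close>, and it remains to
  integrate.\<close>

lemma V_le_energy:
  assumes u: "u \<in> borel_measurable (lebesgue_on \<Omega>)" "\<exists>\<mu>. has_distr_deriv \<Omega> u \<mu>" and w: "L1_on \<Omega> w"
    and ae: "AE x in lborel. x \<in> \<Omega> \<longrightarrow> u x = w x"
  shows "V w \<le> ennreal (energy \<psi> \<Omega> u)"
  unfolding aniso_var_le_iff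
proof (intro allI impI ennreal_leI)
  fix \<phi> assume a: "admissible \<Omega> \<psi> \<phi>"
  define \<mu> where "\<mu> = distr_deriv \<Omega> u"
  define \<tau> where "\<tau> = total_variation (borel_on \<Omega>) \<mu>"
  have \<mu>: "has_distr_deriv \<Omega> u \<mu>" unfolding \<mu>_def by (rule BV_distr_deriv[OF u(2)])
  then have vm: "vector_measure (borel_on \<Omega>) \<mu>" by (simp add: has_distr_deriv_def)
  have s\<tau>: "sets \<tau> = sets (borel_on \<Omega>)" by (simp add: \<tau>_def)
  have \<nu>: "integrable \<tau> (vec_RN_deriv \<tau> \<mu>)" unfolding \<tau>_def by (rule vec_RN_deriv_total_variation[OF vm])
  note p = has_distr_deriv_pairing[OF dom_borel u(1) w ae \<mu> admissible_test_fun[OF a], folded \<tau>_def]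
  have "pairing w \<phi> \<le> (LINT y|\<tau>. \<psi> y (vec_RN_deriv \<tau> \<mu> y))"
    unfolding p(2) using a by (intro integral_mono p(1) psi_integrable[OF s\<tau> \<nu>]) (simp add: admissible_def)
  then show "pairing w \<phi> \<le> energy \<psi> \<Omega> u"
    by (simp add: energy_def var_deriv_def \<mu>_def \<tau>_def)
qed

text \<open>A support vector chosen at one pair of a dense set is nearly optimal at all close pairs,
  because \<psi> is continuous and support vectors have length at most L. A countable family allows
  a measurable choice of j later. The vectors satisfy the constraint at \<open>y j\<close> rather
  than at x, which the bound \<open>e0\<close> on the distance repairs.\<close>

lemma support_cover:
  assumes e0: "e0 > 0" and \<delta>: "\<delta> > 0"
  obtains y p :: "nat \<Rightarrow> real^'n" where "\<And>j \<xi>. p j \<bullet> \<xi> \<le> \<psi> (y j) \<xi>"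
    "\<And>x \<xi>. \<exists>j. dist x (y j) < e0 \<and> \<psi> x \<xi> - \<delta> * norm \<xi> \<le> p j \<bullet> \<xi>"
proof -
  obtain D :: "((real^'n) \<times> (real^'n)) set" where D: "countable D" "\<And>X. open X \<Longrightarrow> X \<noteq> {} \<Longrightarrow> \<exists>d\<in>D. d \<in> X"
    using countable_dense_setE by blast
  have Dne: "D \<noteq> {}" using D(2)[of UNIV] by auto
  define y where "y j = fst (from_nat_into D j)" for j
  define z where "z j = snd (from_nat_into D j)" for j
  have "\<exists>p. (\<forall>\<xi>. p \<bullet> \<xi> \<le> \<psi> (y j) \<xi>) \<and> \<psi> (y j) (z j) - \<delta> / 3 \<le> p \<bullet> z j" for j
    using psi_support[of "\<delta> / 3" "y j" "z j"] \<delta> by (metis divide_pos_pos zero_less_numeral)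
  then obtain p where p: "\<And>j \<xi>. p j \<bullet> \<xi> \<le> \<psi> (y j) \<xi>" "\<And>j. \<psi> (y j) (z j) - \<delta> / 3 \<le> p j \<bullet> z j" by metis
  show ?thesis
  proof (rule that[OF p(1)])
    fix x \<xi> :: "real^'n"
    \<comment> \<open>For \<xi> = 0 any unit vector will do, as everything is multiplied by
      \<open>norm \<xi>\<close> in the end.\<close>
    define u where "u = (if \<xi> = 0 then axis undefined 1 else \<xi> /\<^sub>R norm \<xi>)"
    have u: "\<xi> = norm \<xi> *\<^sub>R u" by (simp add: u_def)
    have L: "L \<ge> l" using psi_lower[of "axis undefined 1" 0] psi_upper[of 0 "axis undefined 1"] by (simp add: norm_axis_1)
    have Lp: "L > 0" using L l_pos by linarith
    have "\<delta> / 3 > 0" using \<delta> by simp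
    then obtain d where d: "d > 0" "\<And>q. dist q (x, u) < d \<Longrightarrow> dist (case q of (x, \<xi>) \<Rightarrow> \<psi> x \<xi>) (\<psi> x u) < \<delta> / 3"
      using psi_cont[unfolded continuous_on_iff, rule_format, of "(x, u)" "\<delta> / 3"] by auto
    \<comment> \<open>Three requirements: continuity of \<psi> at \<open>(x, u)\<close>, the
      distance \<open>e0\<close>, and a change of at most \<open>\<delta> / 3\<close> in the product
      with \<open>p j\<close>, whose length is at most L.\<close>
    define r where "r = min d (min e0 (\<delta> / (3 * L)))"
    have r: "r > 0" using d e0 \<delta> Lp by (simp add: r_def)
    have "open (ball (x, u) r)" "ball (x, u) r \<noteq> {}" using r by auto
    from D(2)[OF this] obtain q where q: "q \<in> D" "dist (x, u) q < r" by auto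
    obtain j where j: "from_nat_into D j = q" using from_nat_into_surj[OF D(1) q(1)] by blast
    have q': "q = (y j, z j)" using j by (simp add: y_def z_def)
    have dx: "dist x (y j) < r" using q(2) dist_fst_le[of "(x, u)" q] q' by simp
    have du: "dist u (z j) < r" using q(2) dist_snd_le[of "(x, u)" q] q' by simp
    have "dist q (x, u) < d" using q(2) by (simp add: r_def dist_commute)
    from d(2)[OF this] have "\<bar>\<psi> (y j) (z j) - \<psi> x u\<bar> < \<delta> / 3" unfolding q' by (simp add: dist_real_def)
    then have 1: "\<psi> x u - \<delta> / 3 \<le> \<psi> (y j) (z j)" by linarith
    have 2: "p j \<bullet> (z j - u) \<le> \<delta> / 3"
    proof -
      have "p j \<bullet> (z j - u) \<le> L * norm (z j - u)" using p(1)[of j "z j - u"] psi_upper[of "y j" "z j - u"] by linarith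
      also have "\<dots> \<le> L * (\<delta> / (3 * L))"
        using du Lp by (intro mult_left_mono) (auto simp: r_def dist_norm norm_minus_commute)
      also have "\<dots> = \<delta> / 3" using Lp by simp
      finally show ?thesis .
    qed
    have "\<psi> x u - \<delta> \<le> p j \<bullet> u" using 1 2 p(2)[of j] by (simp add: inner_diff_right)
    then have "norm \<xi> * (\<psi> x u - \<delta>) \<le> norm \<xi> * (p j \<bullet> u)" by (intro mult_left_mono) auto
    moreover have "\<psi> x \<xi> = norm \<xi> * \<psi> x u" using u psi_scaleR_nonneg[of "norm \<xi>" x u] by simp
    moreover have "p j \<bullet> \<xi> = norm \<xi> * (p j \<bullet> u)" by (subst u) simp
    ultimately have "\<psi> x \<xi> - \<delta> * norm \<xi> \<le> p j \<bullet> \<xi>" by (simp add: right_diff_distrib mult.commute)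
    moreover have "dist x (y j) < e0" using dx by (simp add: r_def)
    ultimately show "\<exists>j. dist x (y j) < e0 \<and> \<psi> x \<xi> - \<delta> * norm \<xi> \<le> p j \<bullet> \<xi>" by blast
  qed
qed

text \<open>Up to a set of small total variation, \<open>\<Omega>\<close> is a finite union of separated compact sets on each
  of which one constant vector nearly attains \<open>\<psi> x (\<nu> x)\<close>, where \<open>\<nu>\<close> is the density of the
  derivative. The mollified piecewise constant field is the required competitor.\<close>

lemma energy_le_V_aux:
  assumes v: "v \<in> borel_measurable (lebesgue_on \<Omega>)" "\<exists>\<mu>. has_distr_deriv \<Omega> v \<mu>" and w: "L1_on \<Omega> w"
    and ae: "AE x in lborel. x \<in> \<Omega> \<longrightarrow> v x = w x" and M: "0 \<le> M" "V w \<le> ennreal M"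
    and \<delta>: "0 < \<delta>"
  shows "energy \<psi> \<Omega> v \<le> (1 + \<delta>)\<^sup>2 * M + \<delta> * (LINT x|var_deriv \<Omega> v. norm (vec_RN_deriv (var_deriv \<Omega> v) (distr_deriv \<Omega> v) x))
    + (L + (1 + \<delta>)\<^sup>2 * L) * \<delta>"
proof -
  define \<mu> where "\<mu> = distr_deriv \<Omega> v"
  define \<tau> where "\<tau> = total_variation (borel_on \<Omega>) \<mu>"
  define \<nu> where "\<nu> = vec_RN_deriv \<tau> \<mu>"
  have \<mu>: "has_distr_deriv \<Omega> v \<mu>" unfolding \<mu>_def by (rule BV_distr_deriv[OF v(2)])
  then have vm: "vector_measure (borel_on \<Omega>) \<mu>" by (simp add: has_distr_deriv_def)
  have s\<tau>: "sets \<tau> = sets (borel_on \<Omega>)" by (simp add: \<tau>_def)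
  have sp\<tau>: "space \<tau> = \<Omega>" by (simp add: \<tau>_def space_restrict_space)
  have \<nu>: "integrable \<tau> \<nu>" unfolding \<nu>_def \<tau>_def by (rule vec_RN_deriv_total_variation[OF vm])
  then have \<nu>m [measurable]: "\<nu> \<in> borel_measurable \<tau>" by simp
  have \<psi>m [measurable]: "(\<lambda>x. \<psi> x (\<nu> x)) \<in> borel_measurable \<tau>" by (rule psi_measurable[OF s\<tau> \<nu>m])
  have \<psi>i: "integrable \<tau> (\<lambda>x. \<psi> x (\<nu> x))" by (rule psi_integrable[OF s\<tau> \<nu>])
  have idm [measurable]: "(\<lambda>x. x) \<in> borel_measurable \<tau>"
    unfolding measurable_cong_sets[OF s\<tau> refl] by (rule continuous_measurable_restrict[OF continuous_on_id])
  have L0: "L \<ge> 0" using psi_lower[of "axis undefined 1" 0] psi_upper[of 0 "axis undefined 1"] l_pos by (simp add: norm_axis_1)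
  obtain e0 where e0: "e0 > 0" "\<And>x y \<xi>. x \<in> \<Omega> \<Longrightarrow> dist x y < e0 \<Longrightarrow> \<psi> y \<xi> \<le> (1 + \<delta>) * \<psi> x \<xi>"
    using psi_uniform[OF \<delta>] by blast
  obtain p y :: "nat \<Rightarrow> real^'n" where p: "\<And>j \<xi>. p j \<bullet> \<xi> \<le> \<psi> (y j) \<xi>"
    and cover: "\<And>x \<xi>. \<exists>j. dist x (y j) < e0 \<and> \<psi> x \<xi> - \<delta> * norm \<xi> \<le> p j \<bullet> \<xi>"
    by (rule support_cover[OF e0(1) \<delta>], rule that) assumption+
  \<comment> \<open>On these sets \<open>p j\<close> is nearly optimal and, up to a factor,
    admissible. Making them disjoint selects one index j per point measurably.\<close>
  define B where "B j = {x\<in>space \<tau>. dist x (y j) < e0 \<and> \<psi> x (\<nu> x) - \<delta> * norm (\<nu> x) \<le> p j \<bullet> \<nu> x}" for j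
  have B: "B j \<in> sets \<tau>" for j unfolding B_def by measurable
  have UB: "(\<Union>j. B j) = \<Omega>" using cover by (auto simp: B_def sp\<tau>)
  define D where "D = disjointed B"
  have D\<tau>: "D j \<in> sets \<tau>" for j
    using sets.range_disjointed_sets[of B \<tau>] B by (auto simp: D_def)
  have Db: "D j \<in> sets borel" for j
    using D\<tau>[of j] open_dom by (simp add: s\<tau> sets_restrict_space_iff)
  have DB: "D j \<subseteq> B j" for j unfolding D_def by (rule disjointed_subset)
  have Dd: "disjoint_family D" unfolding D_def by (rule disjoint_family_disjointed)
  have UD: "(\<Union>j. D j) = \<Omega>" unfolding D_def UN_disjointed_eq by (rule UB)
  \<comment> \<open>The measure with density \<open>norm \<nu>\<close> with respect to \<tau>, moved
    to the Borel sets of the whole space, where approximation by compact sets is available.\<close>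
  define m where "m = distr (density \<tau> (\<lambda>x. ennreal (norm (\<nu> x)))) borel (\<lambda>x. x)"
  have idm' [measurable]: "(\<lambda>x. x) \<in> density \<tau> (\<lambda>x. ennreal (norm (\<nu> x))) \<rightarrow>\<^sub>M borel" using idm by simp
  have sm: "sets m = sets borel" by (simp add: m_def)
  have emm: "emeasure m A = ennreal (LINT x|\<tau>. indicator A x * norm (\<nu> x))" if A: "A \<in> sets borel" for A
  proof -
    have A\<tau>: "A \<inter> \<Omega> \<in> sets \<tau>" using A open_dom by (simp add: s\<tau> sets_restrict_space_iff)
    have im: "(\<lambda>x. indicat_real A x) \<in> borel_measurable \<tau>"
      using measurable_compose[OF idm borel_measurable_indicator[OF A]] by simp
    have ii: "integrable \<tau> (\<lambda>x. indicator A x * norm (\<nu> x))"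
      using \<nu> im by (intro integrable_mult_bounded[of _ _ _ 1]) (auto simp: indicator_def)
    have "emeasure m A = emeasure (density \<tau> (\<lambda>x. ennreal (norm (\<nu> x)))) (A \<inter> \<Omega>)"
      unfolding m_def using A by (subst emeasure_distr) (auto simp: sp\<tau>)
    also have "\<dots> = (\<integral>\<^sup>+x. ennreal (norm (\<nu> x)) * indicator (A \<inter> \<Omega>) x \<partial>\<tau>)"
      using A\<tau> by (subst emeasure_density) auto
    also have "\<dots> = (\<integral>\<^sup>+x. ennreal (indicator A x * norm (\<nu> x)) \<partial>\<tau>)"
      by (intro nn_integral_cong) (auto simp: sp\<tau> indicator_def)
    also have "\<dots> = ennreal (LINT x|\<tau>. indicator A x * norm (\<nu> x))"
      using ii by (intro nn_integral_eq_integral) auto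
    finally show ?thesis .
  qed
  have fm: "finite_measure m" by (intro finite_measureI) (simp add: sets_eq_imp_space_eq[OF sm] emm)
  interpret m: finite_measure m by fact
  have mm: "measure m A = (LINT x|\<tau>. indicator A x * norm (\<nu> x))" if A: "A \<in> sets borel" for A
    unfolding measure_def emm[OF A] by (intro enn2real_ennreal Bochner_Integration.integral_nonneg) auto
  have "(\<lambda>j. measure m (D j)) sums measure m (\<Union>j. D j)"
    using Dd Db by (intro m.finite_measure_UNION) (auto simp: sm)
  then have "(\<lambda>N. \<Sum>j<N. measure m (D j)) \<longlonglongrightarrow> measure m \<Omega>" by (simp add: sums_def UD)
  moreover have "measure m \<Omega> - \<delta> / 2 < measure m \<Omega>" using \<delta> by simp
  ultimately have "\<forall>\<^sub>F N in sequentially. measure m \<Omega> - \<delta> / 2 < (\<Sum>j<N. measure m (D j))" by (rule order_tendstoD)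
  then obtain N where N: "measure m \<Omega> - \<delta> / 2 < (\<Sum>j<N. measure m (D j))" by (auto simp: eventually_sequentially)
  \<comment> \<open>Keeping finitely many pieces has cost \<open>\<delta> / 2\<close>; their
    replacement by compact subsets may cost another \<open>\<delta> / 2\<close> in total.\<close>
  have e': "\<delta> / (2 * (real N + 1)) > 0" using \<delta> by (intro divide_pos_pos) auto
  have "\<exists>K. K \<subseteq> D j \<and> compact K \<and> measure m (D j) - \<delta> / (2 * (real N + 1)) < measure m K" for j
    using inner_compact_approx[OF fm sm Db e'] by metis
  then obtain K where K: "\<And>j. K j \<subseteq> D j" "\<And>j. compact (K j)" "\<And>j. measure m (D j) - \<delta> / (2 * (real N + 1)) < measure m (K j)" by metis
  have Kb: "K j \<in> sets borel" for j using K(2) by (auto simp: compact_imp_closed)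
  define KK where "KK = (\<Union>j<N. K j)"
  have KKc: "compact KK" unfolding KK_def using K(2) by (intro compact_UN) auto
  have KK\<Omega>: "KK \<subseteq> \<Omega>" unfolding KK_def using K(1) UD by blast
  have KKb: "KK \<in> sets borel" using KKc by (auto simp: compact_imp_closed)
  have Kdisj: "K i \<inter> K j = {}" if "i \<noteq> j" for i j
  proof -
    have "D i \<inter> D j = {}" using Dd that by (simp add: disjoint_family_on_def)
    then show ?thesis using K(1)[of i] K(1)[of j] by blast
  qed
  have KK1: "measure m KK = (\<Sum>j<N. measure m (K j))"
    unfolding KK_def using Kb Kdisj by (intro m.finite_measure_finite_Union) (auto simp: sm disjoint_family_on_def)
  have KK2: "(\<Sum>j<N. measure m (K j)) \<ge> (\<Sum>j<N. measure m (D j) - \<delta> / (2 * (real N + 1)))" using K(3) by (intro sum_mono less_imp_le)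
  have KK3: "(\<Sum>j<N. measure m (D j) - \<delta> / (2 * (real N + 1))) = (\<Sum>j<N. measure m (D j)) - real N * (\<delta> / (2 * (real N + 1)))"
    by (simp add: sum_subtractf)
  have KK4: "real N * (\<delta> / (2 * (real N + 1))) \<le> \<delta> / 2"
  proof -
    have "real N * (\<delta> / (2 * (real N + 1))) = \<delta> / 2 * (real N / (real N + 1))" by simp
    also have "\<dots> \<le> \<delta> / 2 * 1" using \<delta> by (intro mult_left_mono) auto
    finally show ?thesis by simp
  qed
  have KKm: "measure m KK > measure m \<Omega> - \<delta>" using N KK1 KK2 KK3 KK4 by linarith
  have rest: "measure m (\<Omega> - KK) < \<delta>"
    using KKm KK\<Omega> KKb m.finite_measure_Diff[of \<Omega> KK] open_dom by (simp add: sm)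
  obtain d where d: "d > 0" "\<And>i j x y. i < N \<Longrightarrow> j < N \<Longrightarrow> i \<noteq> j \<Longrightarrow> x \<in> K i \<Longrightarrow> y \<in> K j \<Longrightarrow> d \<le> dist x y"
    using disjoint_compacts_separated[of N K] K(2) Kdisj by metis
  obtain dm where dm: "dm > 0" "\<And>x. x \<in> KK \<Longrightarrow> cball x dm \<subseteq> \<Omega>" using compact_margin[OF KKc KK\<Omega> open_dom] by blast
  \<comment> \<open>\<open>4 * e < d\<close> keeps the \<open>2 * e\<close>-neighbourhoods of
    different \<open>K j\<close> apart. \<open>3 * e \<le> dm\<close> keeps the e-balls around their
    points in \<Omega>. \<open>3 * e < e0\<close> allows the comparison of \<psi> at x with \<psi>
    at a point of \<open>K j\<close> reached through such a neighbourhood.\<close>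
  define e where "e = min (d / 5) (min (dm / 3) (e0 / 4))"
  have e: "e > 0" "4 * e < d" "3 * e \<le> dm" "3 * e < e0" using d(1) dm(1) e0(1) by (auto simp: e_def)
  \<comment> \<open>The neighbourhood contains the e-ball around each point of \<open>K j\<close>,
    so the field is constant on that ball and mollification returns exactly \<open>p j\<close> on
    \<open>K j\<close>.\<close>
  define Nb where "Nb j = {x + z |x z. x \<in> K j \<and> z \<in> cball (0::real^'n) (2 * e)}" for j
  have Nbc: "compact (Nb j)" for j unfolding Nb_def using K(2) by (intro compact_sums) auto
  have Nbb [measurable]: "Nb j \<in> sets borel" for j using Nbc by (auto simp: compact_imp_closed)
  have Nb_near: "\<exists>z\<in>K j. dist x z \<le> 2 * e" if "x \<in> Nb j" for x j
  proof -
    obtain a z where "x = a + z" "a \<in> K j" "z \<in> cball 0 (2 * e)" using \<open>x \<in> Nb j\<close> unfolding Nb_def by blast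
    then show ?thesis by (intro bexI[of _ a]) (auto simp: dist_norm)
  qed
  have Nb_mem: "x \<in> Nb j" if "z \<in> K j" "dist x z \<le> 2 * e" for x z j
  proof -
    have "x = z + (x - z)" "x - z \<in> cball 0 (2 * e)" using that by (auto simp: dist_norm norm_minus_commute)
    with that(1) show ?thesis unfolding Nb_def by blast
  qed
  have Nb_disj: "i = j" if "i < N" "j < N" "x \<in> Nb i" "x \<in> Nb j" for i j x
  proof (rule ccontr)
    assume "i \<noteq> j"
    obtain a b where "a \<in> K i" "dist x a \<le> 2 * e" "b \<in> K j" "dist x b \<le> 2 * e" using Nb_near[OF \<open>x \<in> Nb i\<close>] Nb_near[OF \<open>x \<in> Nb j\<close>] by blast
    then show False using d(2)[OF that(1,2) \<open>i \<noteq> j\<close>, of a b] e(2) dist_triangle3[of a b x] by linarith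
  qed
  define NN where "NN = (\<Union>j<N. Nb j)"
  have NNc: "compact NN" unfolding NN_def using Nbc by (intro compact_UN) auto
  have NN\<Omega>: "cball x e \<subseteq> \<Omega>" if "x \<in> NN" for x
  proof -
    obtain j z where "j < N" "z \<in> K j" "dist x z \<le> 2 * e" using \<open>x \<in> NN\<close> Nb_near unfolding NN_def by blast
    then have "z \<in> KK" by (auto simp: KK_def)
    moreover have "cball x e \<subseteq> cball z dm"
    proof
      fix q assume "q \<in> cball x e"
      then show "q \<in> cball z dm" using \<open>dist x z \<le> 2 * e\<close> e(3) dist_triangle[of z q x] by (simp add: dist_commute)
    qed
    ultimately show ?thesis using dm(2) by blast
  qed
  define \<Theta> where "\<Theta> x = (\<Sum>j<N. indicator (Nb j) x *\<^sub>R p j)" for x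
  have \<Theta>_eq: "\<Theta> x = p j" if "j < N" "x \<in> Nb j" for x j
  proof -
    have "\<Theta> x = (\<Sum>i<N. if i = j then p i else 0)"
      unfolding \<Theta>_def
    proof (intro sum.cong refl)
      fix i assume "i \<in> {..<N}"
      then show "indicator (Nb i) x *\<^sub>R p i = (if i = j then p i else 0)"
        using Nb_disj[of i j x] that by (cases "i = j"; cases "x \<in> Nb i") auto
    qed
    then show ?thesis using that(1) by simp
  qed
  have \<Theta>_0: "\<Theta> x = 0" if "x \<notin> NN" for x
  proof -
    have "x \<notin> Nb j" if "j < N" for j using \<open>x \<notin> NN\<close> that by (auto simp: NN_def)
    then show ?thesis unfolding \<Theta>_def by (intro sum.neutral) simp
  qed
  have \<Theta>_i: "integrable lborel (\<lambda>x. \<Theta> x $ i)" for i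
  proof -
    have "integrable lborel (indicat_real (Nb j))" for j using emeasure_compact_finite[OF Nbc] by simp
    then show ?thesis unfolding \<Theta>_def sum_component vector_scaleR_component real_scaleR_def
      by (intro Bochner_Integration.integrable_sum integrable_mult_left)
  qed
  \<comment> \<open>One factor \<open>1 + \<delta>\<close> leads from \<open>y j\<close> to a point
    of \<open>K j\<close>, a second one from there to x.\<close>
  define c where "c = (1 + \<delta>)\<^sup>2"
  have c: "c > 0" using \<delta> by (simp add: c_def)
  have le: "\<Theta> q \<bullet> \<xi> \<le> c * \<psi> x \<xi>" if x: "x \<in> \<Omega>" "dist x q < e" for x q \<xi>
  proof (cases "q \<in> NN")
    case True
    then obtain j where j: "j < N" "q \<in> Nb j" unfolding NN_def by blast
    obtain z where z: "z \<in> K j" "dist q z \<le> 2 * e" using Nb_near[OF j(2)] by blast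
    have "z \<in> B j" using z(1) K(1) DB by blast
    then have z': "z \<in> \<Omega>" "dist z (y j) < e0" by (auto simp: B_def sp\<tau>)
    have "dist x z < e0" using dist_triangle[of x z q] x(2) z(2) e(4) by linarith
    have "\<Theta> q \<bullet> \<xi> \<le> \<psi> (y j) \<xi>" unfolding \<Theta>_eq[OF j] by (rule p)
    also have "\<dots> \<le> (1 + \<delta>) * \<psi> z \<xi>" by (rule e0(2)[OF z'])
    also have "\<dots> \<le> (1 + \<delta>) * ((1 + \<delta>) * \<psi> x \<xi>)" using \<delta> by (intro mult_left_mono e0(2)[OF x(1) \<open>dist x z < e0\<close>]) auto
    finally show ?thesis by (simp add: c_def power2_eq_square mult.assoc)
  next
    case False
    then show ?thesis using \<Theta>_0 c psi_nonneg[of x \<xi>] by simp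
  qed
  define \<phi> where "\<phi> x = (\<chi> i. conv (moll e) (\<lambda>x. \<Theta> x $ i) x)" for x
  have tf: "\<forall>i. test_fun \<Omega> (\<lambda>x. \<phi> x $ i)"
    unfolding \<phi>_def using test_fun_conv_moll[OF e(1) NNc NN\<Omega> \<Theta>_i] \<Theta>_0 by simp
  have "pairing w \<phi> \<le> c * M"
    using pairing_conv_moll_le[OF e(1) NNc NN\<Omega> c \<Theta>_i \<Theta>_0 le M] unfolding \<phi>_def[abs_def] .
  note pr = has_distr_deriv_pairing[OF dom_borel v(1) w ae \<mu> tf, folded \<tau>_def \<nu>_def]
  have upper: "(LINT x|\<tau>. \<phi> x \<bullet> \<nu> x) \<le> c * M" using \<open>pairing w \<phi> \<le> c * M\<close> pr(2) by simp
  have \<phi>psi: "\<phi> x \<bullet> \<xi> \<le> c * \<psi> x \<xi>" for x \<xi>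
  proof -
    have "inverse c *\<^sub>R \<phi> x \<bullet> \<xi> \<le> \<psi> x \<xi>"
      using admissible_conv_moll[OF e(1) NNc NN\<Omega> c \<Theta>_i \<Theta>_0 le] unfolding admissible_def \<phi>_def by blast
    then show ?thesis using c by (simp add: field_simps)
  qed
  have \<phi>_low: "- (c * L) * norm \<xi> \<le> \<phi> x \<bullet> \<xi>" for x \<xi>
  proof -
    have "c * \<psi> x (- \<xi>) \<le> c * (L * norm (- \<xi>))" using c psi_upper[of x "- \<xi>"] by (intro mult_left_mono) auto
    with \<phi>psi[of x "- \<xi>"] show ?thesis by simp
  qed
  have \<phi>_K: "\<phi> x = p j" if "j < N" "x \<in> K j" for x j
  proof -
    have "\<Theta> q = p j" if "dist x q < e" for q :: "real^'n"
      using \<open>dist x q < e\<close> \<open>x \<in> K j\<close> e(1) by (intro \<Theta>_eq \<open>j < N\<close> Nb_mem[of x]) (auto simp: dist_commute)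
    then have "\<bar>conv (moll e) (\<lambda>x. \<Theta> x $ i) x - p j $ i\<bar> \<le> 0" for i
      by (intro conv_moll_dist_le[OF e(1) \<Theta>_i]) auto
    then show ?thesis by (simp add: \<phi>_def vec_eq_iff)
  qed
  \<comment> \<open>Off the compact pieces only the lower bound
    \<open>- (c * L) * norm \<xi>\<close> for \<open>\<phi> x \<bullet> \<xi>\<close> is known. The
    last term pays for it and for the missing \<open>\<psi> x (\<nu> x)\<close>, which is at most
    \<open>L * norm (\<nu> x)\<close>.\<close>
  define low where "low x = \<psi> x (\<nu> x) - \<delta> * norm (\<nu> x) - (L + c * L) * (indicator (\<Omega> - KK) x * norm (\<nu> x))" for x
  have Rb: "\<Omega> - KK \<in> sets borel" using KKb by simp
  have irm: "(\<lambda>x. indicat_real (\<Omega> - KK) x) \<in> borel_measurable \<tau>"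
    using measurable_compose[OF idm borel_measurable_indicator[OF Rb]] by simp
  have ir: "integrable \<tau> (\<lambda>x. indicat_real (\<Omega> - KK) x * norm (\<nu> x))"
    using \<nu> irm by (intro integrable_mult_bounded[of _ _ _ 1]) (auto simp: indicator_def)
  have pointwise: "low x \<le> \<phi> x \<bullet> \<nu> x" if "x \<in> space \<tau>" for x
  proof (cases "x \<in> KK")
    case True
    then obtain j where j: "j < N" "x \<in> K j" unfolding KK_def by blast
    then have "x \<in> B j" using K(1) DB by blast
    then show ?thesis using True \<phi>_K[OF j] by (simp add: low_def B_def)
  next
    case False
    then have "low x = \<psi> x (\<nu> x) - \<delta> * norm (\<nu> x) - (L + c * L) * norm (\<nu> x)"
      using that by (simp add: low_def sp\<tau>)
    also have "\<dots> \<le> L * norm (\<nu> x) - 0 - (L + c * L) * norm (\<nu> x)"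
      using psi_upper[of x "\<nu> x"] \<delta> by (intro diff_mono) auto
    also have "\<dots> = - (c * L) * norm (\<nu> x)" by (simp add: algebra_simps)
    also have "\<dots> \<le> \<phi> x \<bullet> \<nu> x" by (rule \<phi>_low)
    finally show ?thesis .
  qed
  have ni: "integrable \<tau> (\<lambda>x. norm (\<nu> x))" using \<nu> by simp
  have "(LINT x|\<tau>. low x) \<le> (LINT x|\<tau>. \<phi> x \<bullet> \<nu> x)"
    using pointwise \<psi>i ni ir pr(1) unfolding low_def by (intro integral_mono) auto
  moreover have "(LINT x|\<tau>. low x) = (LINT x|\<tau>. \<psi> x (\<nu> x)) - \<delta> * (LINT x|\<tau>. norm (\<nu> x)) - (L + c * L) * measure m (\<Omega> - KK)"
    unfolding low_def mm[OF Rb] using \<psi>i ni ir by simp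
  moreover have "(L + c * L) * measure m (\<Omega> - KK) \<le> (L + c * L) * \<delta>" using rest L0 c by (intro mult_left_mono) auto
  ultimately have "(LINT x|\<tau>. \<psi> x (\<nu> x)) \<le> c * M + \<delta> * (LINT x|\<tau>. norm (\<nu> x)) + (L + c * L) * \<delta>"
    using upper by linarith
  then show ?thesis by (simp add: energy_def var_deriv_def \<mu>_def \<tau>_def \<nu>_def c_def)
qed

text \<open>All error terms vanish as \<delta> tends to 0, because the integral that \<delta>
  multiplies is one fixed real number.\<close>

lemma energy_le_V:
  assumes v: "v \<in> borel_measurable (lebesgue_on \<Omega>)" "\<exists>\<mu>. has_distr_deriv \<Omega> v \<mu>" and w: "L1_on \<Omega> w"
    and ae: "AE x in lborel. x \<in> \<Omega> \<longrightarrow> v x = w x" and M: "0 \<le> M" "V w \<le> ennreal M"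
  shows "energy \<psi> \<Omega> v \<le> M"
proof -
  define m where "m = (LINT x|var_deriv \<Omega> v. norm (vec_RN_deriv (var_deriv \<Omega> v) (distr_deriv \<Omega> v) x))"
  define f where "f \<delta> = (1 + \<delta>)\<^sup>2 * M + \<delta> * m + (L + (1 + \<delta>)\<^sup>2 * L) * \<delta>" for \<delta> :: real
  have "(f \<longlongrightarrow> (1 + 0)\<^sup>2 * M + 0 * m + (L + (1 + 0)\<^sup>2 * L) * 0) (at_right 0)"
    unfolding f_def by (intro tendsto_intros)
  then have "(f \<longlongrightarrow> M) (at_right 0)" by simp
  moreover have "\<forall>\<^sub>F \<delta> in at_right 0. energy \<psi> \<Omega> v \<le> f \<delta>"
    using energy_le_V_aux[OF assms] unfolding f_def m_def eventually_at_right_field by (intro exI[of _ 1]) auto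
  ultimately show ?thesis by (intro tendsto_lowerbound[of f M "at_right 0"]) auto
qed

end


section \<open>Weak compactness of measures on Euclidean space\<close>

definition ternary :: "(nat \<Rightarrow> bool) \<Rightarrow> real" where
  "ternary b = (\<Sum>j. (if b j then 2 else 0) / 3 ^ Suc j)"

lemma summable_ternary: "summable (\<lambda>j. (if b j then 2 else 0 :: real) / 3 ^ Suc j)"
proof (rule summable_comparison_test')
  show "summable (\<lambda>j. 2 / 3 * (1 / 3 :: real) ^ j)" by (intro summable_mult summable_geometric) auto
  show "norm ((if b j then 2 else 0 :: real) / 3 ^ Suc j) \<le> 2 / 3 * (1 / 3) ^ j" for j by (simp add: power_one_over)
qed

lemma ternary_bounds: "0 \<le> ternary b" "ternary b \<le> 1"
proof -
  show "0 \<le> ternary b" unfolding ternary_def by (intro suminf_nonneg summable_ternary) auto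
  have s: "(\<lambda>j. 2 / 3 * (1 / 3 :: real) ^ j) sums (2 / 3 * (1 / (1 - 1 / 3)))"
    by (intro sums_mult geometric_sums) auto
  have "ternary b \<le> (\<Sum>j. 2 / 3 * (1 / 3 :: real) ^ j)" unfolding ternary_def
    by (intro suminf_le summable_ternary sums_summable[OF s]) (simp add: power_one_over)
  also have "\<dots> = 1" using sums_unique[OF s] by simp
  finally show "ternary b \<le> 1" .
qed

lemma ternary_shift: "3 * ternary b = (if b 0 then 2 else 0) + ternary (\<lambda>j. b (Suc j))"
proof -
  have "ternary b = (if b 0 then 2 else 0) / 3 + (\<Sum>j. (if b (Suc j) then 2 else 0 :: real) / 3 ^ Suc (Suc j))"
    unfolding ternary_def using suminf_split_head[OF summable_ternary[of b]] by simp
  also have "(\<Sum>j. (if b (Suc j) then 2 else 0 :: real) / 3 ^ Suc (Suc j)) = (1 / 3) * ternary (\<lambda>j. b (Suc j))"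
    unfolding ternary_def by (subst suminf_mult[OF summable_ternary, symmetric]) simp
  finally show ?thesis by simp
qed

text \<open>Multiplication by \<open>3 ^ m\<close> shifts the digits. What moves in front of the
  point is an even integer, all digits being 0 or 2, and is therefore invisible to a function of
  period 2.\<close>

lemma ternary_shift_power: "\<exists>E::int. 3 ^ m * ternary b = 2 * real_of_int E + ternary (\<lambda>j. b (m + j))"
proof (induction m)
  case 0 show ?case by (intro exI[of _ 0]) simp
next
  case (Suc m)
  then obtain E :: int where E: "3 ^ m * ternary b = 2 * real_of_int E + ternary (\<lambda>j. b (m + j))" by blast
  have "3 ^ Suc m * ternary b = 3 * (2 * real_of_int E) + 3 * ternary (\<lambda>j. b (m + j))" using E by simp
  also have "\<dots> = 2 * real_of_int (3 * E + (if b m then 1 else 0)) + ternary (\<lambda>j. b (Suc m + j))"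
    using ternary_shift[of "\<lambda>j. b (m + j)"] by simp
  finally show ?case by blast
qed

text \<open>A continuous function of period 2, equal to 0 on \<open>[0, 1/3]\<close> and to 1 on
  \<open>[2/3, 1]\<close>. These two intervals contain the points of the Cantor set with first
  ternary digit 0 and 2.\<close>

definition schoenberg_wave :: "real \<Rightarrow> real" where
  "schoenberg_wave t = max 0 (min 1 (1 / 2 - cos (pi * t)))"

lemma schoenberg_wave_bounds: "0 \<le> schoenberg_wave t" "schoenberg_wave t \<le> 1"
  by (auto simp: schoenberg_wave_def)

lemma schoenberg_wave_ternary: "schoenberg_wave (3 ^ m * ternary b) = (if b m then 1 else 0)"
proof -
  obtain E :: int where E: "3 ^ m * ternary b = 2 * real_of_int E + ternary (\<lambda>j. b (m + j))"
    using ternary_shift_power by blast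
  define r where "r = ternary (\<lambda>j. b (m + j))"
  have "cos (pi * (3 ^ m * ternary b)) = cos (pi * r + 2 * pi * real_of_int E)"
    unfolding E r_def by (simp add: algebra_simps)
  also have "\<dots> = cos (pi * r)" by (simp add: cos_add)
  finally have c: "cos (pi * (3 ^ m * ternary b)) = cos (pi * r)" .
  have r: "3 * r = (if b m then 2 else 0) + ternary (\<lambda>j. b (m + Suc j))"
    using ternary_shift[of "\<lambda>j. b (m + j)"] by (simp add: r_def)
  note tb = ternary_bounds[of "\<lambda>j. b (m + Suc j)"]
  show ?thesis
  proof (cases "b m")
    case True
    have "2 / 3 \<le> r" "r \<le> 1" using r tb True by auto
    then have "pi * (2 / 3) \<le> pi * r" "pi * r \<le> pi * 1" by (intro mult_left_mono; simp)+
    then have "cos (pi * r) \<le> cos (pi * (2 / 3))" by (intro cos_monotone_0_pi_le) auto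
    also have "cos (pi * (2 / 3)) = - (1 / 2)" using cos_120 by (simp add: mult.commute)
    finally show ?thesis using True c by (simp add: schoenberg_wave_def)
  next
    case False
    have "0 \<le> r" "r \<le> 1 / 3" using r tb False by auto
    then have "0 \<le> pi * r" "pi * r \<le> pi * (1 / 3)" by (simp, intro mult_left_mono) auto
    then have "cos (pi * (1 / 3)) \<le> cos (pi * r)" by (intro cos_monotone_0_pi_le) auto
    moreover have "cos (pi * (1 / 3)) = 1 / 2" using cos_60 by simp
    ultimately show ?thesis using False c by (simp add: schoenberg_wave_def)
  qed
qed

text \<open>The partial sums telescope to the integer part of \<open>2 ^ m * y\<close> divided by
  \<open>2 ^ m\<close>. For \<open>y < 1\<close> this starts at 0, which is why the curve is only
  shown to cover the half-open cube.\<close>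

lemma binary_digits:
  assumes "0 \<le> y" "y < (1::real)"
  shows "(\<lambda>k. (if odd \<lfloor>2 ^ Suc k * y\<rfloor> then 1 else 0) / 2 ^ Suc k) sums y"
proof -
  define F where "F m = \<lfloor>2 ^ m * y\<rfloor>" for m
  have step: "(if odd (F (Suc k)) then 1 else 0 :: real) = real_of_int (F (Suc k)) - 2 * real_of_int (F k)" for k
  proof -
    have "real_of_int (F k) \<le> 2 ^ k * y" "2 ^ k * y < real_of_int (F k) + 1" by (simp_all add: F_def)
    then have "real_of_int (2 * F k) \<le> 2 ^ Suc k * y" "2 ^ Suc k * y < real_of_int (2 * F k) + 2" by simp_all
    then have "2 * F k \<le> F (Suc k)" "F (Suc k) < 2 * F k + 2" unfolding F_def by linarith+
    then have "F (Suc k) = 2 * F k \<or> F (Suc k) = 2 * F k + 1" by linarith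
    then show ?thesis by auto
  qed
  have part: "(\<Sum>k<m. (if odd (F (Suc k)) then 1 else 0) / 2 ^ Suc k) = real_of_int (F m) / 2 ^ m" for m
  proof (induction m)
    case 0
    have "F 0 = 0" using assms by (simp add: F_def floor_eq_iff)
    then show ?case by simp
  next
    case (Suc m)
    then show ?case unfolding sum.lessThan_Suc Suc step by (simp add: field_simps)
  qed
  have "(\<lambda>m. real_of_int (F m) / 2 ^ m) \<longlonglongrightarrow> y"
  proof (rule tendsto_sandwich[of "\<lambda>m. y - (1 / 2) ^ m" _ _ "\<lambda>_. y"])
    show "\<forall>\<^sub>F m in sequentially. y - (1 / 2) ^ m \<le> real_of_int (F m) / 2 ^ m"
    proof (intro always_eventually allI)
      fix m
      have "2 ^ m * y - 1 \<le> real_of_int (F m)" unfolding F_def by linarith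
      then have "(2 ^ m * y - 1) / 2 ^ m \<le> real_of_int (F m) / 2 ^ m" by (intro divide_right_mono) auto
      then show "y - (1 / 2) ^ m \<le> real_of_int (F m) / 2 ^ m" by (simp add: diff_divide_distrib power_one_over)
    qed
    show "\<forall>\<^sub>F m in sequentially. real_of_int (F m) / 2 ^ m \<le> y"
      by (intro always_eventually allI) (simp add: F_def field_simps)
    have "(\<lambda>m. y - (1 / 2 :: real) ^ m) \<longlonglongrightarrow> y - 0" by (intro tendsto_intros LIMSEQ_power_zero) auto
    then show "(\<lambda>m. y - (1 / 2 :: real) ^ m) \<longlonglongrightarrow> y" by simp
  qed auto
  then have "(\<lambda>m. \<Sum>k<m. (if odd (F (Suc k)) then 1 else 0) / 2 ^ Suc k) \<longlonglongrightarrow> y" by (simp only: part)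
  then show ?thesis unfolding sums_def F_def .
qed

text \<open>Schoenberg's curve: the binary digits of the coordinates are read off the ternary digits of a
  point of the Cantor set.\<close>

lemma space_filling_curve:
  obtains f :: "real \<Rightarrow> real^'n::finite" where "continuous_on UNIV f"
    "{x. \<forall>i. 0 \<le> x $ i \<and> x $ i < 1} \<subseteq> f ` {0..1}" "\<And>t i. 0 \<le> f t $ i \<and> f t $ i \<le> 1"
proof -
  define N where "N = CARD('n)"
  have N: "N > 0" by (simp add: N_def)
  obtain h :: "'n \<Rightarrow> nat" where h: "bij_betw h UNIV {..<N}"
    using ex_bij_betw_finite_nat[of "UNIV :: 'n set"] by (auto simp: N_def atLeast0LessThan)
  \<comment> \<open>Coordinate i reads the digits whose index is congruent to \<open>h i\<close>
    modulo N, so that one digit sequence carries all coordinates interleaved.\<close>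
  define q where "q i k t = (1 / 2) ^ Suc k * schoenberg_wave (3 ^ (N * k + h i) * t)" for i k t
  define f where "f t = (\<chi> i. \<Sum>k. q i k t)" for t
  have qb: "0 \<le> q i k t" "q i k t \<le> (1 / 2) ^ Suc k" for i k t
    using schoenberg_wave_bounds by (auto simp: q_def intro: mult_left_le)
  have hs: "(\<lambda>k. (1 / 2 :: real) ^ Suc k) sums 1" by (rule power_half_series)
  have qs: "summable (\<lambda>k. q i k t)" for i t
    by (rule summable_comparison_test'[OF sums_summable[OF hs]]) (use qb in \<open>auto simp: abs_of_nonneg\<close>)
  have qc: "continuous_on UNIV (q i k)" for i k
    unfolding q_def schoenberg_wave_def by (intro continuous_intros)
  have cont: "continuous_on UNIV (\<lambda>t. \<Sum>k. q i k t)" for i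
  proof (rule uniform_limit_theorem)
    show "uniform_limit UNIV (\<lambda>n t. \<Sum>k<n. q i k t) (\<lambda>t. \<Sum>k. q i k t) sequentially"
      by (rule Weierstrass_m_test[OF _ sums_summable[OF hs]]) (use qb in \<open>auto simp: abs_of_nonneg\<close>)
    show "\<forall>\<^sub>F n in sequentially. continuous_on UNIV (\<lambda>t. \<Sum>k<n. q i k t)"
      using qc by (intro always_eventually allI continuous_on_sum) auto
  qed auto
  show ?thesis
  proof (rule that[of f])
    show "continuous_on UNIV f" unfolding f_def by (intro continuous_on_vec_lambda cont)
    show "0 \<le> f t $ i \<and> f t $ i \<le> 1" for t i
    proof
      show "0 \<le> f t $ i" using qb qs by (simp add: f_def suminf_nonneg)
      have "(\<Sum>k. q i k t) \<le> (\<Sum>k. (1 / 2 :: real) ^ Suc k)" by (intro suminf_le qb qs sums_summable[OF hs])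
      then show "f t $ i \<le> 1" using sums_unique[OF hs] by (simp add: f_def)
    qed
    show "{x. \<forall>i. 0 \<le> x $ i \<and> x $ i < 1} \<subseteq> f ` {0..1}"
    proof
      fix x :: "real^'n" assume "x \<in> {x. \<forall>i. 0 \<le> x $ i \<and> x $ i < 1}"
      then have x: "0 \<le> x $ i" "x $ i < 1" for i by auto
      define b where "b m = odd \<lfloor>2 ^ Suc (m div N) * x $ (the_inv_into UNIV h (m mod N))\<rfloor>" for m
      have bi: "b (N * k + h i) = odd \<lfloor>2 ^ Suc k * x $ i\<rfloor>" for k i
      proof -
        have "h i < N" using h by (auto simp: bij_betw_def)
        then have "(N * k + h i) div N = k" "(N * k + h i) mod N = h i" using N by simp_all
        moreover have "the_inv_into UNIV h (h i) = i" using h by (simp add: bij_betw_def the_inv_into_f_f)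
        ultimately show ?thesis by (simp add: b_def)
      qed
      have "f (ternary b) $ i = x $ i" for i
      proof -
        have "(\<lambda>k. q i k (ternary b)) sums (x $ i)"
          using binary_digits[OF x[of i]] by (simp add: q_def schoenberg_wave_ternary bi power_one_over)
        then show ?thesis by (simp add: f_def sums_iff)
      qed
      then have "f (ternary b) = x" by (simp add: vec_eq_iff)
      then show "x \<in> f ` {0..1}" using ternary_bounds[of b] by (intro image_eqI[of _ _ "ternary b"]) auto
    qed
  qed
qed

text \<open>The section picks the smallest parameter in \<open>{0..1}\<close>. On the image of the
  curve its sublevel sets are images of compact sets, hence closed, and this makes it Borel; off the
  image it takes the value 0.\<close>

lemma curve_section:
  fixes f :: "real \<Rightarrow> 'a::euclidean_space"
  assumes f: "continuous_on UNIV f"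
  obtains g where "g \<in> borel_measurable borel" "\<And>x. x \<in> f ` {0..1} \<Longrightarrow> f (g x) = x" "\<And>x. 0 \<le> g x \<and> g x \<le> 1"
proof -
  define S where "S x = {t \<in> {0..1}. f t = x}" for x
  define g where "g x = (if x \<in> f ` {0..1} then Inf (S x) else 0)" for x
  have mem: "Inf (S x) \<in> S x" if "x \<in> f ` {0..1}" for x
  proof (rule closed_contains_Inf)
    show "S x \<noteq> {}" using that by (auto simp: S_def)
    show "bdd_below (S x)" by (rule bdd_belowI[of _ 0]) (auto simp: S_def)
    have "S x = {0..1} \<inter> f -` {x}" by (auto simp: S_def)
    then show "closed (S x)" using continuous_closed_preimage[OF continuous_on_subset[OF f], of "{0..1}" "{x}"] by auto
  qed
  have low: "Inf (S x) \<le> t" if "t \<in> S x" for x t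
    using that by (intro cInf_lower bdd_belowI[of _ 0]) (auto simp: S_def)
  have compact_image: "compact (f ` ({0..1} \<inter> {..a}))" for a
    using f by (intro compact_continuous_image) (auto intro: continuous_on_subset compact_Int_closed)
  have "g \<in> borel_measurable borel"
  proof (rule borel_measurableI_le)
    fix a
    have "{x \<in> space borel. g x \<le> a} = f ` ({0..1} \<inter> {..a}) \<union> (if 0 \<le> a then - (f ` {0..1}) else {})"
    proof (intro set_eqI iffI)
      fix x assume "x \<in> {x \<in> space borel. g x \<le> a}"
      then have ga: "g x \<le> a" by simp
      show "x \<in> f ` ({0..1} \<inter> {..a}) \<union> (if 0 \<le> a then - (f ` {0..1}) else {})"
      proof (cases "x \<in> f ` {0..1}")
        case True
        then have "f (Inf (S x)) = x" "Inf (S x) \<in> {0..1} \<inter> {..a}" using mem[OF True] ga by (auto simp: S_def g_def)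
        then have "x \<in> f ` ({0..1} \<inter> {..a})" by (metis imageI)
        then show ?thesis by blast
      next
        case False then show ?thesis using ga by (auto simp: g_def)
      qed
    next
      fix x assume x: "x \<in> f ` ({0..1} \<inter> {..a}) \<union> (if 0 \<le> a then - (f ` {0..1}) else {})"
      show "x \<in> {x \<in> space borel. g x \<le> a}"
      proof (cases "x \<in> f ` {0..1}")
        case True
        then have "x \<in> f ` ({0..1} \<inter> {..a})" using x by (auto split: if_splits)
        then obtain t where "t \<in> S x" "t \<le> a" by (auto simp: S_def)
        then show ?thesis using low[of t x] True by (simp add: g_def)
      next
        case False
        then have "0 \<le> a" using x by (auto split: if_splits)
        with False show ?thesis by (simp add: g_def)
      qed
    qed
    moreover have "f ` ({0..1} \<inter> {..a}) \<in> sets borel" for a using compact_image[of a] by (intro borel_closed compact_imp_closed)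
    moreover have "f ` {0..1} \<in> sets borel"
    proof -
      have "{0..1} \<inter> {..1} = {0..1::real}" by auto
      then show ?thesis using calculation(2)[of 1] by simp
    qed
    ultimately show "{x \<in> space borel. g x \<le> a} \<in> sets borel" by (auto simp del: space_borel)
  qed
  moreover have "f (g x) = x" if "x \<in> f ` {0..1}" for x using mem[OF that] that by (simp add: g_def S_def)
  moreover have "0 \<le> g x \<and> g x \<le> 1" for x using mem[of x] by (auto simp: g_def S_def)
  ultimately show ?thesis using that by blast
qed

text \<open>Pulling the measures back along a space-filling curve, by means of a Borel section of it, reduces
  the claim to Helly's selection theorem on the line.\<close>

lemma weak_compactness:
  fixes N :: "nat \<Rightarrow> (real^'n::finite) measure"
  assumes sN: "\<And>j. sets (N j) = sets borel" and mass: "\<And>j. emeasure (N j) UNIV \<le> ennreal C" and C: "0 \<le> C"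
    and supp: "\<And>j. emeasure (N j) (- S) = 0" and S: "bounded S" "S \<in> sets borel"
  obtains r :: "nat \<Rightarrow> nat" and P where "strict_mono r" "finite_measure P" "sets P = sets borel"
    "\<And>\<phi> :: real^'n \<Rightarrow> real. continuous_on UNIV \<phi> \<Longrightarrow> (\<lambda>j. LINT x|N (r j). \<phi> x) \<longlonglongrightarrow> (LINT x|P. \<phi> x)"
proof -
  obtain c :: "real \<Rightarrow> real^'n" where c: "continuous_on UNIV c"
    "{x. \<forall>i. 0 \<le> x $ i \<and> x $ i < 1} \<subseteq> c ` {0..1}" "\<And>t i. 0 \<le> c t $ i \<and> c t $ i \<le> 1" using space_filling_curve by blast
  obtain R where R: "R > 0" "\<And>x. x \<in> S \<Longrightarrow> norm x < R" using S(1) by (auto simp: bounded_pos_less)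
  \<comment> \<open>The unit cube is mapped to the cube of half-width R about the origin. The strict
    bound \<open>norm x < R\<close> places S in the half-open cube that the curve covers.\<close>
  define f where "f t = (2 * R) *\<^sub>R c t - (\<chi> i. R)" for t
  have f: "continuous_on UNIV f" unfolding f_def using c(1) by (intro continuous_intros)
  have Sf: "S \<subseteq> f ` {0..1}"
  proof
    fix x assume x: "x \<in> S"
    define y where "y = (1 / (2 * R)) *\<^sub>R (x + (\<chi> i. R))"
    have "0 \<le> y $ i \<and> y $ i < 1" for i
      using component_le_norm_cart[of x i] R(2)[OF x] R(1) by (simp add: y_def field_simps abs_le_iff)
    then obtain t where t: "t \<in> {0..1}" "c t = y" using c(2) by blast
    then have "f t = x" using R(1) by (simp add: f_def y_def vec_eq_iff)
    with t show "x \<in> f ` {0..1}" by blast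
  qed
  obtain g where g [measurable]: "g \<in> borel_measurable borel" and fg: "\<And>x. x \<in> f ` {0..1} \<Longrightarrow> f (g x) = x" and g01: "\<And>x. 0 \<le> g x \<and> g x \<le> 1"
    using curve_section[OF f] by blast
  have fin: "finite_measure (N j)" for j
    using mass[of j] by (intro finite_measureI) (auto simp: sets_eq_imp_space_eq[OF sN] top_unique)
  define m where "m j = measure (N j) UNIV" for j
  have m: "0 \<le> m j" "m j \<le> C" for j
  proof -
    interpret finite_measure "N j" by (rule fin)
    show "0 \<le> m j" by (simp add: m_def)
    show "m j \<le> C" using mass[of j] C by (simp add: m_def emeasure_eq_measure)
  qed
  \<comment> \<open>The image measures are normalised to mass 1, with a point mass as placeholder
    when the mass vanishes. The factor \<open>m j\<close> returns in
    \<open>integral_N\<close>.\<close>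
  define P where "P j = (if m j = 0 then return borel 0 else density (distr (N j) borel g) (\<lambda>_. ennreal (1 / m j)))" for j
  have gN [measurable]: "g \<in> measurable (N j) borel" for j using g by (simp add: measurable_cong_sets[OF sN refl])
  have emdist: "emeasure (distr (N j) borel g) A = emeasure (N j) (g -` A)" if "A \<in> sets borel" for A j
    using that by (subst emeasure_distr) (auto simp: sets_eq_imp_space_eq[OF sN])
  have totd: "emeasure (N j) UNIV = ennreal (m j)" for j
  proof -
    interpret finite_measure "N j" by (rule fin)
    show ?thesis by (simp add: m_def emeasure_eq_measure)
  qed
  have P01: "emeasure (P j) A = 1" if A: "A \<in> sets borel" "{0..1} \<subseteq> A" for A j
  proof (cases "m j = 0")
    case True
    have "0 \<in> A" using A(2) by auto
    then show ?thesis using True A by (simp add: P_def)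
  next
    case False
    have "g x \<in> {0..1}" for x using g01 by simp
    then have "g -` A = UNIV" using A(2) by blast
    then have "emeasure (P j) A = ennreal (1 / m j) * ennreal (m j)"
      using False A by (simp add: P_def emeasure_density nn_integral_cmult emdist totd)
    also have "\<dots> = 1" using False m(1)[of j] by (simp add: ennreal_mult'[symmetric])
    finally show ?thesis .
  qed
  have sP [simp]: "sets (P j) = sets borel" for j by (simp add: P_def)
  have rd: "real_distribution (P j)" for j
  proof -
    have "prob_space (P j)" using P01[of UNIV j] by (intro prob_spaceI) (simp add: sets_eq_imp_space_eq[OF sP])
    then show ?thesis by (simp add: real_distribution_def real_distribution_axioms_def)
  qed
  have "tight P"
    unfolding tight_def
  proof (intro conjI allI impI rd)
    fix \<epsilon> :: real assume \<epsilon>: "\<epsilon> > 0"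
    \<comment> \<open>Tightness is stated with intervals open on the left, hence the left end -1
      instead of 0.\<close>
    have "{0..1} \<subseteq> {-1<..1::real}" by auto
    then have "measure (P j) {-1<..1} = 1" for j using P01[of "{-1<..1}" j] by (simp add: measure_def)
    then show "\<exists>a b. a < b \<and> (\<forall>n. 1 - \<epsilon> < measure (P n) {a<..b})" using \<epsilon> by (intro exI[of _ "-1"] exI[of _ 1]) auto
  qed
  \<comment> \<open>The total masses are made convergent first; weak convergence is then extracted
    along that subsequence.\<close>
  have "m j \<in> {0..C}" for j using m[of j] by simp
  then obtain m0 s where m0: "m0 \<in> {0..C}" "strict_mono s" "(m \<circ> s) \<longlonglongrightarrow> m0"
    using compact_Icc[of 0 C] unfolding compact_eq_seq_compact_metric seq_compact_def by metis
  obtain s' Q where Q: "strict_mono s'" "real_distribution Q" "weak_conv_m (P \<circ> s \<circ> s') Q"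
    using tight_imp_convergent_subsubsequence[OF \<open>tight P\<close> m0(2)] by blast
  interpret Q: real_distribution Q by (rule Q(2))
  define r where "r = s \<circ> s'"
  have r: "strict_mono r" using m0(2) Q(1) by (simp add: r_def strict_mono_o)
  have fm [measurable]: "f \<in> borel_measurable borel" using f by (rule borel_measurable_continuous_onI)
  define D where "D = density (distr Q borel f) (\<lambda>_. ennreal m0)"
  have integral_N: "(LINT x|N j. \<phi> x) = m j * (LINT t|P j. \<phi> (f t))" if \<phi>: "continuous_on UNIV \<phi>" for \<phi> :: "real^'n \<Rightarrow> real" and j
  proof -
    have pm [measurable]: "\<phi> \<in> borel_measurable borel" using \<phi> by (rule borel_measurable_continuous_onI)
    have pN [measurable]: "\<phi> \<in> borel_measurable (N j)" by (simp add: measurable_cong_sets[OF sN refl])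
    have "AE x in N j. x \<in> S"
      using supp[of j] S(2) by (intro AE_I[of _ _ "- S"]) (auto simp: sN sets_eq_imp_space_eq[OF sN])
    then have ae: "AE x in N j. \<phi> x = \<phi> (f (g x))" using Sf fg by (auto elim!: eventually_mono)
    have "(LINT x|N j. \<phi> x) = (LINT x|N j. \<phi> (f (g x)))" using ae by (intro integral_cong_AE) auto
    also have "\<dots> = (LINT t|distr (N j) borel g. \<phi> (f t))" by (subst integral_distr) auto
    also have "\<dots> = m j * (LINT t|P j. \<phi> (f t))"
    proof (cases "m j = 0")
      case True
      have "emeasure (distr (N j) borel g) (space (distr (N j) borel g)) = 0" using emdist[of UNIV j] totd[of j] True by simp
      then have "AE x in distr (N j) borel g. \<phi> (f x) = 0"
        by (intro AE_I[of _ _ "space (distr (N j) borel g)"]) auto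
      then have "(LINT t|distr (N j) borel g. \<phi> (f t)) = 0" by (intro integral_eq_zero_AE)
      with True show ?thesis by simp
    next
      case False
      then have "(LINT t|P j. \<phi> (f t)) = (1 / m j) * (LINT t|distr (N j) borel g. \<phi> (f t))"
        using m(1)[of j] by (simp add: P_def integral_density)
      then show ?thesis using False by simp
    qed
    finally show ?thesis .
  qed
  show ?thesis
  proof (rule that[OF r])
    show "sets D = sets borel" by (simp add: D_def)
    show "finite_measure D"
    proof (rule finite_measureI)
      have "emeasure D UNIV = ennreal m0 * emeasure Q UNIV"
        by (simp add: D_def emeasure_density nn_integral_cmult emeasure_distr sets_eq_imp_space_eq[OF Q.events_eq_borel])
      then show "emeasure D (space D) \<noteq> \<infinity>" using Q.emeasure_finite[of UNIV]
        by (simp add: D_def ennreal_mult_eq_top_iff)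
    qed
    fix \<phi> :: "real^'n \<Rightarrow> real" assume \<phi>: "continuous_on UNIV \<phi>"
    have pm [measurable]: "\<phi> \<in> borel_measurable borel" using \<phi> by (rule borel_measurable_continuous_onI)
    \<comment> \<open>Weak convergence applies to bounded continuous functions. The composition
      \<open>\<phi> (f t)\<close> is bounded because f stays in a fixed ball, even though \<phi>
      itself may be unbounded.\<close>
    have fR: "f t \<in> cball 0 (R * (3 * CARD('n)))" for t
    proof -
      have "norm (f t) \<le> (\<Sum>i\<in>UNIV. \<bar>f t $ i\<bar>)" by (rule norm_le_l1_cart)
      also have "\<dots> \<le> (\<Sum>i\<in>(UNIV::'n set). 3 * R)"
      proof (rule sum_mono)
        fix i
        have "\<bar>f t $ i\<bar> = \<bar>2 * R * (c t $ i) - R\<bar>" by (simp add: f_def)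
        moreover have "0 \<le> 2 * R * (c t $ i)" "2 * R * (c t $ i) \<le> 2 * R" using c(3)[of t i] R(1) by (auto intro: mult_left_le)
        ultimately show "\<bar>f t $ i\<bar> \<le> 3 * R" using R(1) by linarith
      qed
      finally show ?thesis by (simp add: mult_ac)
    qed
    have "compact (\<phi> ` cball 0 (R * (3 * CARD('n))))" using \<phi> by (intro compact_continuous_image) (auto intro: continuous_on_subset)
    then have "bounded (\<phi> ` cball 0 (R * (3 * CARD('n))))" by (rule compact_imp_bounded)
    then obtain B where "\<forall>y\<in>\<phi> ` cball 0 (R * (3 * CARD('n))). norm y \<le> B" unfolding bounded_iff by blast
    then have B: "norm (\<phi> x) \<le> B" if "x \<in> cball 0 (R * (3 * CARD('n)))" for x using that by blast
    have "isCont (\<lambda>t. \<phi> (f t)) t" for t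
      using continuous_on_compose2[OF \<phi> f] by (simp add: continuous_on_eq_continuous_at)
    then have "(\<lambda>j. LINT t|(P \<circ> s \<circ> s') j. \<phi> (f t)) \<longlonglongrightarrow> (LINT t|Q. \<phi> (f t))"
      using rd B[OF fR] by (intro weak_conv_imp_integral_bdd_continuous_conv[OF _ Q(2,3), where B=B]) auto
    moreover have "(\<lambda>j. m (r j)) \<longlonglongrightarrow> m0" using LIMSEQ_subseq_LIMSEQ[OF m0(3) Q(1)] by (simp add: r_def o_def)
    ultimately have "(\<lambda>j. m (r j) * (LINT t|P (r j). \<phi> (f t))) \<longlonglongrightarrow> m0 * (LINT t|Q. \<phi> (f t))"
      by (intro tendsto_mult) (auto simp: r_def o_def)
    moreover have "(LINT x|D. \<phi> x) = m0 * (LINT t|Q. \<phi> (f t))"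
      using m0(1) by (simp add: D_def integral_density integral_distr)
    ultimately show "(\<lambda>j. LINT x|N (r j). \<phi> x) \<longlonglongrightarrow> (LINT x|D. \<phi> x)" by (simp add: integral_N[OF \<phi>])
  qed
qed

section \<open>Measures representing one partial derivative\<close>

lemma infdist_compl_ge:
  assumes "- \<Omega> \<noteq> {}" "cball x d \<subseteq> \<Omega>" "d \<ge> 0" shows "d \<le> infdist x (- \<Omega>)"
proof -
  have "d \<le> dist x a" if "a \<in> - \<Omega>" for a
    using that assms(2) by (meson ComplD linorder_not_less mem_cball less_imp_le subsetD)
  then show ?thesis using assms(1) unfolding infdist_notempty[OF assms(1)] by (intro cINF_greatest) auto
qed

text \<open>The derivatives of the mollified functions, cut off near the boundary, have integrals of
  absolute values at most C, since such an integral is the pairing of v with a mollified sign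
  function. Weak limits of their positive and negative parts represent the derivative.\<close>

lemma component_derivative_measures:
  fixes v :: "real^'n::finite \<Rightarrow> real"
  assumes \<Omega>: "open \<Omega>" "bounded \<Omega>" and v: "L1_on \<Omega> v" and C: "0 \<le> C"
    and bound: "\<And>\<phi>. test_fun \<Omega> \<phi> \<Longrightarrow> (\<And>x. \<bar>\<phi> x\<bar> \<le> 1) \<Longrightarrow> - (LINT x|lborel. v x * partial i \<phi> x) \<le> C"
  obtains P N where "finite_measure P" "finite_measure N" "sets P = sets borel" "sets N = sets borel"
    "\<And>\<phi>. test_fun \<Omega> \<phi> \<Longrightarrow> (LINT x|P. \<phi> x) - (LINT x|N. \<phi> x) = - (LINT x|lborel. v x * partial i \<phi> x)"
proof -
  have \<Omega>b [measurable]: "\<Omega> \<in> sets borel" using \<Omega> by simp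
  \<comment> \<open>A bounded set has nonempty complement, so that \<open>infdist\<close> to it is a
    genuine distance and not the default value 0.\<close>
  have ne: "- \<Omega> \<noteq> {}" using \<Omega>(2) not_bounded_UNIV by (metis Compl_eq_Diff_UNIV Diff_eq_empty_iff top.extremum_uniqueI)
  define w where "w x = indicator \<Omega> x * v x" for x
  have wi: "integrable lborel w" using v by (simp add: w_def[abs_def] L1_on_def)
  define e where "e j = 1 / real (Suc j)" for j
  have e: "e j > 0" for j by (simp add: e_def)
  have e0: "e \<longlonglongrightarrow> 0" unfolding e_def by real_asymp
  define W where "W j = conv (moll (e j)) w" for j
  have CW: "C_k k (W j)" for k j unfolding W_def by (rule C_k_conv[OF C_c_moll[OF e] wi])
  define h where "h j = partial i (W j)" for j
  have hc: "continuous_on UNIV (h j)" for j using CW[of "Suc 0" j] by (simp add: h_def)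
  have hm [measurable]: "h j \<in> borel_measurable borel" for j using hc by (rule borel_measurable_continuous_onI)
  \<comment> \<open>The distance \<open>2 * e j\<close> leaves room for mollification at scale
    \<open>e j\<close>: functions living on \<open>A j\<close> become test functions of
    \<Omega>.\<close>
  define A where "A j = {x. 2 * e j \<le> infdist x (- \<Omega>)}" for j
  have A_sub: "A j \<subseteq> \<Omega>" for j
  proof
    fix x assume x: "x \<in> A j"
    show "x \<in> \<Omega>"
    proof (rule ccontr)
      assume "x \<notin> \<Omega>"
      then have "infdist x (- \<Omega>) = 0" by simp
      then show False using x e[of j] by (simp add: A_def)
    qed
  qed
  have Ac: "compact (A j)" for j
  proof -
    have "closed (A j)" unfolding A_def by (intro closed_Collect_le continuous_intros)
    moreover have "bounded (A j)" using bounded_subset[OF \<Omega>(2) A_sub] .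
    ultimately show ?thesis by (simp add: compact_eq_bounded_closed)
  qed
  have Am [measurable]: "A j \<in> sets borel" for j using Ac by (auto simp: compact_imp_closed)
  have A_margin: "cball x (e j) \<subseteq> \<Omega>" if "x \<in> A j" for x j
  proof
    fix y assume y: "y \<in> cball x (e j)"
    show "y \<in> \<Omega>"
    proof (rule ccontr)
      assume "y \<notin> \<Omega>"
      then have "infdist x (- \<Omega>) \<le> dist x y" by (intro infdist_le) simp
      then show False using y \<open>x \<in> A j\<close> e[of j] by (simp add: A_def)
    qed
  qed
  define hA where "hA j x = indicator (A j) x * h j x" for j x
  have hA_i: "integrable lborel (hA j)" for j
  proof -
    have "integrable lborel (\<lambda>x. indicator (A j) x *\<^sub>R h j x)"
      by (rule borel_integrable_compact[OF Ac]) (rule continuous_on_subset[OF hc], simp)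
    then show ?thesis by (simp add: hA_def[abs_def])
  qed
  have hA_C: "(LINT x|lborel. \<bar>hA j x\<bar>) \<le> C" for j
  proof -
    \<comment> \<open>Integrating the derivative against its sign gives its absolute value. Duality
      moves the mollification onto this sign, where it preserves the bound 1.\<close>
    define s where "s x = indicator (A j) x * sgn (h j x)" for x
    have sb: "\<bar>s x\<bar> \<le> 1" for x by (simp add: s_def indicator_def sgn_if)
    have sm [measurable]: "s \<in> borel_measurable borel" unfolding s_def[abs_def] by measurable
    have s0: "s x = 0" if "x \<notin> A j" for x using that by (simp add: s_def)
    have si: "integrable lborel s"
    proof -
      have "integrable lborel (\<lambda>x. sgn (h j x) * indicat_real (A j) x)"
        using emeasure_compact_finite[OF Ac] by (intro integrable_mult_bounded[of _ _ _ 1]) (auto simp: sgn_if)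
      then show ?thesis by (simp add: s_def[abs_def] mult.commute)
    qed
    have tf: "test_fun \<Omega> (conv (moll (e j)) s)" by (rule test_fun_conv_moll[OF e Ac A_margin si s0])
    have "\<bar>conv (moll (e j)) s x\<bar> \<le> 1" for x using conv_moll_dist_le[OF e si, where b=0 and c=1] sb by simp
    then have "- (LINT x|lborel. v x * partial i (conv (moll (e j)) s) x) \<le> C" by (rule bound[OF tf])
    moreover have "(\<lambda>x. w x * partial i (conv (moll (e j)) s) x) = (\<lambda>x. v x * partial i (conv (moll (e j)) s) x)"
    proof
      show "w x * partial i (conv (moll (e j)) s) x = v x * partial i (conv (moll (e j)) s) x" for x
        using test_fun_partial_outside[OF tf, of x i] by (cases "x \<in> \<Omega>") (auto simp: w_def)
    qed
    moreover have "(LINT x|lborel. h j x * s x) = - (LINT x|lborel. w x * partial i (conv (moll (e j)) s) x)"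
      unfolding h_def W_def by (rule conv_moll_partial_duality[OF e wi si sb])
    moreover have "h j x * s x = \<bar>hA j x\<bar>" for x by (simp add: s_def hA_def abs_sgn indicator_def abs_mult)
    ultimately show ?thesis by simp
  qed
  \<comment> \<open>The value \<open>\<sigma> = 1\<close> gives the positive part and
    \<open>\<sigma> = -1\<close> the negative part.\<close>
  define PP where "PP \<sigma> j = density lborel (\<lambda>x. ennreal (max 0 (\<sigma> * hA j x)))" for \<sigma> :: real and j
  have hAm [measurable]: "hA j \<in> borel_measurable borel" for j unfolding hA_def[abs_def] by measurable
  have mass: "emeasure (PP \<sigma> j) UNIV \<le> ennreal C" if \<sigma>: "\<bar>\<sigma>\<bar> = 1" for \<sigma> j
  proof -
    have "emeasure (PP \<sigma> j) UNIV = (\<integral>\<^sup>+x. ennreal (max 0 (\<sigma> * hA j x)) \<partial>lborel)"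
      by (simp add: PP_def emeasure_density)
    also have "\<dots> \<le> (\<integral>\<^sup>+x. ennreal \<bar>hA j x\<bar> \<partial>lborel)"
    proof (intro nn_integral_mono ennreal_leI)
      fix x
      have "\<sigma> * hA j x \<le> \<bar>\<sigma> * hA j x\<bar>" by simp
      also have "\<dots> = \<bar>hA j x\<bar>" using \<sigma> by (simp add: abs_mult)
      finally show "max 0 (\<sigma> * hA j x) \<le> \<bar>hA j x\<bar>" by simp
    qed
    also have "\<dots> = ennreal (LINT x|lborel. \<bar>hA j x\<bar>)" using hA_i by (intro nn_integral_eq_integral) auto
    finally show ?thesis using hA_C[of j] by (meson ennreal_leI order_trans)
  qed
  have supp: "emeasure (PP \<sigma> j) (- \<Omega>) = 0" for \<sigma> j
  proof -
    have "(\<lambda>x. ennreal (max 0 (\<sigma> * hA j x)) * indicator (- \<Omega>) x) = (\<lambda>_. 0)"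
      using A_sub[of j] by (intro ext) (auto simp: hA_def indicator_def)
    moreover have "emeasure (PP \<sigma> j) (- \<Omega>) = (\<integral>\<^sup>+x. ennreal (max 0 (\<sigma> * hA j x)) * indicator (- \<Omega>) x \<partial>lborel)"
      unfolding PP_def by (rule emeasure_density) auto
    ultimately show ?thesis by (simp only:) simp
  qed
  have sPP: "sets (PP \<sigma> j) = sets borel" for \<sigma> j by (simp add: PP_def)
  obtain r1 P where P: "strict_mono r1" "finite_measure P" "sets P = sets borel"
    "\<And>\<phi> :: real^'n \<Rightarrow> real. continuous_on UNIV \<phi> \<Longrightarrow> (\<lambda>j. LINT x|PP 1 (r1 j). \<phi> x) \<longlonglongrightarrow> (LINT x|P. \<phi> x)"
    using weak_compactness[of "PP 1" C \<Omega>, OF sPP mass C supp \<Omega>(2) \<Omega>b] by auto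
  obtain r2 N where N: "strict_mono r2" "finite_measure N" "sets N = sets borel"
    "\<And>\<phi> :: real^'n \<Rightarrow> real. continuous_on UNIV \<phi> \<Longrightarrow> (\<lambda>j. LINT x|PP (-1) (r1 (r2 j)). \<phi> x) \<longlonglongrightarrow> (LINT x|N. \<phi> x)"
    using weak_compactness[of "\<lambda>j. PP (-1) (r1 j)" C \<Omega>, OF sPP mass C supp \<Omega>(2) \<Omega>b] by auto
  define r where "r = r1 \<circ> r2"
  have r: "strict_mono r" using P(1) N(1) by (simp add: r_def strict_mono_o)
  show ?thesis
  proof (rule that[OF P(2) N(2) P(3) N(3)])
    fix \<phi> assume tf: "test_fun \<Omega> \<phi>"
    obtain K where K: "K \<subseteq> \<Omega>" "\<And>k. C_c k K \<phi>" using test_fun_C_c[OF tf] by blast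
    have \<phi>c: "continuous_on UNIV \<phi>" using C_c_cont(1)[OF K(2)] .
    have \<phi>m [measurable]: "\<phi> \<in> borel_measurable borel" using \<phi>c by (rule borel_measurable_continuous_onI)
    obtain B\<phi> where B\<phi>: "\<And>x. \<bar>\<phi> x\<bar> \<le> B\<phi>" using C_c_bounded[OF K(2)] by blast
    have p: "C_c 0 K (partial i \<phi>)" using C_c_partial[OF K(2)] .
    obtain B where B: "B > 0" "\<And>x. \<bar>partial i \<phi> x\<bar> \<le> B" using C_c_bounded[OF p] by blast
    have pm [measurable]: "partial i \<phi> \<in> borel_measurable borel" using C_c_measurable[OF p] .
    have "(\<lambda>j. LINT x|PP 1 (r j). \<phi> x) \<longlonglongrightarrow> (LINT x|P. \<phi> x)"
      using LIMSEQ_subseq_LIMSEQ[OF P(4)[OF \<phi>c] N(1)] by (simp add: r_def o_def)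
    moreover have "(\<lambda>j. LINT x|PP (-1) (r j). \<phi> x) \<longlonglongrightarrow> (LINT x|N. \<phi> x)" using N(4)[OF \<phi>c] by (simp add: r_def)
    ultimately have lim1: "(\<lambda>j. (LINT x|PP 1 (r j). \<phi> x) - (LINT x|PP (-1) (r j). \<phi> x)) \<longlonglongrightarrow> (LINT x|P. \<phi> x) - (LINT x|N. \<phi> x)"
      by (rule tendsto_diff)
    have eq1: "(LINT x|PP 1 j. \<phi> x) - (LINT x|PP (-1) j. \<phi> x) = (LINT x|lborel. hA j x * \<phi> x)" for j
    proof -
      have i: "integrable lborel (\<lambda>x. \<phi> x * max 0 (\<sigma> * hA j x))" for \<sigma>
      proof (rule integrable_mult_bounded[OF _ _ B\<phi>])
        have "integrable lborel (\<lambda>x. \<sigma> * hA j x)" using hA_i[of j] by simp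
        then show "integrable lborel (\<lambda>x. max 0 (\<sigma> * hA j x))" by (intro Bochner_Integration.integrable_max) auto
      qed auto
      have "(LINT x|PP \<sigma> j. \<phi> x) = (LINT x|lborel. \<phi> x * max 0 (\<sigma> * hA j x))" for \<sigma>
        unfolding PP_def by (subst integral_density) (auto simp: mult.commute)
      then have "(LINT x|PP 1 j. \<phi> x) - (LINT x|PP (-1) j. \<phi> x) = (LINT x|lborel. \<phi> x * max 0 (1 * hA j x) - \<phi> x * max 0 (- 1 * hA j x))"
        using i[of 1] i[of "-1"] by simp
      also have "\<dots> = (LINT x|lborel. hA j x * \<phi> x)"
        by (intro Bochner_Integration.integral_cong) (auto simp: max_def)
      finally show ?thesis .
    qed
    obtain d where d: "d > 0" "\<And>x. x \<in> K \<Longrightarrow> cball x d \<subseteq> \<Omega>" using compact_margin[OF C_c_cont(2)[OF K(2)] K(1) \<Omega>(1)] by blast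
    have "(\<lambda>j. 2 * e j) \<longlonglongrightarrow> 2 * 0" by (intro tendsto_intros e0)
    \<comment> \<open>From some index on \<open>A j\<close> contains K, off which \<phi> vanishes,
      and the cutoff disappears from the integrals.\<close>
    then have ev: "\<forall>\<^sub>F j in sequentially. 2 * e j < d" using d(1) by (intro order_tendstoD(2)) auto
    have eq2: "(LINT x|lborel. hA j x * \<phi> x) = - (LINT x|lborel. W j x * partial i \<phi> x)" if "2 * e j < d" for j
    proof -
      have "hA j x * \<phi> x = partial i (W j) x * \<phi> x" for x
      proof (cases "x \<in> K")
        case True
        then have "d \<le> infdist x (- \<Omega>)" using d by (intro infdist_compl_ge[OF ne]) auto
        then have "x \<in> A j" using \<open>2 * e j < d\<close> by (simp add: A_def)
        then show ?thesis by (simp add: hA_def h_def)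
      next
        case False then show ?thesis using C_c_cont(3)[OF K(2)[of 0]] by simp
      qed
      then have "(\<lambda>x. hA j x * \<phi> x) = (\<lambda>x. partial i (W j) x * \<phi> x)" by blast
      then show ?thesis using integration_by_parts[OF CW K(2), of j i] by (simp only:)
    qed
    have lim2: "(\<lambda>j. LINT x|lborel. W j x * partial i \<phi> x) \<longlonglongrightarrow> (LINT x|lborel. w x * partial i \<phi> x)"
    proof (rule LIMSEQ_I)
      fix \<eta> :: real assume \<eta>: "\<eta> > 0"
      then have "\<eta> / B > 0" using B(1) by simp
      then obtain \<epsilon> where \<epsilon>: "\<epsilon> > 0" "\<And>e. 0 < e \<Longrightarrow> e < \<epsilon> \<Longrightarrow> (LINT x|lborel. \<bar>conv (moll e) w x - w x\<bar>) < \<eta> / B"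
        using conv_moll_L1[OF wi] by blast
      have "\<forall>\<^sub>F j in sequentially. e j < \<epsilon>" using e0 \<epsilon>(1) by (rule order_tendstoD(2))
      then obtain j0 where j0: "\<And>j. j \<ge> j0 \<Longrightarrow> e j < \<epsilon>" by (auto simp: eventually_sequentially)
      have Wi: "integrable lborel (W j)" for j unfolding W_def by (rule integrable_conv[OF C_c_moll[OF e] wi])
      have prod_i: "integrable lborel (\<lambda>x. u x * partial i \<phi> x)" if "integrable lborel u" for u :: "real^'n \<Rightarrow> real"
        using integrable_mult_bounded[OF that _ B(2)] by (simp add: mult.commute)
      have "norm ((LINT x|lborel. W j x * partial i \<phi> x) - (LINT x|lborel. w x * partial i \<phi> x)) < \<eta>" if "j \<ge> j0" for j
      proof -
        have "(LINT x|lborel. W j x * partial i \<phi> x) - (LINT x|lborel. w x * partial i \<phi> x) = (LINT x|lborel. (W j x - w x) * partial i \<phi> x)"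
          using prod_i[OF Wi] prod_i[OF wi] by (simp add: left_diff_distrib)
        also have "norm \<dots> \<le> (LINT x|lborel. norm ((W j x - w x) * partial i \<phi> x))" by (rule integral_norm_bound)
        also have "\<dots> \<le> (LINT x|lborel. B * \<bar>W j x - w x\<bar>)"
        proof (rule integral_mono')
          show "integrable lborel (\<lambda>x. B * \<bar>W j x - w x\<bar>)" using Wi wi by auto
          show "norm ((W j x - w x) * partial i \<phi> x) \<le> B * \<bar>W j x - w x\<bar>" for x
            using mult_left_mono[OF B(2)[of x], of "\<bar>W j x - w x\<bar>"] by (simp add: abs_mult mult.commute)
        qed (use B in auto)
        also have "\<dots> = B * (LINT x|lborel. \<bar>W j x - w x\<bar>)" by simp
        also have "\<dots> < B * (\<eta> / B)" using \<epsilon>(2)[OF e j0[OF that]] B(1) unfolding W_def by (intro mult_strict_left_mono) auto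
        finally show ?thesis using B(1) by simp
      qed
      then show "\<exists>no. \<forall>j\<ge>no. norm ((LINT x|lborel. W j x * partial i \<phi> x) - (LINT x|lborel. w x * partial i \<phi> x)) < \<eta>" by blast
    qed
    have "(\<lambda>j. (LINT x|PP 1 j. \<phi> x) - (LINT x|PP (-1) j. \<phi> x)) \<longlonglongrightarrow> - (LINT x|lborel. w x * partial i \<phi> x)"
    proof (rule Lim_transform_eventually[OF tendsto_minus[OF lim2]])
      show "\<forall>\<^sub>F j in sequentially. - (LINT x|lborel. W j x * partial i \<phi> x) = (LINT x|PP 1 j. \<phi> x) - (LINT x|PP (-1) j. \<phi> x)"
        using ev by eventually_elim (simp add: eq1 eq2)
    qed
    from LIMSEQ_subseq_LIMSEQ[OF this r] lim1
    have "(LINT x|P. \<phi> x) - (LINT x|N. \<phi> x) = - (LINT x|lborel. w x * partial i \<phi> x)"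
      unfolding o_def using LIMSEQ_unique by blast
    also have "(\<lambda>x. w x * partial i \<phi> x) = (\<lambda>x. v x * partial i \<phi> x)"
    proof
      show "w x * partial i \<phi> x = v x * partial i \<phi> x" for x
        using test_fun_partial_outside[OF tf, of x i] by (cases "x \<in> \<Omega>") (auto simp: w_def)
    qed
    finally show "(LINT x|P. \<phi> x) - (LINT x|N. \<phi> x) = - (LINT x|lborel. v x * partial i \<phi> x)" .
  qed
qed


section \<open>Rounding to a finite set of values\<close>

lemma simple_function_sum_indicator:
  fixes F :: "'a \<Rightarrow> real"
  assumes "simple_function M F" "x \<in> space M"
  shows "F x = (\<Sum>y\<in>F ` space M. y * indicator (F -` {y} \<inter> space M) x)"
proof -
  have "finite (F ` space M)" using assms(1) by (simp add: simple_function_def)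
  moreover have "(\<Sum>y\<in>F ` space M. y * indicator (F -` {y} \<inter> space M) x) = (\<Sum>y\<in>F ` space M. if y = F x then y else 0)"
    using assms(2) by (intro sum.cong) (auto simp: indicator_def)
  ultimately show ?thesis using assms(2) by simp
qed

text \<open>\<open>vec_integral\<close> is defined by a density, while the derivative is constructed
  from differences of measures. Agreement on sets is extended to h by simple functions, uniformly
  bounded by \<open>2 * B\<close>, and dominated convergence.\<close>

lemma signed_integral_eq:
  fixes f h :: "'a \<Rightarrow> real"
  assumes fin: "finite_measure P" "finite_measure N"
    and sets: "sets P = sets \<tau>" "sets N = sets \<tau>" and f: "integrable \<tau> f"
    and eq: "\<And>A. A \<in> sets \<tau> \<Longrightarrow> measure P A - measure N A = (LINT x|\<tau>. indicator A x * f x)"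
    and h: "h \<in> borel_measurable \<tau>" "\<And>x. \<bar>h x\<bar> \<le> B"
  shows "(LINT x|P. h x) - (LINT x|N. h x) = (LINT x|\<tau>. h x * f x)"
proof -
  interpret P: finite_measure P by fact
  interpret N: finite_measure N by fact
  have sp: "space P = space \<tau>" "space N = space \<tau>" using sets by (auto dest: sets_eq_imp_space_eq)
  have B: "0 \<le> B" using h(2)[of undefined] by linarith
  have hP: "h \<in> borel_measurable P" "h \<in> borel_measurable N"
    using h(1) by (simp_all add: measurable_cong_sets[OF sets(1) refl] measurable_cong_sets[OF sets(2) refl])
  obtain F where F: "\<And>i. simple_function \<tau> (F i)" "\<And>x. x \<in> space \<tau> \<Longrightarrow> (\<lambda>i. F i x) \<longlonglongrightarrow> h x"
    "\<And>i x. x \<in> space \<tau> \<Longrightarrow> dist (F i x) 0 \<le> 2 * dist (h x) 0"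
    using borel_measurable_implies_sequence_metric[OF h(1), of 0] by blast
  have Fb: "\<bar>F i x\<bar> \<le> 2 * B" if "x \<in> space \<tau>" for i x
    using F(3)[OF that, of i] h(2)[of x] by simp
  have Fm: "F i \<in> borel_measurable \<tau>" for i using F(1) by (rule borel_measurable_simple_function)
  have FP: "F i \<in> borel_measurable P" "F i \<in> borel_measurable N" for i
    using Fm by (simp_all add: measurable_cong_sets[OF sets(1) refl] measurable_cong_sets[OF sets(2) refl])
  have simple: "(LINT x|P. F i x) - (LINT x|N. F i x) = (LINT x|\<tau>. F i x * f x)" for i
  proof -
    let ?Y = "F i ` space \<tau>" and ?A = "\<lambda>y. F i -` {y} \<inter> space \<tau>"
    have fY: "finite ?Y" using F(1) by (simp add: simple_function_def)
    have A: "?A y \<in> sets \<tau>" for y using Fm[of i] by measurable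
    have rep: "F i x = (\<Sum>y\<in>?Y. y * indicator (?A y) x)" if "x \<in> space \<tau>" for x
      by (rule simple_function_sum_indicator[OF F(1) that])
    have "(LINT x|P. F i x) = (LINT x|P. (\<Sum>y\<in>?Y. y * indicator (?A y) x))"
      by (intro Bochner_Integration.integral_cong refl rep) (simp add: sp)
    also have "\<dots> = (\<Sum>y\<in>?Y. y * measure P (?A y))"
      using A sets by (subst Bochner_Integration.integral_sum) (auto intro!: integrable_mult_right P.integrable_const_bound[of _ 1] simp: sp)
    finally have 1: "(LINT x|P. F i x) = (\<Sum>y\<in>?Y. y * measure P (?A y))" .
    have "(LINT x|N. F i x) = (LINT x|N. (\<Sum>y\<in>?Y. y * indicator (?A y) x))"
      by (intro Bochner_Integration.integral_cong refl rep) (simp add: sp)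
    also have "\<dots> = (\<Sum>y\<in>?Y. y * measure N (?A y))"
      using A sets by (subst Bochner_Integration.integral_sum) (auto intro!: integrable_mult_right N.integrable_const_bound[of _ 1] simp: sp)
    finally have 2: "(LINT x|N. F i x) = (\<Sum>y\<in>?Y. y * measure N (?A y))" .
    have int: "integrable \<tau> (\<lambda>x. indicator (?A y) x * f x)" for y
      by (rule integrable_mult_bounded[OF f borel_measurable_indicator[OF A], of _ 1]) (simp add: indicator_def)
    have "(LINT x|\<tau>. F i x * f x) = (LINT x|\<tau>. (\<Sum>y\<in>?Y. y * (indicator (?A y) x * f x)))"
    proof (intro Bochner_Integration.integral_cong refl)
      fix x assume "x \<in> space \<tau>"
      from rep[OF this] show "F i x * f x = (\<Sum>y\<in>?Y. y * (indicator (?A y) x * f x))"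
        by (simp only: sum_distrib_right mult.assoc)
    qed
    also have "\<dots> = (\<Sum>y\<in>?Y. y * (LINT x|\<tau>. indicator (?A y) x * f x))"
      using int by (subst Bochner_Integration.integral_sum) auto
    also have "\<dots> = (\<Sum>y\<in>?Y. y * measure P (?A y)) - (\<Sum>y\<in>?Y. y * measure N (?A y))"
      using eq[OF A] by (simp add: right_diff_distrib sum_subtractf flip: eq[OF A])
    finally show ?thesis using 1 2 by simp
  qed
  have limP: "(\<lambda>i. LINT x|P. F i x) \<longlonglongrightarrow> (LINT x|P. h x)"
    by (rule integral_dominated_convergence[where w="\<lambda>_. 2 * B"]) (use F(2) Fb hP FP sp in auto)
  have limN: "(\<lambda>i. LINT x|N. F i x) \<longlonglongrightarrow> (LINT x|N. h x)"
    by (rule integral_dominated_convergence[where w="\<lambda>_. 2 * B"]) (use F(2) Fb hP FP sp in auto)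
  have lim\<tau>: "(\<lambda>i. LINT x|\<tau>. F i x * f x) \<longlonglongrightarrow> (LINT x|\<tau>. h x * f x)"
  proof (rule integral_dominated_convergence[where w="\<lambda>x. 2 * B * \<bar>f x\<bar>"])
    show "AE x in \<tau>. (\<lambda>i. F i x * f x) \<longlonglongrightarrow> h x * f x" using F(2) by (intro AE_I2 tendsto_mult tendsto_const) auto
    show "AE x in \<tau>. norm (F i x * f x) \<le> 2 * B * \<bar>f x\<bar>" for i
      using Fb by (intro AE_I2) (auto simp: abs_mult intro: mult_right_mono)
  qed (use f h Fm in auto)
  have "(\<lambda>i. (LINT x|P. F i x) - (LINT x|N. F i x)) \<longlonglongrightarrow> (LINT x|P. h x) - (LINT x|N. h x)"
    by (intro tendsto_diff limP limN)
  then show ?thesis unfolding simple using lim\<tau> LIMSEQ_unique by blast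
qed

text \<open>Component i of the measure is the difference of the two positive measures found for
  direction i. The remaining work is to recognise integration against it in
  \<open>vec_integral\<close>, which goes through the polar density.\<close>

lemma has_distr_deriv_exists:
  fixes v :: "real^'n::finite \<Rightarrow> real"
  assumes \<Omega>: "open \<Omega>" "bounded \<Omega>" and v: "L1_on \<Omega> v" and C: "0 \<le> C"
    and bound: "\<And>i \<phi>. test_fun \<Omega> \<phi> \<Longrightarrow> (\<And>x. \<bar>\<phi> x\<bar> \<le> 1) \<Longrightarrow> - (LINT x|lborel. v x * partial i \<phi> x) \<le> C"
  shows "\<exists>\<mu>. has_distr_deriv \<Omega> v \<mu>"
proof -
  have \<Omega>b: "\<Omega> \<in> sets borel" using \<Omega> by simp
  define R where "R i P N \<longleftrightarrow> finite_measure P \<and> finite_measure N \<and> sets P = sets borel \<and> sets N = sets borel \<and>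
    (\<forall>\<phi>. test_fun \<Omega> \<phi> \<longrightarrow> (LINT x|P. \<phi> x) - (LINT x|N. \<phi> x) = - (LINT x|lborel. v x * partial i \<phi> x))"
    for i and P N :: "(real^'n) measure"
  have "\<exists>P N. R i P N" for i
    by (rule component_derivative_measures[OF \<Omega> v C bound, where i=i]) (auto simp: R_def)
  then obtain P N where "\<And>i. R i (P i) (N i)" by metis
  then have PN: "\<And>i. finite_measure (P i)" "\<And>i. finite_measure (N i)"
    "\<And>i. sets (P i) = sets borel" "\<And>i. sets (N i) = sets borel"
    "\<And>i \<phi>. test_fun \<Omega> \<phi> \<Longrightarrow> (LINT x|P i. \<phi> x) - (LINT x|N i. \<phi> x) = - (LINT x|lborel. v x * partial i \<phi> x)"
    unfolding R_def by blast+
  define \<mu> where "\<mu> A = (\<chi> i. measure (P i) A - measure (N i) A)" for A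
  have sb: "A \<in> sets (borel_on \<Omega>) \<longleftrightarrow> A \<in> sets borel \<and> A \<subseteq> \<Omega>" for A
    using \<Omega>b by (simp add: sets_restrict_space_iff conj_commute)
  have vm: "vector_measure (borel_on \<Omega>) \<mu>"
    unfolding vector_measure_def
  proof (intro conjI allI impI)
    show "\<mu> {} = 0" by (simp add: \<mu>_def vec_eq_iff)
    fix A :: "nat \<Rightarrow> (real^'n) set" assume A: "range A \<subseteq> sets (borel_on \<Omega>) \<and> disjoint_family A"
    then have Ab: "range A \<subseteq> sets borel" using sb by blast
    have "(\<lambda>k. measure (P i) (A k)) sums measure (P i) (\<Union>k. A k)" for i
      using A Ab by (intro finite_measure.finite_measure_UNION[OF PN(1)]) (auto simp: PN(3))
    moreover have "(\<lambda>k. measure (N i) (A k)) sums measure (N i) (\<Union>k. A k)" for i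
      using A Ab by (intro finite_measure.finite_measure_UNION[OF PN(2)]) (auto simp: PN(4))
    ultimately have "(\<lambda>k. measure (P i) (A k) - measure (N i) (A k)) sums (measure (P i) (\<Union>k. A k) - measure (N i) (\<Union>k. A k))" for i
      by (intro sums_diff)
    then show "(\<lambda>k. \<mu> (A k)) sums \<mu> (\<Union>k. A k)"
      unfolding sums_def by (intro vec_tendstoI) (simp add: \<mu>_def)
  qed
  define \<tau> where "\<tau> = total_variation (borel_on \<Omega>) \<mu>"
  define \<nu> where "\<nu> = vec_RN_deriv \<tau> \<mu>"
  have s\<tau>: "sets \<tau> = sets (borel_on \<Omega>)" by (simp add: \<tau>_def)
  have \<nu>: "integrable \<tau> \<nu>" unfolding \<nu>_def \<tau>_def by (rule vec_RN_deriv_total_variation[OF vm])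
  have \<nu>A: "\<mu> A = (LINT x:A|\<tau>. \<nu> x)" if "A \<in> sets (borel_on \<Omega>)" for A
    unfolding \<nu>_def \<tau>_def by (rule vec_RN_deriv_total_variation(2)[OF vm that])
  have "(LINT x|lebesgue_on \<Omega>. v x * partial i \<phi> x) = - (vec_integral (borel_on \<Omega>) \<mu> \<phi> $ i)" if tf: "test_fun \<Omega> \<phi>" for \<phi> i
  proof -
    obtain K where K: "K \<subseteq> \<Omega>" "\<And>k. C_c k K \<phi>" using test_fun_C_c[OF tf] by blast
    obtain B where B: "\<And>x. \<bar>\<phi> x\<bar> \<le> B" using C_c_bounded[OF K(2)] by blast
    have \<phi>\<tau>: "\<phi> \<in> borel_measurable \<tau>"
      unfolding measurable_cong_sets[OF s\<tau> refl] by (rule continuous_measurable_restrict[OF C_c_cont(1)[OF K(2)]])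
    have \<phi>b: "\<phi> \<in> borel_measurable borel" using C_c_measurable[OF K(2)] .
    have \<nu>i: "integrable \<tau> (\<lambda>x. \<nu> x $ i)" using integrable_bounded_linear[OF bounded_linear_vec_nth \<nu>] .
    have out: "(\<lambda>x. indicator \<Omega> x * \<phi> x) = \<phi>"
      using C_c_cont(3)[OF K(2)[of 0]] K(1) by (intro ext) (auto simp: indicator_def)
    \<comment> \<open>Test functions vanish off \<Omega>, so mass that the weak limits may carry on
      the boundary does not count.\<close>
    have restr: "(LINT x|restrict_space Q \<Omega>. \<phi> x) = (LINT x|Q. \<phi> x)" if "sets Q = sets borel" for Q
      using \<Omega>b that by (subst integral_restrict_space) (auto simp: out sets_eq_imp_space_eq[OF that])
    have "(LINT x|restrict_space (P i) \<Omega>. \<phi> x) - (LINT x|restrict_space (N i) \<Omega>. \<phi> x) = (LINT x|\<tau>. \<phi> x * \<nu> x $ i)"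
    proof (rule signed_integral_eq)
      show "finite_measure (restrict_space (P i) \<Omega>)" "finite_measure (restrict_space (N i) \<Omega>)"
        using PN \<Omega>b by (auto intro!: finite_measure_restrict_space simp: sets_eq_imp_space_eq[OF PN(3)] sets_eq_imp_space_eq[OF PN(4)])
      show "sets (restrict_space (P i) \<Omega>) = sets \<tau>" "sets (restrict_space (N i) \<Omega>) = sets \<tau>"
        unfolding s\<tau> using PN by (auto intro!: sets_restrict_space_cong)
      fix A assume A: "A \<in> sets \<tau>"
      then have A': "A \<in> sets borel" "A \<subseteq> \<Omega>" using sb s\<tau> by auto
      have "measure (restrict_space (P i) \<Omega>) A - measure (restrict_space (N i) \<Omega>) A = \<mu> A $ i"
        using A' \<Omega>b by (subst (1 2) measure_restrict_space)
          (auto simp: \<mu>_def PN sets_eq_imp_space_eq[OF PN(3)] sets_eq_imp_space_eq[OF PN(4)])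
      also have "\<dots> = (LINT x|\<tau>. (indicator A x *\<^sub>R \<nu> x) $ i)"
        unfolding \<nu>A[OF A[unfolded s\<tau>]] set_lebesgue_integral_def
        using \<nu> A by (intro integral_bounded_linear[OF bounded_linear_vec_nth, symmetric] integrable_mult_indicator)
      finally show "measure (restrict_space (P i) \<Omega>) A - measure (restrict_space (N i) \<Omega>) A = (LINT x|\<tau>. indicator A x * \<nu> x $ i)" by simp
    qed (use \<nu>i \<phi>\<tau> B in auto)
    also have "\<dots> = (LINT x|\<tau>. \<phi> x *\<^sub>R \<nu> x) $ i"
    proof -
      have "integrable \<tau> (\<lambda>x. \<phi> x *\<^sub>R \<nu> x)"
      proof (rule Bochner_Integration.integrable_bound[of _ "\<lambda>x. B *\<^sub>R \<nu> x"])
        show "AE x in \<tau>. norm (\<phi> x *\<^sub>R \<nu> x) \<le> norm (B *\<^sub>R \<nu> x)"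
        proof (intro AE_I2)
          fix x
          have "\<bar>\<phi> x\<bar> \<le> \<bar>B\<bar>" using B[of x] by linarith
          then show "norm (\<phi> x *\<^sub>R \<nu> x) \<le> norm (B *\<^sub>R \<nu> x)" by (simp add: mult_right_mono)
        qed
      qed (use \<nu> \<phi>\<tau> in auto)
      from integral_bounded_linear[OF bounded_linear_vec_nth this, of i] show ?thesis by simp
    qed
    finally have "vec_integral (borel_on \<Omega>) \<mu> \<phi> $ i = - (LINT x|lborel. v x * partial i \<phi> x)"
      unfolding vec_integral_def \<tau>_def[symmetric] \<nu>_def[symmetric] restr[OF PN(3)] restr[OF PN(4)] PN(5)[OF tf] by simp
    moreover have "(LINT x|lebesgue_on \<Omega>. v x * partial i \<phi> x) = (LINT x|lborel. v x * partial i \<phi> x)"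
    proof (rule test_fun_integral_lebesgue_on[OF \<Omega>b _ _ _ tf])
      show vb: "v \<in> borel_measurable borel" using v by (simp add: L1_on_def)
      then show "v \<in> borel_measurable (lebesgue_on \<Omega>)" by (intro measurable_restrict_space1 measurable_completion) simp
    qed simp
    ultimately show ?thesis by simp
  qed
  then show ?thesis using vm unfolding has_distr_deriv_def by blast
qed

context anisotropy begin

text \<open>If \<bar>\<phi>\<bar> is at most 1, then \<open>l * \<phi>\<close> times a coordinate
  vector is a competitor, because \<open>l * norm \<xi> \<le> \<psi> x \<xi>\<close>. Hence each
  partial derivative is bounded as a functional by \<open>V v\<close> divided by l.\<close>

lemma V_finite_imp_distr_deriv:
  assumes v: "L1_on \<Omega> v" and fin: "V v < \<infinity>"
  shows "\<exists>\<mu>. has_distr_deriv \<Omega> v \<mu>"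
proof (rule has_distr_deriv_exists[OF open_dom bounded_dom v])
  define M where "M = enn2real (V v)"
  have M: "0 \<le> M" "V v = ennreal M" using fin by (auto simp: M_def)
  show "0 \<le> M / l" using M l_pos by simp
  fix i :: 'n and \<phi> assume tf: "test_fun \<Omega> \<phi>" and b: "\<And>x. \<bar>\<phi> x\<bar> \<le> 1"
  define \<Phi> where "\<Phi> x = (l * \<phi> x) *\<^sub>R axis i (1::real)" for x
  have comp: "(\<lambda>x. \<Phi> x $ j) = (if j = i then \<lambda>x. l * \<phi> x else (\<lambda>_. 0))" for j
    by (auto simp: \<Phi>_def axis_def)
  have tl: "test_fun \<Omega> (\<lambda>x. l * \<phi> x)"
  proof -
    obtain K where K: "K \<subseteq> \<Omega>" "\<And>k. C_c k K \<phi>" using test_fun_C_c[OF tf] by blast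
    then show ?thesis
      using C_c_cont(2,3)[OF K(2)] by (intro test_funI[of _ K] C_k_mult C_k_const test_fun_C_k[OF tf]) auto
  qed
  have adm: "admissible \<Omega> \<psi> \<Phi>"
    unfolding admissible_def
  proof (intro conjI allI)
    show "test_fun \<Omega> (\<lambda>x. \<Phi> x $ j)" for j
      unfolding comp using tl test_funI[of "\<lambda>_. 0" "{}"] by auto
    fix x \<xi>
    have "\<Phi> x \<bullet> \<xi> = l * (\<phi> x * \<xi> $ i)" by (simp add: \<Phi>_def inner_axis' mult.assoc)
    also have "\<dots> \<le> l * norm \<xi>"
    proof (intro mult_left_mono)
      have "\<phi> x * \<xi> $ i \<le> \<bar>\<phi> x\<bar> * \<bar>\<xi> $ i\<bar>" by (metis abs_ge_self abs_mult)
      also have "\<dots> \<le> 1 * norm \<xi>" by (intro mult_mono b component_le_norm_cart) auto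
      finally show "\<phi> x * \<xi> $ i \<le> norm \<xi>" by simp
    qed (use l_pos in simp)
    also have "\<dots> \<le> \<psi> x \<xi>" by (rule psi_lower)
    finally show "\<Phi> x \<bullet> \<xi> \<le> \<psi> x \<xi>" .
  qed
  have "\<phi> differentiable (at x)" for x using test_fun_C_k[OF tf, of "Suc 0"] by simp
  then have "partial j (\<lambda>x. \<Phi> x $ j) x = (if j = i then l * partial i \<phi> x else 0)" for j x
    unfolding comp by (simp add: partial_cmult)
  then have div: "diverg \<Phi> x = l * partial i \<phi> x" for x by (simp add: diverg_def)
  have "ennreal (pairing v \<Phi>) \<le> ennreal M" using pairing_le_aniso_var[OF adm, of v] M(2) by simp
  then have "pairing v \<Phi> \<le> M" using M(1) by (simp add: ennreal_le_iff)
  then have "l * (- (LINT x|lborel. v x * partial i \<phi> x)) \<le> M"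
    by (simp add: pairing_def div mult.left_commute)
  then show "- (LINT x|lborel. v x * partial i \<phi> x) \<le> M / l" using l_pos by (simp add: field_simps)
qed

end

section \<open>Rounded functions and their convergence\<close>

lemma sum_indicator_initial_segment:
  fixes c :: "nat \<Rightarrow> real"
  assumes "m \<le> M" "\<And>i. i < M \<Longrightarrow> x \<in> A i \<longleftrightarrow> i < m"
  shows "c 0 + (\<Sum>i<M. (c (Suc i) - c i) * indicator (A i) x) = c m"
proof -
  have "(\<Sum>i<M. (c (Suc i) - c i) * indicator (A i) x) = (\<Sum>i<M. if i < m then c (Suc i) - c i else 0)"
    using assms(2) by (intro sum.cong) auto
  also have "\<dots> = (\<Sum>i\<in>{..<M} \<inter> {i. i < m}. c (Suc i) - c i)" by (simp add: sum.If_cases)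
  also have "{..<M} \<inter> {i. i < m} = {..<m}" using assms(1) by auto
  also have "(\<Sum>i<m. c (Suc i) - c i) = c m - c 0" by (rule sum_lessThan_telescope)
  finally show ?thesis by simp
qed

text \<open>Two properties of the sets \<open>A i\<close> matter: they decrease with i, so that v
  takes only the values \<open>c m\<close>, and the margins decide membership wherever w is within
  \<delta> of some \<open>c m\<close>.\<close>

lemma rounded_BV:
  fixes c :: "nat \<Rightarrow> real" and u :: "real^'n::finite \<Rightarrow> real"
  assumes "anisotropy \<Omega> \<psi> l L" and u: "u \<in> BV \<Omega>" and c: "\<And>i. i < M \<Longrightarrow> c i < c (Suc i)" and \<epsilon>: "0 < \<epsilon>" "\<epsilon> < 1"
    and \<delta>: "\<And>i. i < M \<Longrightarrow> \<delta> \<le> \<epsilon> / 2 * (c (Suc i) - c i)"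
  obtains v where "v \<in> BV_into \<Omega> (c ` {..M})" "(1 - \<epsilon>) * energy \<psi> \<Omega> v \<le> energy \<psi> \<Omega> u" "integrable (lebesgue_on \<Omega>) v"
    "AE x in lebesgue_on \<Omega>. \<forall>m\<le>M. \<bar>u x - c m\<bar> < \<delta> \<longrightarrow> v x = c m"
proof -
  interpret anisotropy \<Omega> \<psi> l L by fact
  have ui: "integrable (lebesgue_on \<Omega>) u" and uD: "\<exists>\<mu>. has_distr_deriv \<Omega> u \<mu>" using u by (auto simp: BV_def)
  have um: "u \<in> borel_measurable (lebesgue_on \<Omega>)" using ui by simp
  obtain w where w: "w \<in> borel_measurable borel" "AE x in lborel. x \<in> \<Omega> \<longrightarrow> u x = w x"
    using borel_representative[OF dom_borel um] by blast
  have wL: "L1_on \<Omega> w" using integrable_lebesgue_on_borel[OF dom_borel um w] ui w(1) by (simp add: L1_on_def)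
  have VE: "V w \<le> ennreal (energy \<psi> \<Omega> u)" by (rule V_le_energy[OF um uD wL w(2)])
  then have fin: "V w < \<infinity>" by (simp add: order_le_less_trans)
  have E0: "0 \<le> energy \<psi> \<Omega> u" unfolding energy_def using psi_nonneg by (intro Bochner_Integration.integral_nonneg) auto
  define R where "R A \<longleftrightarrow> (\<forall>i<M. A i \<in> sets borel) \<and>
    (\<forall>i x. i < M \<longrightarrow> c (Suc i) - \<epsilon> / 2 * (c (Suc i) - c i) < w x \<longrightarrow> x \<in> A i) \<and>
    (\<forall>i x. i < M \<longrightarrow> x \<in> A i \<longrightarrow> c i + \<epsilon> / 2 * (c (Suc i) - c i) \<le> w x) \<and>
    ennreal (1 - \<epsilon>) * V (\<lambda>x. c 0 + (\<Sum>i<M. (c (Suc i) - c i) * indicator (A i) x)) \<le> V w" for A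
  have "\<exists>A. R A"
    by (rule V_rounding[where w=w and c=c and M=M and \<epsilon>=\<epsilon>, OF wL fin c \<epsilon>], unfold R_def) blast+
  then obtain A where "R A" by blast
  then have A: "\<And>i. i < M \<Longrightarrow> A i \<in> sets borel"
    "\<And>i x. i < M \<Longrightarrow> c (Suc i) - \<epsilon> / 2 * (c (Suc i) - c i) < w x \<Longrightarrow> x \<in> A i"
    "\<And>i x. i < M \<Longrightarrow> x \<in> A i \<Longrightarrow> c i + \<epsilon> / 2 * (c (Suc i) - c i) \<le> w x"
    "ennreal (1 - \<epsilon>) * V (\<lambda>x. c 0 + (\<Sum>i<M. (c (Suc i) - c i) * indicator (A i) x)) \<le> V w"
    unfolding R_def by blast+
  define v where "v x = c 0 + (\<Sum>i<M. (c (Suc i) - c i) * indicator (A i) x)" for x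
  have cm: "c i \<le> c j" if "i \<le> j" "j \<le> M" for i j
    using that
  proof (induction j rule: dec_induct)
    case (step n) then show ?case using c[of n] by simp
  qed simp
  have pos: "0 < \<epsilon> / 2 * (c (Suc i) - c i)" if "i < M" for i using c[OF that] \<epsilon> by simp
  \<comment> \<open>On \<open>A j\<close> the function w exceeds \<open>c j\<close>, hence also the
    level of any earlier gap beyond which membership in its set is forced.\<close>
  have nested: "x \<in> A i" if "i \<le> j" "j < M" "x \<in> A j" for i j x
  proof (cases "i = j")
    case False
    then have "c (Suc i) \<le> c j" using that by (intro cm) auto
    then have "c (Suc i) - \<epsilon> / 2 * (c (Suc i) - c i) < w x" using A(3)[OF that(2,3)] pos[of i] pos[of j] that by linarith
    then show ?thesis using A(2) that by simp
  qed (use that in simp)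
  have vT: "v x \<in> c ` {..M}" for x
  proof -
    \<comment> \<open>M is the default for points that lie in all the sets.\<close>
    define m where "m = (LEAST m. m = M \<or> x \<notin> A m)"
    have m: "m = M \<or> x \<notin> A m" unfolding m_def by (rule LeastI[of _ M]) simp
    have "m \<le> M" unfolding m_def by (rule Least_le) simp
    moreover have "x \<in> A i \<longleftrightarrow> i < m" if "i < M" for i
    proof
      assume "x \<in> A i"
      then show "i < m" using nested[of m i x] m that by (metis linorder_not_le)
    next
      assume "i < m"
      then show "x \<in> A i" using not_less_Least[of i "\<lambda>m. m = M \<or> x \<notin> A m"] unfolding m_def by blast
    qed
    ultimately have "v x = c m" unfolding v_def by (rule sum_indicator_initial_segment)
    with \<open>m \<le> M\<close> show ?thesis by simp
  qed
  have close: "v x = c m" if "m \<le> M" "\<bar>w x - c m\<bar> < \<delta>" for x m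
    unfolding v_def
  proof (rule sum_indicator_initial_segment[OF that(1)])
    fix i assume i: "i < M"
    show "x \<in> A i \<longleftrightarrow> i < m"
    proof
      assume "x \<in> A i"
      then have a: "c i + \<epsilon> / 2 * (c (Suc i) - c i) \<le> w x" by (rule A(3)[OF i])
      show "i < m"
      proof (rule ccontr)
        assume "\<not> i < m"
        then have "c m \<le> c i" using i by (intro cm) auto
        then show False using a that(2) \<delta>[OF i] by linarith
      qed
    next
      assume "i < m"
      then have "c (Suc i) \<le> c m" using that(1) by (intro cm) auto
      then show "x \<in> A i" using that(2) \<delta>[OF i] by (intro A(2)[OF i]) linarith
    qed
  qed
  have vm: "v \<in> borel_measurable borel" unfolding v_def[abs_def] using A(1) by measurable
  have vL: "L1_on \<Omega> v"
  proof (rule L1_on_bound[OF vm _ L1_on_const[of 0]])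
    fix x
    have "finite (c ` {..M})" by simp
    then have "\<bar>v x\<bar> \<le> Max (abs ` c ` {..M})" using vT[of x] by (intro Max_ge) auto
    then show "\<bar>v x\<bar> \<le> Max (abs ` c ` {..M}) + \<bar>0\<bar>" by simp
  qed
  have vlm: "v \<in> borel_measurable (lebesgue_on \<Omega>)" using vm by (intro measurable_restrict_space1 measurable_completion) simp
  have Vv: "V v \<le> ennreal (energy \<psi> \<Omega> u / (1 - \<epsilon>))"
  proof -
    have "V v = ennreal (1 / (1 - \<epsilon>)) * (ennreal (1 - \<epsilon>) * V v)"
      using \<epsilon> by (simp add: mult.assoc[symmetric] ennreal_mult'[symmetric])
    also have "\<dots> \<le> ennreal (1 / (1 - \<epsilon>)) * ennreal (energy \<psi> \<Omega> u)"
      using A(4) VE unfolding v_def[abs_def] by (intro mult_left_mono) auto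
    also have "\<dots> = ennreal (energy \<psi> \<Omega> u / (1 - \<epsilon>))" using \<epsilon> E0 by (simp add: ennreal_mult'[symmetric])
    finally show ?thesis .
  qed
  have vD: "\<exists>\<mu>. has_distr_deriv \<Omega> v \<mu>"
    using Vv by (intro V_finite_imp_distr_deriv[OF vL]) (simp add: order_le_less_trans)
  show ?thesis
  proof (rule that[of v])
    show "v \<in> BV_into \<Omega> (c ` {..M})" unfolding BV_into_def using vlm vT vD by blast
    have "energy \<psi> \<Omega> v \<le> energy \<psi> \<Omega> u / (1 - \<epsilon>)"
      using E0 \<epsilon> by (intro energy_le_V[OF vlm vD vL _ _ Vv]) auto
    then show "(1 - \<epsilon>) * energy \<psi> \<Omega> v \<le> energy \<psi> \<Omega> u" using \<epsilon> by (simp add: field_simps)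
    show "integrable (lebesgue_on \<Omega>) v"
      using integrable_lebesgue_on_borel[OF dom_borel vlm vm] vL by (simp add: L1_on_def)
    have "AE x in lebesgue_on \<Omega>. u x = w x"
      using AE_completion[OF w(2)] open_dom by (subst AE_restrict_space_iff) auto
    then show "AE x in lebesgue_on \<Omega>. \<forall>m\<le>M. \<bar>u x - c m\<bar> < \<delta> \<longrightarrow> v x = c m"
      by eventually_elim (use close in auto)
  qed
qed

theorem proposition5p6:
  fixes \<Omega> :: "(real^'n::finite) set"
    and T :: "real set"
    and l L :: real
    and \<psi> :: "nat \<Rightarrow> real^'n \<Rightarrow> real^'n \<Rightarrow> real"
    and u :: "nat \<Rightarrow> real^'n \<Rightarrow> real"
    and u0 :: "real^'n \<Rightarrow> real"
  assumes "finite T" and "T \<noteq> {}"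
    and "open \<Omega>" and "bounded \<Omega>" and "lipschitz_boundary \<Omega>"
    and "0 < l" and "l \<le> L"
    and "\<And>k. \<psi> k \<in> class_G l L"
    and "\<And>k. u k \<in> BV \<Omega>"
    and "u0 \<in> BV_into \<Omega> T"
    and "L1_converges \<Omega> u u0"
  shows "\<forall>\<epsilon>\<in>{0<..<1}. \<exists>v :: nat \<Rightarrow> real^'n \<Rightarrow> real.
           (\<forall>k. v k \<in> BV_into \<Omega> T) \<and>
           (\<forall>k. (1 - \<epsilon>) * energy (\<psi> k) \<Omega> (v k) \<le> energy (\<psi> k) \<Omega> (u k)) \<and>
           L1_converges \<Omega> v u0"
proof
  fix \<epsilon> :: real assume "\<epsilon> \<in> {0<..<1}"
  then have \<epsilon>: "0 < \<epsilon>" "\<epsilon> < 1" by auto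
  \<comment> \<open>M is the number of gaps, so the values are \<open>c 0\<close> up to and
    including \<open>c M\<close>.\<close>
  define M where "M = card T - 1"
  define c where "c i = sorted_list_of_set T ! i" for i
  have cardT: "card T = Suc M" using assms(1,2) by (simp add: M_def card_gt_0_iff)
  have cT: "c ` {..M} = T"
  proof -
    have "set (sorted_list_of_set T) = c ` {..<card T}"
      unfolding c_def set_conv_nth using assms(1) by auto
    then show ?thesis using assms(1) cardT by (simp add: lessThan_Suc_atMost)
  qed
  have c: "c i < c (Suc i)" if "i < M" for i
    unfolding c_def using that assms(1) cardT strict_sorted_list_of_set[of T]
    by (intro sorted_wrt_nth_less[of "(<)"]) auto
  \<comment> \<open>The smallest margin over all gaps, with 1 inserted for a single-valued T. It
    depends neither on k nor on the integrands.\<close>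
  define \<delta> where "\<delta> = Min (insert 1 ((\<lambda>i. \<epsilon> / 2 * (c (Suc i) - c i)) ` {..<M}))"
  have \<delta>0: "\<delta> > 0" unfolding \<delta>_def using c \<epsilon> by (subst Min_gr_iff) auto
  have \<delta>: "\<delta> \<le> \<epsilon> / 2 * (c (Suc i) - c i)" if "i < M" for i
    unfolding \<delta>_def using that by (intro Min_le) auto
  have ani: "anisotropy \<Omega> (\<psi> k) l L" for k using assms by unfold_locales
  define R where "R k v \<longleftrightarrow> v \<in> BV_into \<Omega> T \<and> (1 - \<epsilon>) * energy (\<psi> k) \<Omega> v \<le> energy (\<psi> k) \<Omega> (u k) \<and> integrable (lebesgue_on \<Omega>) v \<and>
     (AE x in lebesgue_on \<Omega>. \<forall>m\<le>M. \<bar>u k x - c m\<bar> < \<delta> \<longrightarrow> v x = c m)" for k v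
  have "\<exists>v. R k v" for k
    by (rule rounded_BV[where \<psi>="\<psi> k" and u="u k" and c=c and M=M and \<delta>=\<delta>, OF ani assms(9) c \<epsilon> \<delta>]) (auto simp: cT R_def)
  then obtain v where "\<And>k. R k (v k)" by metis
  then have v: "\<And>k. v k \<in> BV_into \<Omega> T" "\<And>k. (1 - \<epsilon>) * energy (\<psi> k) \<Omega> (v k) \<le> energy (\<psi> k) \<Omega> (u k)"
    "\<And>k. integrable (lebesgue_on \<Omega>) (v k)" "\<And>k. AE x in lebesgue_on \<Omega>. \<forall>m\<le>M. \<bar>u k x - c m\<bar> < \<delta> \<longrightarrow> v k x = c m"
    unfolding R_def by blast+
  define D where "D = Max ((\<lambda>(s, t). \<bar>s - t\<bar>) ` (T \<times> T))"
  have D: "\<bar>s - t\<bar> \<le> D" if "s \<in> T" "t \<in> T" for s t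
    unfolding D_def using that assms(1) by (intro Max_ge) (auto intro!: image_eqI[of _ _ "(s, t)"])
  have ui: "\<And>k. integrable (lebesgue_on \<Omega>) (u k)" "integrable (lebesgue_on \<Omega>) u0"
    and ulim: "(\<lambda>k. LINT x|lebesgue_on \<Omega>. \<bar>u k x - u0 x\<bar>) \<longlonglongrightarrow> 0" using assms(11) by (auto simp: L1_converges_def)
  have u0T: "u0 x \<in> T" if "x \<in> \<Omega>" for x using assms(10) that by (simp add: BV_into_def)
  have vT: "v k x \<in> T" if "x \<in> \<Omega>" for k x using v(1)[of k] that by (simp add: BV_into_def)
  \<comment> \<open>The pointwise form of Chebyshev's inequality. Where \<open>u k\<close> is within
    \<delta> of \<open>u0\<close>, the functions \<open>v k\<close> and \<open>u0\<close> agree;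
    elsewhere they differ by at most the diameter D of T, while
    \<open>\<bar>u k x - u0 x\<bar> / \<delta>\<close> is at least 1.\<close>
  have le: "(LINT x|lebesgue_on \<Omega>. \<bar>v k x - u0 x\<bar>) \<le> D / \<delta> * (LINT x|lebesgue_on \<Omega>. \<bar>u k x - u0 x\<bar>)" for k
  proof -
    have "(LINT x|lebesgue_on \<Omega>. \<bar>v k x - u0 x\<bar>) \<le> (LINT x|lebesgue_on \<Omega>. D / \<delta> * \<bar>u k x - u0 x\<bar>)"
    proof (rule integral_mono_AE)
      show "integrable (lebesgue_on \<Omega>) (\<lambda>x. \<bar>v k x - u0 x\<bar>)" "integrable (lebesgue_on \<Omega>) (\<lambda>x. D / \<delta> * \<bar>u k x - u0 x\<bar>)"
        using v(3) ui by auto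
      show "AE x in lebesgue_on \<Omega>. \<bar>v k x - u0 x\<bar> \<le> D / \<delta> * \<bar>u k x - u0 x\<bar>"
        using v(4)[of k] AE_space
      proof eventually_elim
        fix x assume close: "\<forall>m\<le>M. \<bar>u k x - c m\<bar> < \<delta> \<longrightarrow> v k x = c m" and "x \<in> space (lebesgue_on \<Omega>)"
        then have x: "x \<in> \<Omega>" by simp
        obtain m where m: "m \<le> M" "u0 x = c m" using u0T[OF x] cT by auto
        have D0: "0 \<le> D" using D[OF u0T[OF x] u0T[OF x]] by simp
        show "\<bar>v k x - u0 x\<bar> \<le> D / \<delta> * \<bar>u k x - u0 x\<bar>"
        proof (cases "\<bar>u k x - c m\<bar> < \<delta>")
          case True
          then show ?thesis using close m D0 \<delta>0 by simp
        next
          case False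
          have "\<bar>v k x - u0 x\<bar> \<le> D" by (rule D[OF vT[OF x] u0T[OF x]])
          also have "\<dots> = D / \<delta> * \<delta>" using \<delta>0 by simp
          also have "\<dots> \<le> D / \<delta> * \<bar>u k x - u0 x\<bar>" using False m D0 \<delta>0 by (intro mult_left_mono) auto
          finally show ?thesis .
        qed
      qed
    qed
    then show ?thesis by simp
  qed
  have "(\<lambda>k. LINT x|lebesgue_on \<Omega>. \<bar>v k x - u0 x\<bar>) \<longlonglongrightarrow> 0"
  proof (rule tendsto_sandwich[of "\<lambda>_. 0" _ _ "\<lambda>k. D / \<delta> * (LINT x|lebesgue_on \<Omega>. \<bar>u k x - u0 x\<bar>)"])
    show "(\<lambda>k. D / \<delta> * (LINT x|lebesgue_on \<Omega>. \<bar>u k x - u0 x\<bar>)) \<longlonglongrightarrow> 0" using tendsto_mult_left[OF ulim, of "D / \<delta>"] by simp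
  qed (use le in \<open>auto intro!: always_eventually Bochner_Integration.integral_nonneg\<close>)
  then have "L1_converges \<Omega> v u0" using v(3) ui(2) by (simp add: L1_converges_def)
  with v(1,2) show "\<exists>v :: nat \<Rightarrow> real^'n \<Rightarrow> real.
           (\<forall>k. v k \<in> BV_into \<Omega> T) \<and>
           (\<forall>k. (1 - \<epsilon>) * energy (\<psi> k) \<Omega> (v k) \<le> energy (\<psi> k) \<Omega> (u k)) \<and>
           L1_converges \<Omega> v u0" by blast
qed


end
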